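(* Let $X$ be a compact Hausdorff space with $\pi_1(X)=\Gamma$ a finitely generated group. Let $\{U_i\}_{i\in I}$ be a finite open covering of $X$, let $\varphi_i$, $i\in I$, be continuous functions on $X$ with $0\le\varphi_i(x)\le 1$, $\operatorname{supp}\varphi_i\subset U_i$ and $\sum_{i\in I}\varphi_i^2(x)=1$ for all $x\in X$, and let $\{\gamma_{ij}\}_{i,j\in I}$ be a $\Gamma$-valued cocycle, i.e. $\gamma_{ij}\in\Gamma$, $\gamma_{ji}=\gamma_{ij}^{-1}$ for all $i,j\in I$, and $\gamma_{ij}\gamma_{jk}=\gamma_{ik}$ whenever $U_i\cap U_j\cap U_k\neq\emptyset$. For a map $\pi:\Gamma\to M_n$ put $$A_\pi(x)=(\varphi_i(x)\varphi_j(x)\pi(\gamma_{ij}))_{i,j\in I},\qquad x\in X.$$ Then there exist a finite set $F_0\subset\Gamma$ and $\varepsilon_0>0$ such that for every finite $F\supset F_0$, every $0<\varepsilon\le\varepsilon_0$, every $n$, and every $(F,\varepsilon)$-balanced pair $(\pi^+,\pi^-)$ of maps $\Gamma\to M_n$, the element $P''(A_{\pi^+},A_{\pi^-})$ is an almost projection over $C(X)$, so that $$[P''(A_{\pi^+},A_{\pi^-})]-\left[\begin{pmatrix}1&0\\0&0\end{pmatrix}\right]$$ determines a class in $K^0(X)$.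
   Context: $M_n$ denotes the $C^*$-algebra of operators on the $n$-dimensional Hilbert space. For a map $\pi:\Gamma\to M_n$ and $g,h\in\Gamma$ put $M_\pi(g,h)=\pi(gh)-\pi(g)\pi(h)$. For a finite set $F\subset\Gamma$ and $\varepsilon>0$, a pair $(\pi^+,\pi^-)$ of maps $\Gamma\to M_n$ satisfying $\pi^\pm(g^{-1})=\pi^\pm(g)^*$ for all $g\in F$ is $(F,\varepsilon)$-balanced if $\|M_{\pi^+}(g,h)-M_{\pi^-}(g,h)\|<\varepsilon$ for all $g,h\in F$, and $\|\pi^+(k)M_{\pi^+}(g,h)-\pi^-(k)M_{\pi^-}(g,h)\|<\varepsilon$ for all $g,h,k\in F$. For elements $a,b$ of a unital $C^*$-algebra, $$P''(a,b)=\begin{pmatrix}1+(1-a)(a-b)(1-a)&(1-a)(b-a)a\\ a(b-a)(1-a)&a(a-b)a\end{pmatrix}.$$ Here $A_{\pi^\pm}$ are regarded as elements of $C(X;M_{|I|n})$, and $1$ in $\begin{pmatrix}1&0\\0&0\end{pmatrix}$ is the unit of this algebra. An almost projection is a selfadjoint element $A$ with $\|A^2-A\|<\frac14$. It determines a $K_0$-class, denoted $[A]$, namely the class of the spectral projection of $A$ corresponding to the part of its spectrum in $(\frac12,\infty)$ (note $\frac12$ is not in the spectrum). $K^0(X)$ is identified with $K_0(C(X))$. *)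

theory Defs
  imports
    "HOL-Analysis.Homotopy"
    "HOL-Analysis.L2_Norm"
    "HOL-Algebra.Generated_Groups"
    "Jordan_Normal_Form.Schur_Decomposition"
begin

section \<open>The fundamental group\<close>

definition loops_at :: "'a::topological_space set \<Rightarrow> 'a \<Rightarrow> (real \<Rightarrow> 'a) set" where
  "loops_at X x0 =
     {p. path p \<and> path_image p \<subseteq> X \<and> pathstart p = x0 \<and> pathfinish p = x0}"

definition loop_rel :: "'a::topological_space set \<Rightarrow> 'a \<Rightarrow> (real \<Rightarrow> 'a) rel" where
  "loop_rel X x0 = {(p, q). p \<in> loops_at X x0 \<and> q \<in> loops_at X x0 \<and> homotopic_paths X p q}"

definition fundamental_group :: "'a::topological_space set \<Rightarrow> 'a \<Rightarrow> (real \<Rightarrow> 'a) set monoid" where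
  "fundamental_group X x0 =
     \<lparr>carrier = loops_at X x0 // loop_rel X x0,
      monoid.mult = (\<lambda>a b. \<Union>p\<in>a. \<Union>q\<in>b. loop_rel X x0 `` {p +++ q}),
      monoid.one = loop_rel X x0 `` {\<lambda>_. x0}\<rparr>"

definition finitely_generated_group :: "('g, 'b) monoid_scheme \<Rightarrow> bool" where
  "finitely_generated_group G \<longleftrightarrow>
     group G \<and> (\<exists>S. finite S \<and> S \<subseteq> carrier G \<and> generate G S = carrier G)"

section \<open>Matrix algebras over \<open>C(X)\<close>\<close>

definition vec_l2norm :: "complex vec \<Rightarrow> real" where
  "vec_l2norm v = L2_set (\<lambda>i. cmod (vec_index v i)) {..<dim_vec v}"

definition op_norm :: "complex mat \<Rightarrow> real" where
  "op_norm A = (SUP v \<in> {v \<in> carrier_vec (dim_col A). vec_l2norm v \<le> 1}. vec_l2norm (A *\<^sub>v v))"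

text \<open>Elements of \<open>C(X; M\<^bsub>r\<times>c\<^esub>)\<close> are represented by matrix-valued functions on the whole type,
  of which only the values on \<open>X\<close> matter. Algebraic operations are pointwise.\<close>

definition cont_mat ::
  "'a::topological_space set \<Rightarrow> nat \<Rightarrow> nat \<Rightarrow> ('a \<Rightarrow> complex mat) \<Rightarrow> bool" where
  "cont_mat X r c A \<longleftrightarrow>
     (\<forall>x\<in>X. A x \<in> carrier_mat r c) \<and>
     (\<forall>i<r. \<forall>j<c. continuous_on X (\<lambda>x. A x $$ (i, j)))"

definition sup_op_norm :: "'a set \<Rightarrow> ('a \<Rightarrow> complex mat) \<Rightarrow> real" where
  "sup_op_norm X A = (SUP x\<in>X. op_norm (A x))"

definition almost_projection ::
  "'a::topological_space set \<Rightarrow> nat \<Rightarrow> ('a \<Rightarrow> complex mat) \<Rightarrow> bool" where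
  "almost_projection X k A \<longleftrightarrow>
     cont_mat X k k A \<and> (\<forall>x\<in>X. mat_adjoint (A x) = A x) \<and>
     sup_op_norm X (\<lambda>x. A x * A x - A x) < 1/4"

text \<open>For a selfadjoint matrix \<open>A\<close>, the spectral projection of \<open>A\<close> corresponding to \<open>(1/2, \<infinity>)\<close>:
  it is the identity on the eigenspaces for eigenvalues in \<open>(1/2, \<infinity>)\<close> and vanishes on the others.
  As the eigenvectors of \<open>A\<close> span the space, this determines it. The spectral projection of
  an element of \<open>C(X; M\<^sub>k)\<close> is computed pointwise.\<close>

definition spectral_projection :: "complex mat \<Rightarrow> complex mat" where
  "spectral_projection A =
     (THE P. P \<in> carrier_mat (dim_row A) (dim_row A) \<and>
        (\<forall>v e. eigenvector A v e \<longrightarrow>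
           P *\<^sub>v v = (if 1/2 < Re e then v else 0\<^sub>v (dim_row A))))"

section \<open>The group \<open>K\<^sub>0(C(X))\<close>\<close>

text \<open>The Grothendieck group of the monoid of Murray--von Neumann equivalence classes of
  projections in matrix algebras (of arbitrary size) over \<open>C(X)\<close>.\<close>

definition projections :: "'a::topological_space set \<Rightarrow> ('a \<Rightarrow> complex mat) set" where
  "projections X =
     {p. \<exists>k. cont_mat X k k p \<and> (\<forall>x\<in>X. mat_adjoint (p x) = p x \<and> p x * p x = p x)}"

definition mvn_equiv ::
  "'a::topological_space set \<Rightarrow> ('a \<Rightarrow> complex mat) \<Rightarrow> ('a \<Rightarrow> complex mat) \<Rightarrow> bool" where
  "mvn_equiv X p q \<longleftrightarrow>
     (\<exists>r c v. cont_mat X r c v \<and>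
        (\<forall>x\<in>X. p x = mat_adjoint (v x) * v x \<and> q x = v x * mat_adjoint (v x)))"

definition diag_sum :: "('a \<Rightarrow> complex mat) \<Rightarrow> ('a \<Rightarrow> complex mat) \<Rightarrow> 'a \<Rightarrow> complex mat"
    (infixr \<open>\<oplus>\<^sub>d\<close> 65) where
  "p \<oplus>\<^sub>d q = (\<lambda>x. four_block_mat (p x) (0\<^sub>m (dim_row (p x)) (dim_col (q x)))
                               (0\<^sub>m (dim_row (q x)) (dim_col (p x))) (q x))"

definition K0_rel ::
  "'a::topological_space set \<Rightarrow> (('a \<Rightarrow> complex mat) \<times> ('a \<Rightarrow> complex mat)) rel" where
  "K0_rel X =
     {((p, q), (p', q')). {p, q, p', q'} \<subseteq> projections X \<and>
        (\<exists>r\<in>projections X. mvn_equiv X (p \<oplus>\<^sub>d q' \<oplus>\<^sub>d r) (p' \<oplus>\<^sub>d q \<oplus>\<^sub>d r))}"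

text \<open>The class of the pair \<open>(p, q)\<close> is the formal difference \<open>[p] - [q]\<close>. The group is written
  multiplicatively, as always in \<open>HOL-Algebra\<close>.\<close>

definition K0 ::
  "'a::topological_space set \<Rightarrow> (('a \<Rightarrow> complex mat) \<times> ('a \<Rightarrow> complex mat)) set monoid" where
  "K0 X =
     \<lparr>carrier = (projections X \<times> projections X) // K0_rel X,
      monoid.mult = (\<lambda>a b. \<Union>(p, q)\<in>a. \<Union>(p', q')\<in>b. K0_rel X `` {(p \<oplus>\<^sub>d p', q \<oplus>\<^sub>d q')}),
      monoid.one = K0_rel X `` {(\<lambda>_. 0\<^sub>m 0 0, \<lambda>_. 0\<^sub>m 0 0)}\<rparr>"

definition K0_class ::
  "'a::topological_space set \<Rightarrow> ('a \<Rightarrow> complex mat) \<Rightarrow>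
     (('a \<Rightarrow> complex mat) \<times> ('a \<Rightarrow> complex mat)) set" where
  "K0_class X A = K0_rel X `` {(\<lambda>x. spectral_projection (A x), \<lambda>_. 0\<^sub>m 0 0)}"

subsection \<open>It is an abelian group\<close>

lemma dim_mat_adjoint [simp]:
  "dim_row (mat_adjoint A) = dim_col A" "dim_col (mat_adjoint A) = dim_row A"
  by (auto simp: mat_adjoint_def mat_of_rows_def)

lemma index_mat_adjoint [simp]:
  fixes A :: "complex mat"
  shows "i < dim_col A \<Longrightarrow> j < dim_row A \<Longrightarrow> mat_adjoint A $$ (i, j) = cnj (A $$ (j, i))"
  by (auto simp: mat_adjoint_def mat_of_rows_index)

lemma mat_adjoint_carrier [simp]:
  "A \<in> carrier_mat r c \<Longrightarrow> mat_adjoint A \<in> carrier_mat c r"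
  by (metis carrier_matD carrier_matI dim_mat_adjoint)

lemma mat_adjoint_adjoint [simp]: "mat_adjoint (mat_adjoint A) = (A :: complex mat)"
  by (rule eq_matI) auto

lemma mat_adjoint_mult:
  fixes A B :: "complex mat"
  assumes "A \<in> carrier_mat r m" "B \<in> carrier_mat m c"
  shows "mat_adjoint (A * B) = mat_adjoint B * mat_adjoint A"
  using assms by (intro eq_matI) (auto simp: scalar_prod_def mult.commute intro!: sum.cong)

lemma cont_mat_mult:
  assumes "cont_mat X r m A" "cont_mat X m c B"
  shows "cont_mat X r c (\<lambda>x. A x * B x)"
proof -
  have "continuous_on X (\<lambda>x. (A x * B x) $$ (i, j))" if "i < r" "j < c" for i j
  proof -
    have "continuous_on X (\<lambda>x. \<Sum>k<m. A x $$ (i, k) * B x $$ (k, j))"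
      by (intro continuous_on_sum continuous_on_mult) (use assms that in \<open>auto simp: cont_mat_def\<close>)
    moreover have "(A x * B x) $$ (i, j) = (\<Sum>k<m. A x $$ (i, k) * B x $$ (k, j))" if "x \<in> X" for x
    proof -
      have "A x \<in> carrier_mat r m" "B x \<in> carrier_mat m c"
        using assms that by (simp_all add: cont_mat_def)
      then show ?thesis using \<open>i < r\<close> \<open>j < c\<close>
        by (simp add: scalar_prod_def atLeast0LessThan)
    qed
    ultimately show ?thesis by (simp cong: continuous_on_cong)
  qed
  then show ?thesis using assms by (auto simp: cont_mat_def)
qed

lemma cont_mat_adjoint:
  assumes "cont_mat X r c A"
  shows "cont_mat X c r (\<lambda>x. mat_adjoint (A x))"
proof -
  have "continuous_on X (\<lambda>x. mat_adjoint (A x) $$ (i, j))" if "i < c" "j < r" for i j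
  proof -
    have "continuous_on X (\<lambda>x. cnj (A x $$ (j, i)))"
      by (intro continuous_on_cnj) (use assms that in \<open>auto simp: cont_mat_def\<close>)
    moreover have "mat_adjoint (A x) $$ (i, j) = cnj (A x $$ (j, i))" if "x \<in> X" for x
    proof -
      have "A x \<in> carrier_mat r c"
        using assms that by (simp add: cont_mat_def)
      then show ?thesis using \<open>i < c\<close> \<open>j < r\<close> by simp
    qed
    ultimately show ?thesis by (simp cong: continuous_on_cong)
  qed
  then show ?thesis using assms by (auto simp: cont_mat_def)
qed

lemma cont_mat_four_block:
  assumes "cont_mat X r1 c1 A" "cont_mat X r1 c2 B" "cont_mat X r2 c1 C" "cont_mat X r2 c2 D"
  shows "cont_mat X (r1 + r2) (c1 + c2) (\<lambda>x. four_block_mat (A x) (B x) (C x) (D x))"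
proof -
  have "continuous_on X (\<lambda>x. four_block_mat (A x) (B x) (C x) (D x) $$ (i, j))"
    if ij: "i < r1 + r2" "j < c1 + c2" for i j
  proof -
    have "four_block_mat (A x) (B x) (C x) (D x) $$ (i, j) =
       (if i < r1 then if j < c1 then A x $$ (i, j) else B x $$ (i, j - c1)
        else if j < c1 then C x $$ (i - r1, j) else D x $$ (i - r1, j - c1))" if "x \<in> X" for x
    proof -
      have "A x \<in> carrier_mat r1 c1" "D x \<in> carrier_mat r2 c2"
        using assms that by (simp_all add: cont_mat_def)
      then show ?thesis using ij by simp
    qed
    moreover have "continuous_on X (\<lambda>x. (if i < r1 then if j < c1 then A x $$ (i, j) else B x $$ (i, j - c1)
        else if j < c1 then C x $$ (i - r1, j) else D x $$ (i - r1, j - c1)))"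
    proof -
      have "i - r1 < r2" if "\<not> i < r1" using ij that by simp
      moreover have "j - c1 < c2" if "\<not> j < c1" using ij that by simp
      ultimately show ?thesis using assms ij unfolding cont_mat_def
        by (cases "i < r1"; cases "j < c1") simp_all
    qed
    ultimately show ?thesis by (simp cong: continuous_on_cong)
  qed
  then show ?thesis using assms by (auto simp: cont_mat_def)
qed

lemma cont_mat_const: "A \<in> carrier_mat r c \<Longrightarrow> cont_mat X r c (\<lambda>_. A)"
  by (auto simp: cont_mat_def)

lemma cont_mat_cong: "(\<And>x. x \<in> X \<Longrightarrow> A x = B x) \<Longrightarrow> cont_mat X r c A = cont_mat X r c B"
  by (auto simp: cont_mat_def cong: continuous_on_cong)

lemma cont_mat_diag_sum:
  assumes "cont_mat X r1 c1 p" "cont_mat X r2 c2 q"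
  shows "cont_mat X (r1 + r2) (c1 + c2) (p \<oplus>\<^sub>d q)"
proof -
  have "cont_mat X (r1 + r2) (c1 + c2) (\<lambda>x. four_block_mat (p x) (0\<^sub>m r1 c2) (0\<^sub>m r2 c1) (q x))"
    using assms by (intro cont_mat_four_block cont_mat_const) auto
  moreover have "(p \<oplus>\<^sub>d q) x = four_block_mat (p x) (0\<^sub>m r1 c2) (0\<^sub>m r2 c1) (q x)" if "x \<in> X" for x
  proof -
    have "p x \<in> carrier_mat r1 c1" "q x \<in> carrier_mat r2 c2"
      using assms that by (simp_all add: cont_mat_def)
    then show ?thesis by (simp add: diag_sum_def)
  qed
  ultimately show ?thesis by (simp cong: cont_mat_cong)
qed

abbreviation (input) zero_proj :: "'a \<Rightarrow> complex mat" where "zero_proj \<equiv> \<lambda>_. 0\<^sub>m 0 0"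

lemma diag_sum_zero [simp]: "p \<oplus>\<^sub>d zero_proj = p" "zero_proj \<oplus>\<^sub>d p = p"
  by (auto simp: diag_sum_def fun_eq_iff)

lemma diag_sum_assoc: "(p \<oplus>\<^sub>d q) \<oplus>\<^sub>d r = p \<oplus>\<^sub>d q \<oplus>\<^sub>d r"
proof
  fix x
  show "((p \<oplus>\<^sub>d q) \<oplus>\<^sub>d r) x = (p \<oplus>\<^sub>d q \<oplus>\<^sub>d r) x"
    using assoc_four_block_mat[of "p x" "q x" "r x"] by (simp add: diag_sum_def)
qed

lemma mult_diag_block:
  fixes A B :: "complex mat"
  assumes "A1 \<in> carrier_mat r1 m1" "A2 \<in> carrier_mat r2 m2"
    "B1 \<in> carrier_mat m1 c1" "B2 \<in> carrier_mat m2 c2"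
  shows "four_block_mat A1 (0\<^sub>m r1 m2) (0\<^sub>m r2 m1) A2 * four_block_mat B1 (0\<^sub>m m1 c2) (0\<^sub>m m2 c1) B2
    = four_block_mat (A1 * B1) (0\<^sub>m r1 c2) (0\<^sub>m r2 c1) (A2 * (B2 :: complex mat))"
  using assms by (subst mult_four_block_mat[of _ r1 m1 _ m2 _ r2 _ _ c1 _ c2]) auto

lemma adjoint_diag_block:
  assumes "A \<in> carrier_mat r1 c1" "B \<in> carrier_mat r2 c2"
  shows "mat_adjoint (four_block_mat A (0\<^sub>m r1 c2) (0\<^sub>m r2 c1) (B :: complex mat)) =
    four_block_mat (mat_adjoint A) (0\<^sub>m c1 r2) (0\<^sub>m c2 r1) (mat_adjoint B)"
  using assms by (intro eq_matI) auto

lemma projections_diag_sum: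
  assumes "p \<in> projections X" "q \<in> projections X"
  shows "p \<oplus>\<^sub>d q \<in> projections X"
proof -
  obtain k where p: "cont_mat X k k p" "\<And>x. x \<in> X \<Longrightarrow> mat_adjoint (p x) = p x \<and> p x * p x = p x"
    using assms by (auto simp: projections_def)
  obtain l where q: "cont_mat X l l q" "\<And>x. x \<in> X \<Longrightarrow> mat_adjoint (q x) = q x \<and> q x * q x = q x"
    using assms by (auto simp: projections_def)
  have "mat_adjoint ((p \<oplus>\<^sub>d q) x) = (p \<oplus>\<^sub>d q) x \<and> (p \<oplus>\<^sub>d q) x * (p \<oplus>\<^sub>d q) x = (p \<oplus>\<^sub>d q) x" if "x \<in> X" for x
  proof -
    have c: "p x \<in> carrier_mat k k" "q x \<in> carrier_mat l l" using p q that by (auto simp: cont_mat_def)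
    then have "(p \<oplus>\<^sub>d q) x = four_block_mat (p x) (0\<^sub>m k l) (0\<^sub>m l k) (q x)" by (auto simp: diag_sum_def)
    then show ?thesis
      using adjoint_diag_block[OF c] mult_diag_block[OF c c] p(2)[OF that] q(2)[OF that] by simp
  qed
  then show ?thesis using cont_mat_diag_sum[OF p(1) q(1)] by (auto simp: projections_def)
qed

lemma zero_proj_in [simp]: "zero_proj \<in> projections X"
  by (auto simp: projections_def intro!: exI[of _ 0] cont_mat_const eq_matI)

lemma mvn_refl: "p \<in> projections X \<Longrightarrow> mvn_equiv X p p"
  by (force simp: projections_def mvn_equiv_def)

lemma mvn_sym: assumes "mvn_equiv X p q" shows "mvn_equiv X q p"
proof -
  obtain r c v where v: "cont_mat X r c v"
    "\<forall>x\<in>X. p x = mat_adjoint (v x) * v x \<and> q x = v x * mat_adjoint (v x)"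
    using assms by (auto simp: mvn_equiv_def)
  show ?thesis unfolding mvn_equiv_def
    by (rule exI[of _ c], rule exI[of _ r], rule exI[of _ "\<lambda>x. mat_adjoint (v x)"])
      (use v cont_mat_adjoint in auto)
qed

lemma mvn_trans:
  assumes "mvn_equiv X p q" "mvn_equiv X q s" "p \<in> projections X" "q \<in> projections X" "s \<in> projections X"
  shows "mvn_equiv X p s"
proof (cases "X = {}")
  case True then show ?thesis by (auto simp: mvn_equiv_def cont_mat_def)
next
  case False
  then obtain x0 where x0: "x0 \<in> X" by auto
  obtain r c v where v: "cont_mat X r c v"
    and v': "\<And>x. x\<in>X \<Longrightarrow> p x = mat_adjoint (v x) * v x \<and> q x = v x * mat_adjoint (v x)"
    using assms by (auto simp: mvn_equiv_def)
  obtain r' c' w where w: "cont_mat X r' c' w"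
    and w': "\<And>x. x\<in>X \<Longrightarrow> q x = mat_adjoint (w x) * w x \<and> s x = w x * mat_adjoint (w x)"
    using assms by (auto simp: mvn_equiv_def)
  have "c' = r"
  proof -
    have "dim_row (q x0) = r" using v'[OF x0] v x0 by (auto simp: cont_mat_def)
    moreover have "dim_row (q x0) = c'" using w'[OF x0] w x0 by (auto simp: cont_mat_def)
    ultimately show ?thesis by simp
  qed
  have "p x = mat_adjoint (w x * v x) * (w x * v x) \<and> s x = (w x * v x) * mat_adjoint (w x * v x)"
    if x: "x \<in> X" for x
  proof -
    have cv: "v x \<in> carrier_mat r c" and cw: "w x \<in> carrier_mat r' r"
      using v w x \<open>c' = r\<close> by (auto simp: cont_mat_def)
    note [simp] = mat_adjoint_carrier[OF cv] mat_adjoint_carrier[OF cw] cv cw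
    have pp: "p x * p x = p x" "s x * s x = s x" using assms x by (auto simp: projections_def)
    have ad: "mat_adjoint (w x * v x) = mat_adjoint (v x) * mat_adjoint (w x)"
      by (rule mat_adjoint_mult[OF cw cv])
    have "mat_adjoint (w x * v x) * (w x * v x)
        = mat_adjoint (v x) * ((mat_adjoint (w x) * w x) * v x)"
      unfolding ad by (simp add: assoc_mult_mat[of _ c r _ r' _ c] assoc_mult_mat[of _ r r' _ r _ c] mult_carrier_mat[of _ r' r])
    also have "\<dots> = mat_adjoint (v x) * ((v x * mat_adjoint (v x)) * v x)" using v'[OF x] w'[OF x] by simp
    also have "\<dots> = (mat_adjoint (v x) * v x) * (mat_adjoint (v x) * v x)"
      by (simp add: assoc_mult_mat[of _ c r _ c _ c] assoc_mult_mat[of _ r c _ r _ c] mult_carrier_mat[of _ c r _ c])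
    also have "\<dots> = p x" using v'[OF x] pp by simp
    finally have 1: "p x = mat_adjoint (w x * v x) * (w x * v x)" by simp
    have "(w x * v x) * mat_adjoint (w x * v x) = w x * ((v x * mat_adjoint (v x)) * mat_adjoint (w x))"
      unfolding ad by (simp add: assoc_mult_mat[of _ r' r _ c _ r'] assoc_mult_mat[of _ r c _ r _ r'] mult_carrier_mat[of _ c r])
    also have "\<dots> = w x * ((mat_adjoint (w x) * w x) * mat_adjoint (w x))" using v'[OF x] w'[OF x] by simp
    also have "\<dots> = (w x * mat_adjoint (w x)) * (w x * mat_adjoint (w x))"
      by (simp add: assoc_mult_mat[of _ r' r _ r' _ r'] assoc_mult_mat[of _ r r' _ r _ r'] mult_carrier_mat[of _ r' r _ r'])
    also have "\<dots> = s x" using w'[OF x] pp by simp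
    finally show ?thesis using 1 by simp
  qed
  moreover have "cont_mat X r' c (\<lambda>x. w x * v x)" using cont_mat_mult w v \<open>c' = r\<close> by blast
  ultimately show ?thesis unfolding mvn_equiv_def by blast
qed

lemma mvn_diag_sum:
  assumes "mvn_equiv X p p'" "mvn_equiv X q q'"
  shows "mvn_equiv X (p \<oplus>\<^sub>d q) (p' \<oplus>\<^sub>d q')"
proof -
  obtain r c v where v: "cont_mat X r c v"
    and v': "\<And>x. x\<in>X \<Longrightarrow> p x = mat_adjoint (v x) * v x \<and> p' x = v x * mat_adjoint (v x)"
    using assms by (auto simp: mvn_equiv_def)
  obtain r' c' w where w: "cont_mat X r' c' w"
    and w': "\<And>x. x\<in>X \<Longrightarrow> q x = mat_adjoint (w x) * w x \<and> q' x = w x * mat_adjoint (w x)"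
    using assms by (auto simp: mvn_equiv_def)
  have "(p \<oplus>\<^sub>d q) x = mat_adjoint ((v \<oplus>\<^sub>d w) x) * (v \<oplus>\<^sub>d w) x \<and>
        (p' \<oplus>\<^sub>d q') x = (v \<oplus>\<^sub>d w) x * mat_adjoint ((v \<oplus>\<^sub>d w) x)" if x: "x \<in> X" for x
  proof -
    have c: "v x \<in> carrier_mat r c" "w x \<in> carrier_mat r' c'" using v w x by (auto simp: cont_mat_def)
    then have "(v \<oplus>\<^sub>d w) x = four_block_mat (v x) (0\<^sub>m r c') (0\<^sub>m r' c) (w x)" by (auto simp: diag_sum_def)
    then show ?thesis
      using c v'[OF x] w'[OF x]
      by (simp add: adjoint_diag_block[OF c] mult_diag_block[of _ r c _ r' c' _ r _ r'] mult_diag_block[of _ c r _ c' r' _ c _ c'] diag_sum_def)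
  qed
  then show ?thesis using cont_mat_diag_sum[OF v w] unfolding mvn_equiv_def by blast
qed

lemma mvn_diag_sum_commute:
  assumes "p \<in> projections X" "q \<in> projections X"
  shows "mvn_equiv X (p \<oplus>\<^sub>d q) (q \<oplus>\<^sub>d p)"
proof -
  obtain k where p: "cont_mat X k k p" "\<And>x. x \<in> X \<Longrightarrow> mat_adjoint (p x) = p x \<and> p x * p x = p x"
    using assms by (auto simp: projections_def)
  obtain l where q: "cont_mat X l l q" "\<And>x. x \<in> X \<Longrightarrow> mat_adjoint (q x) = q x \<and> q x * q x = q x"
    using assms by (auto simp: projections_def)
  define v where "v = (\<lambda>x. four_block_mat (0\<^sub>m l k) (q x) (p x) (0\<^sub>m k l))"
  have cv: "cont_mat X (l + k) (k + l) v" unfolding v_def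
    by (intro cont_mat_four_block cont_mat_const p q) auto
  have "(p \<oplus>\<^sub>d q) x = mat_adjoint (v x) * v x \<and> (q \<oplus>\<^sub>d p) x = v x * mat_adjoint (v x)" if x: "x \<in> X" for x
  proof -
    have c: "p x \<in> carrier_mat k k" "q x \<in> carrier_mat l l" using p q x by (auto simp: cont_mat_def)
    have "mat_adjoint (v x) = four_block_mat (0\<^sub>m k l) (mat_adjoint (p x)) (mat_adjoint (q x)) (0\<^sub>m l k)"
      unfolding v_def using c by (intro eq_matI) auto
    then have ad: "mat_adjoint (v x) = four_block_mat (0\<^sub>m k l) (p x) (q x) (0\<^sub>m l k)"
      using p(2)[OF x] q(2)[OF x] by simp
    show ?thesis unfolding ad unfolding v_def using c p(2)[OF x] q(2)[OF x]
      by (simp add: mult_four_block_mat[of _ k l _ k _ l _ _ k _ l] mult_four_block_mat[of _ l k _ l _ k _ _ l _ k] diag_sum_def)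
  qed
  then show ?thesis using cv unfolding mvn_equiv_def by blast
qed

text \<open>Iterated direct sums depend, up to equivalence, only on the multiset of summands.\<close>

definition dsums :: "('a \<Rightarrow> complex mat) list \<Rightarrow> 'a \<Rightarrow> complex mat" where
  "dsums ps = foldr (\<oplus>\<^sub>d) ps zero_proj"

lemma dsums_simps [simp]: "dsums [] = zero_proj" "dsums (p # ps) = p \<oplus>\<^sub>d dsums ps"
  by (auto simp: dsums_def)

lemma dsums_append: "dsums (ps @ qs) = dsums ps \<oplus>\<^sub>d dsums qs"
  by (induction ps) (auto simp: diag_sum_assoc)

lemma dsums_in [simp]: "set ps \<subseteq> projections X \<Longrightarrow> dsums ps \<in> projections X"
  by (induction ps) (auto simp: projections_diag_sum)

lemma dsums_remove1:
  "set ps \<subseteq> projections X \<Longrightarrow> p \<in> set ps \<Longrightarrow> mvn_equiv X (dsums ps) (p \<oplus>\<^sub>d dsums (remove1 p ps))"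
proof (induction ps)
  case (Cons q ps)
  show ?case
  proof (cases "p = q")
    case True then show ?thesis using Cons.prems by (auto intro!: mvn_refl projections_diag_sum)
  next
    case False
    have P: "p \<in> projections X" "q \<in> projections X" "set ps \<subseteq> projections X" using Cons.prems by auto
    have S: "dsums (remove1 p ps) \<in> projections X" by (meson P(3) dsums_in order_trans set_remove1_subset)
    have "mvn_equiv X (q \<oplus>\<^sub>d dsums ps) (q \<oplus>\<^sub>d p \<oplus>\<^sub>d dsums (remove1 p ps))"
      using Cons P False by (intro mvn_diag_sum mvn_refl) auto
    moreover have "mvn_equiv X ((q \<oplus>\<^sub>d p) \<oplus>\<^sub>d dsums (remove1 p ps)) ((p \<oplus>\<^sub>d q) \<oplus>\<^sub>d dsums (remove1 p ps))"
      using P S by (intro mvn_diag_sum mvn_refl mvn_diag_sum_commute) auto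
    ultimately have "mvn_equiv X (q \<oplus>\<^sub>d dsums ps) (p \<oplus>\<^sub>d q \<oplus>\<^sub>d dsums (remove1 p ps))"
      unfolding diag_sum_assoc using P S
      by (elim mvn_trans) (auto intro!: projections_diag_sum mvn_refl)
    then show ?thesis using False by simp
  qed
qed auto

lemma dsums_mset:
  "mset ps = mset qs \<Longrightarrow> set ps \<subseteq> projections X \<Longrightarrow> mvn_equiv X (dsums ps) (dsums qs)"
proof (induction ps arbitrary: qs)
  case (Cons p ps)
  have sq: "set qs \<subseteq> projections X" "p \<in> set qs"
    using Cons.prems by (metis mset_eq_setD) (metis Cons.prems(1) list.set_intros(1) mset_eq_setD)
  then have "set (remove1 p qs) \<subseteq> projections X" by (meson order_trans set_remove1_subset)
  moreover have "mset ps = mset (remove1 p qs)" using Cons.prems(1) by (metis add_mset_remove_trivial mset.simps(2) mset_remove1)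
  ultimately have "mvn_equiv X (p \<oplus>\<^sub>d dsums ps) (p \<oplus>\<^sub>d dsums (remove1 p qs))"
    using Cons by (intro mvn_diag_sum mvn_refl) auto
  moreover have "mvn_equiv X (p \<oplus>\<^sub>d dsums (remove1 p qs)) (dsums qs)"
    using dsums_remove1[OF sq] by (rule mvn_sym)
  ultimately show ?case
    using Cons.prems sq \<open>set (remove1 p qs) \<subseteq> projections X\<close>
      mvn_trans[of X "p \<oplus>\<^sub>d dsums ps" "p \<oplus>\<^sub>d dsums (remove1 p qs)" "dsums qs"]
      projections_diag_sum[of p X "dsums ps"] projections_diag_sum[of p X "dsums (remove1 p qs)"]
    by simp
qed (auto intro: mvn_refl)

lemma K0_rel_iff:
  "((p, q), (p', q')) \<in> K0_rel X \<longleftrightarrow> {p, q, p', q'} \<subseteq> projections X \<and>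
     (\<exists>r\<in>projections X. mvn_equiv X (dsums [p, q', r]) (dsums [p', q, r]))"
  by (simp add: K0_rel_def)

lemma K0_relI:
  assumes "{p, q, p', q'} \<subseteq> projections X" "set rs \<subseteq> projections X"
    "mvn_equiv X (dsums ps) (dsums qs)"
    "mset ps = {#p, q'#} + mset rs" "mset qs = {#p', q#} + mset rs"
  shows "((p, q), (p', q')) \<in> K0_rel X"
proof -
  have 1: "mset (p # q' # rs) = mset ps" "mset (p' # q # rs) = mset qs" using assms by auto
  have s: "set ps \<subseteq> projections X" "set qs \<subseteq> projections X"
    using assms(1,2) mset_eq_setD[OF 1(1)] mset_eq_setD[OF 1(2)] by auto
  have 2: "mvn_equiv X (dsums (p # q' # rs)) (dsums ps)" "mvn_equiv X (dsums qs) (dsums (p' # q # rs))"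
    using dsums_mset[OF 1(1)] dsums_mset[OF 1(2)[symmetric]] assms s by auto
  have "mvn_equiv X (dsums (p # q' # rs)) (dsums (p' # q # rs))"
    by (intro mvn_trans[OF mvn_trans[OF 2(1) assms(3)] 2(2)] dsums_in)
      (use assms(1,2) s in simp_all)
  then show ?thesis unfolding K0_rel_iff using assms
    by (auto intro!: bexI[of _ "dsums rs"])
qed

lemma equiv_K0_rel: "equiv (projections X \<times> projections X) (K0_rel X)"
proof (rule equivI)
  show "K0_rel X \<subseteq> (projections X \<times> projections X) \<times> projections X \<times> projections X"
    by (auto simp: K0_rel_def)
  show "refl_on (projections X \<times> projections X) (K0_rel X)"
    by (auto simp: refl_on_def K0_rel_def intro!: bexI[of _ zero_proj] mvn_refl projections_diag_sum)
  show "sym (K0_rel X)"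
    by (auto simp: sym_def K0_rel_def intro: mvn_sym)
  show "trans (K0_rel X)"
  proof (rule transI, clarify)
    fix p q p' q' p'' q''
    assume "((p, q), (p', q')) \<in> K0_rel X" "((p', q'), (p'', q'')) \<in> K0_rel X"
    then obtain r s where *: "{p, q, p', q', p'', q'', r, s} \<subseteq> projections X"
      "mvn_equiv X (dsums [p, q', r]) (dsums [p', q, r])"
      "mvn_equiv X (dsums [p', q'', s]) (dsums [p'', q', s])"
      unfolding K0_rel_iff by auto
    have "mvn_equiv X (dsums ([p, q', r] @ [p', q'', s])) (dsums ([p', q, r] @ [p'', q', s]))"
      unfolding dsums_append using * by (intro mvn_diag_sum)
    then show "((p, q), (p'', q'')) \<in> K0_rel X"
      by (rule K0_relI[where rs = "[p', q', r, s]", rotated 2]) (use * in auto)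
  qed
qed

lemma K0_rel_diag_sum:
  assumes "((p, q), (p', q')) \<in> K0_rel X" "((s, t), (s', t')) \<in> K0_rel X"
  shows "((p \<oplus>\<^sub>d s, q \<oplus>\<^sub>d t), (p' \<oplus>\<^sub>d s', q' \<oplus>\<^sub>d t')) \<in> K0_rel X"
proof -
  obtain a b where *: "{p, q, p', q', s, t, s', t', a, b} \<subseteq> projections X"
      "mvn_equiv X (dsums [p, q', a]) (dsums [p', q, a])"
      "mvn_equiv X (dsums [s, t', b]) (dsums [s', t, b])"
    using assms unfolding K0_rel_iff by auto
  have P: "{p, q, p', q', s, t, s', t', a, b, p \<oplus>\<^sub>d s, q \<oplus>\<^sub>d t, p' \<oplus>\<^sub>d s', q' \<oplus>\<^sub>d t'} \<subseteq> projections X"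
    using * by (auto intro: projections_diag_sum)
  have "mvn_equiv X (dsums [p, q', a] \<oplus>\<^sub>d dsums [s, t', b]) (dsums [p', q, a] \<oplus>\<^sub>d dsums [s', t, b])"
    using * by (intro mvn_diag_sum)
  then have "mvn_equiv X (dsums [p, q', a, s, t', b]) (dsums [p', q, a, s', t, b])"
    by (simp add: diag_sum_assoc)
  moreover have "mvn_equiv X (dsums [p, s, q', t', a, b]) (dsums [p, q', a, s, t', b])"
    "mvn_equiv X (dsums [p', q, a, s', t, b]) (dsums [p', s', q, t, a, b])"
    using * by (auto intro!: dsums_mset simp del: dsums_simps)
  moreover have "dsums [p, s, q', t', a, b] \<in> projections X" "dsums [p, q', a, s, t', b] \<in> projections X"
     "dsums [p', q, a, s', t, b] \<in> projections X" "dsums [p', s', q, t, a, b] \<in> projections X"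
    using * by (auto intro!: dsums_in simp del: dsums_simps)
  ultimately have "mvn_equiv X (dsums [p, s, q', t', a, b]) (dsums [p', s', q, t, a, b])"
    by (elim mvn_trans) (simp_all only: mvn_refl)
  then show ?thesis unfolding K0_rel_iff using P
    by (auto intro!: bexI[of _ "a \<oplus>\<^sub>d b"] projections_diag_sum simp: diag_sum_assoc)
qed

lemma K0_mult:
  assumes "{p, q, p', q'} \<subseteq> projections X"
  shows "K0_rel X `` {(p, q)} \<otimes>\<^bsub>K0 X\<^esub> K0_rel X `` {(p', q')} = K0_rel X `` {(p \<oplus>\<^sub>d p', q \<oplus>\<^sub>d q')}"
proof -
  let ?f = "\<lambda>u v. K0_rel X `` {(fst u \<oplus>\<^sub>d fst v, snd u \<oplus>\<^sub>d snd v)}"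
  have "congruent2 (K0_rel X) (K0_rel X) ?f"
  proof (rule congruent2I')
    fix y1 z1 y2 z2 assume "(y1, z1) \<in> K0_rel X" "(y2, z2) \<in> K0_rel X"
    then have "((fst y1 \<oplus>\<^sub>d fst y2, snd y1 \<oplus>\<^sub>d snd y2), (fst z1 \<oplus>\<^sub>d fst z2, snd z1 \<oplus>\<^sub>d snd z2)) \<in> K0_rel X"
      using K0_rel_diag_sum by (metis prod.collapse)
    then show "?f y1 y2 = ?f z1 z2" by (rule equiv_class_eq[OF equiv_K0_rel])
  qed
  from UN_equiv_class2[OF equiv_K0_rel equiv_K0_rel this, of "(p, q)" "(p', q')"] assms
  show ?thesis by (simp add: K0_def case_prod_beta)
qed

lemma K0_carrierE:
  assumes "a \<in> carrier (K0 X)"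
  obtains p q where "p \<in> projections X" "q \<in> projections X" "a = K0_rel X `` {(p, q)}"
  using assms by (auto simp: K0_def elim!: quotientE)

lemma K0_carrierI:
  "p \<in> projections X \<Longrightarrow> q \<in> projections X \<Longrightarrow> K0_rel X `` {(p, q)} \<in> carrier (K0 X)"
  by (auto simp: K0_def intro!: quotientI)

lemma one_K0: "\<one>\<^bsub>K0 X\<^esub> = K0_rel X `` {(zero_proj, zero_proj)}"
  by (simp add: K0_def)

theorem comm_group_K0: "comm_group (K0 X)"
proof (rule comm_groupI)
  fix a b assume "a \<in> carrier (K0 X)" "b \<in> carrier (K0 X)"
  then show "a \<otimes>\<^bsub>K0 X\<^esub> b \<in> carrier (K0 X)"
    by (elim K0_carrierE) (simp add: K0_mult K0_carrierI projections_diag_sum)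
next
  show "\<one>\<^bsub>K0 X\<^esub> \<in> carrier (K0 X)" by (simp add: one_K0 K0_carrierI)
next
  fix a b c assume "a \<in> carrier (K0 X)" "b \<in> carrier (K0 X)" "c \<in> carrier (K0 X)"
  then show "a \<otimes>\<^bsub>K0 X\<^esub> b \<otimes>\<^bsub>K0 X\<^esub> c = a \<otimes>\<^bsub>K0 X\<^esub> (b \<otimes>\<^bsub>K0 X\<^esub> c)"
    by (elim K0_carrierE) (simp add: K0_mult projections_diag_sum diag_sum_assoc)
next
  fix a b assume "a \<in> carrier (K0 X)" "b \<in> carrier (K0 X)"
  then obtain p q p' q' where *: "{p, q, p', q'} \<subseteq> projections X"
    "a = K0_rel X `` {(p, q)}" "b = K0_rel X `` {(p', q')}"
    by (elim K0_carrierE) auto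
  have "((p \<oplus>\<^sub>d p', q \<oplus>\<^sub>d q'), (p' \<oplus>\<^sub>d p, q' \<oplus>\<^sub>d q)) \<in> K0_rel X"
  proof -
    have "mvn_equiv X (dsums [p, p', q', q]) (dsums [p', p, q, q'])"
      using * by (auto intro!: dsums_mset simp del: dsums_simps)
    then show ?thesis using *
      by (auto simp: K0_rel_iff diag_sum_assoc intro!: projections_diag_sum bexI[of _ zero_proj])
  qed
  then show "a \<otimes>\<^bsub>K0 X\<^esub> b = b \<otimes>\<^bsub>K0 X\<^esub> a"
    using * equiv_class_eq[OF equiv_K0_rel] by (simp add: K0_mult)
next
  fix a assume "a \<in> carrier (K0 X)"
  then show "\<one>\<^bsub>K0 X\<^esub> \<otimes>\<^bsub>K0 X\<^esub> a = a"
    by (elim K0_carrierE) (simp add: K0_mult one_K0)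
next
  fix a assume "a \<in> carrier (K0 X)"
  then obtain p q where *: "p \<in> projections X" "q \<in> projections X" "a = K0_rel X `` {(p, q)}"
    by (elim K0_carrierE) auto
  have "mvn_equiv X (dsums [q, p]) (dsums [p, q])"
    using * by (auto intro!: dsums_mset simp del: dsums_simps)
  then have "((q \<oplus>\<^sub>d p, p \<oplus>\<^sub>d q), (zero_proj, zero_proj)) \<in> K0_rel X"
    using * by (auto simp: K0_rel_iff intro!: projections_diag_sum bexI[of _ zero_proj])
  then have "K0_rel X `` {(q, p)} \<otimes>\<^bsub>K0 X\<^esub> a = \<one>\<^bsub>K0 X\<^esub>"
    using * equiv_class_eq[OF equiv_K0_rel] by (simp add: K0_mult one_K0)
  then show "\<exists>y\<in>carrier (K0 X). y \<otimes>\<^bsub>K0 X\<^esub> a = \<one>\<^bsub>K0 X\<^esub>"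
    using * K0_carrierI by blast
qed

section \<open>Balanced pairs\<close>

definition mult_defect ::
  "('g, 'b) monoid_scheme \<Rightarrow> ('g \<Rightarrow> complex mat) \<Rightarrow> 'g \<Rightarrow> 'g \<Rightarrow> complex mat" where
  "mult_defect G \<pi> g h = \<pi> (g \<otimes>\<^bsub>G\<^esub> h) - \<pi> g * \<pi> h"

definition balanced_pair ::
  "('g, 'b) monoid_scheme \<Rightarrow> nat \<Rightarrow> 'g set \<Rightarrow> real \<Rightarrow>
     ('g \<Rightarrow> complex mat) \<Rightarrow> ('g \<Rightarrow> complex mat) \<Rightarrow> bool" where
  "balanced_pair G n F \<epsilon> \<pi>p \<pi>m \<longleftrightarrow>
     \<pi>p \<in> carrier G \<rightarrow> carrier_mat n n \<and> \<pi>m \<in> carrier G \<rightarrow> carrier_mat n n \<and>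
     (\<forall>g\<in>F. \<pi>p (inv\<^bsub>G\<^esub> g) = mat_adjoint (\<pi>p g) \<and> \<pi>m (inv\<^bsub>G\<^esub> g) = mat_adjoint (\<pi>m g)) \<and>
     (\<forall>g\<in>F. \<forall>h\<in>F. op_norm (mult_defect G \<pi>p g h - mult_defect G \<pi>m g h) < \<epsilon>) \<and>
     (\<forall>g\<in>F. \<forall>h\<in>F. \<forall>k\<in>F.
        op_norm (\<pi>p k * mult_defect G \<pi>p g h - \<pi>m k * mult_defect G \<pi>m g h) < \<epsilon>)"

text \<open>The block matrix \<open>(\<phi>\<^sub>i(x) \<phi>\<^sub>j(x) \<pi>(\<gamma>\<^sub>i\<^sub>j))\<close>, \<open>i, j < N\<close>, with blocks of size \<open>n\<close>.\<close>

definition A_mat ::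
  "nat \<Rightarrow> nat \<Rightarrow> (nat \<Rightarrow> 'a \<Rightarrow> real) \<Rightarrow> (nat \<Rightarrow> nat \<Rightarrow> 'g) \<Rightarrow> ('g \<Rightarrow> complex mat) \<Rightarrow>
     'a \<Rightarrow> complex mat" where
  "A_mat N n \<phi> \<gamma> \<pi> x =
     mat (N * n) (N * n) (\<lambda>(s, t). complex_of_real (\<phi> (s div n) x * \<phi> (t div n) x) *
       \<pi> (\<gamma> (s div n) (t div n)) $$ (s mod n, t mod n))"

definition P2 :: "complex mat \<Rightarrow> complex mat \<Rightarrow> complex mat" where
  "P2 a b =
     (let one = 1\<^sub>m (dim_row a) in
      four_block_mat (one + (one - a) * (a - b) * (one - a)) ((one - a) * (b - a) * a)
                     (a * (b - a) * (one - a)) (a * (a - b) * a))"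

definition E11 :: "nat \<Rightarrow> complex mat" where
  "E11 k = four_block_mat (1\<^sub>m k) (0\<^sub>m k k) (0\<^sub>m k k) (0\<^sub>m k k)"

end

theory Submission
  imports Defs "Jordan_Normal_Form.Spectral_Radius" "HOL-Analysis.Uniform_Limit"
begin

text \<open>
  Fix a point of \<open>X\<close> and write \<open>a\<close>, \<open>b\<close> for the values of \<open>A\<close> for the two maps there,
  \<open>d = a - b\<close> and \<open>m\<^sub>a = a\<^sup>2 - a\<close>. Since \<open>\<gamma>\<close> is a cocycle and the squares of the \<open>\<phi>\<^sub>i\<close> add up to \<open>1\<close>,
  the \<open>(i, k)\<close> block of \<open>m\<^sub>a\<close> is \<open>- \<phi>\<^sub>i \<phi>\<^sub>k\<close> times a convex combination of the multiplicativity
  defects of \<open>\<pi>\<close>. So a balanced pair gives \<open>\<parallel>m\<^sub>a - m\<^sub>b\<parallel> \<le> \<epsilon>\<close> and \<open>\<parallel>a m\<^sub>a - b m\<^sub>b\<parallel> \<le> \<epsilon>\<close>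
  (\<open>block_mat_defect_bounds\<close>), with no loss depending on the number or the size of the blocks
  because \<open>(\<phi>\<^sub>i)\<close> is a unit vector. What has to be shown is that then
  \<open>P''(a, b)\<^sup>2 - P''(a, b)\<close> has norm at most \<open>C \<epsilon>\<close>, where \<open>C\<close> depends neither on the
  dimension nor on the norms of \<open>a\<close> and \<open>b\<close>: nothing bounds these norms.

  With \<open>w = (1 - a)\<^sup>2 + a\<^sup>2\<close> the blocks of \<open>P''\<^sup>2 - P''\<close> are \<open>(1 - a)(d + d w d)(1 - a)\<close>,
  \<open>- (1 - a) d w d a\<close>, its adjoint, and \<open>a (d w d - d) a\<close>. They can be rewritten as sums of products
  in which every term has a factor \<open>a d b\<close> or \<open>(1 - a) d (1 - b) = a d b - (m\<^sub>a - m\<^sub>b)\<close> or an adjoint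
  of one of these, and all other factors are among \<open>d\<close>, \<open>a d\<close>, \<open>d a\<close>, \<open>a d a\<close> and the like.
  So it suffices to know that \<open>a d b\<close> is \<open>O(\<epsilon>)\<close> and that \<open>d\<close> and \<open>a d\<close> are bounded
  (\<open>almost_idempotent\<close>).

  These three facts (\<open>difference_estimates\<close>) are the heart of the proof. Put \<open>c = 2 a - 1\<close>,
  \<open>e = 2 b - 1\<close>, \<open>D = c - e\<close>. If \<open>c\<close> always stands to the left of \<open>D\<close> and \<open>e\<close> to the right, expressions
  \<open>\<Sum> c\<^sup>i D e\<^sup>j\<close> multiply like the polynomials \<open>\<Sum> x\<^sup>i y\<^sup>j\<close>, and the two small quantities become
  \<open>F = c\<^sup>2 - e\<^sup>2\<close> with polynomial \<open>x + y\<close> and \<open>H = c\<^sup>3 - e\<^sup>3 - D\<close> with polynomial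
  \<open>x\<^sup>2 + x y + y\<^sup>2 - 1\<close>. The wanted one is \<open>K = c D e + D\<close>, with polynomial
  \<open>x y + 1 = (x + y)\<^sup>2 - (x\<^sup>2 + x y + y\<^sup>2 - 1)\<close>, since \<open>8 a d b = K + F\<close>. The multiplier \<open>x + y\<close> is
  unbounded, which is cured by multiplying with a positive definite quadratic polynomial:
  \<open>(x\<^sup>2 + x y + y\<^sup>2 + 1) (x y + 1) = (x y - 1) (x\<^sup>2 + x y + y\<^sup>2 - 1) + 2 (x + y)\<^sup>2\<close>.
  Read this as an identity of operators and test it on singular vectors \<open>K v = s u\<close>, \<open>K\<^sup>* u = s v\<close>
  with \<open>s = \<parallel>K\<parallel>\<close>. On the left, \<open>c\<^sup>2 K\<close> and \<open>K e\<^sup>2\<close> contribute exactly \<open>s \<parallel>c u\<parallel>\<^sup>2\<close> and \<open>s \<parallel>e v\<parallel>\<^sup>2\<close>,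
  and the mixed term is at least \<open>- s \<parallel>c u\<parallel> \<parallel>e v\<parallel>\<close>; the right-hand side is at most a multiple of \<open>\<epsilon>\<close> times
  the same quadratic form in \<open>\<parallel>c u\<parallel>\<close>, \<open>\<parallel>e v\<parallel>\<close>. Hence \<open>s = O(\<epsilon>)\<close>. The bounds on \<open>D\<close> and \<open>c D\<close> come from
  the same test applied to the equation for \<open>H\<close>.

  For the class in \<open>K\<^sub>0(C(X))\<close> one needs that the spectral projections of an almost projection form a
  projection over \<open>C(X)\<close>. Pointwise this is diagonalization; for continuity, the spectral projection
  is the uniform limit of the iterates of the polynomial \<open>3 t\<^sup>2 - 2 t\<^sup>3\<close>
  (\<open>spectral_projection_in_projections\<close>).
\<close>

section \<open>Selfadjoint maps with almost equal defects of idempotency\<close>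

definition bounded_by :: "('v::real_normed_vector \<Rightarrow> 'v) \<Rightarrow> real \<Rightarrow> bool" where
  "bounded_by T s \<longleftrightarrow> (\<forall>x. norm (T x) \<le> s * norm x)"

definition symmetric_map :: "('v::real_inner \<Rightarrow> 'v) \<Rightarrow> bool" where
  "symmetric_map T \<longleftrightarrow> linear T \<and> (\<forall>x y. inner (T x) y = inner x (T y))"

text \<open>The vectors \<open>u\<close> and \<open>v\<close> are left and right singular vectors for the largest singular value \<open>s\<close>. The
  equation \<open>T\<^sup>* u = s v\<close> is written in weak form, so that no adjoint of \<open>T\<close> has to be named.\<close>

definition singular_triple :: "('v::real_inner \<Rightarrow> 'v) \<Rightarrow> real \<Rightarrow> 'v \<Rightarrow> 'v \<Rightarrow> bool" where
  "singular_triple T s u v \<longleftrightarrow>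
     norm u = 1 \<and> norm v = 1 \<and> T v = s *\<^sub>R u \<and> (\<forall>x. inner (T x) u = s * inner x v) \<and> bounded_by T s"

lemma bounded_byI: "(\<And>x. norm (T x) \<le> s * norm x) \<Longrightarrow> bounded_by T s"
  by (simp add: bounded_by_def)

lemma bounded_byD: "bounded_by T s \<Longrightarrow> norm (T x) \<le> s * norm x"
  by (simp add: bounded_by_def)

lemma bounded_by_mono: "bounded_by T s \<Longrightarrow> s \<le> t \<Longrightarrow> bounded_by T t"
  unfolding bounded_by_def by (meson mult_right_mono norm_ge_zero order_trans)

lemma bounded_by_comp:
  assumes "bounded_by S s" "bounded_by T t" "0 \<le> s"
  shows "bounded_by (\<lambda>x. S (T x)) (s * t)"
proof (rule bounded_byI)
  fix x
  have "norm (S (T x)) \<le> s * norm (T x)" using assms by (simp add: bounded_by_def)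
  also have "\<dots> \<le> s * (t * norm x)" using assms by (intro mult_left_mono) (auto simp: bounded_by_def)
  finally show "norm (S (T x)) \<le> s * t * norm x" by simp
qed

lemma bounded_by_add:
  "bounded_by S s \<Longrightarrow> bounded_by T t \<Longrightarrow> bounded_by (\<lambda>x. S x + T x) (s + t)"
  by (auto simp: bounded_by_def distrib_right intro: norm_triangle_mono)

lemma bounded_by_diff:
  "bounded_by S s \<Longrightarrow> bounded_by T t \<Longrightarrow> bounded_by (\<lambda>x. S x - T x) (s + t)"
  unfolding bounded_by_def distrib_right by (meson add_mono norm_triangle_ineq4 order_trans)

lemma bounded_by_scaleR: "bounded_by T t \<Longrightarrow> 0 \<le> r \<Longrightarrow> bounded_by (\<lambda>x. r *\<^sub>R T x) (r * t)"
  by (auto simp: bounded_by_def mult.assoc intro: mult_left_mono)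

lemma bounded_by_uminus: "bounded_by S s \<Longrightarrow> bounded_by (\<lambda>x. - S x) s"
  by (auto simp: bounded_by_def)

lemma bounded_by_adjoint:
  fixes S T :: "'v::real_inner \<Rightarrow> 'v"
  assumes "bounded_by S s" "\<And>x y. inner (S x) y = inner x (T y)"
  shows "bounded_by T s"
proof (rule bounded_byI)
  fix y
  have "norm (T y) * norm (T y) = inner (S (T y)) y"
    by (simp add: assms(2) power2_norm_eq_inner flip: power2_eq_square)
  also have "\<dots> \<le> norm (S (T y)) * norm y" by (rule norm_cauchy_schwarz)
  also have "\<dots> \<le> s * norm (T y) * norm y"
    by (intro mult_right_mono) (use assms in \<open>auto simp: bounded_by_def\<close>)
  finally have "norm (T y) * norm (T y) \<le> norm (T y) * (s * norm y)" by (simp add: mult_ac)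
  moreover have "0 \<le> s * norm y" using bounded_byD[OF assms(1), of y] norm_ge_zero order_trans by blast
  ultimately show "norm (T y) \<le> s * norm y" by (cases "norm (T y) = 0") auto
qed

text \<open>At a top singular pair the operator \<open>T \<mapsto> c\<^sup>2 T + c T e + T e\<^sup>2\<close> is bounded below by the value of a
  positive definite quadratic form in \<open>\<parallel>c u\<parallel>\<close> and \<open>\<parallel>e v\<parallel>\<close>: the outer terms can be evaluated exactly,
  because \<open>T\<close> can be moved onto \<open>v\<close> or \<open>u\<close>, and only the mixed term is estimated. This replaces
  a bound on the inverse of that operator, and it involves neither the dimension nor \<open>\<parallel>c\<parallel>\<close>, \<open>\<parallel>e\<parallel>\<close>.\<close>

lemma singular_elliptic:
  fixes T c e :: "'v::real_inner \<Rightarrow> 'v"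
  assumes c: "symmetric_map c" and e: "symmetric_map e" and T: "singular_triple T s u v"
  shows "inner (c (c (T v)) + c (T (e v)) + T (e (e v))) u
          \<ge> s * ((norm (c u))\<^sup>2 + (norm (e v))\<^sup>2 - norm (c u) * norm (e v))"
proof -
  have T': "T v = s *\<^sub>R u" "\<And>x. inner (T x) u = s * inner x v" "bounded_by T s"
    using T by (auto simp: singular_triple_def)
  have c': "\<And>x y. inner (c x) y = inner x (c y)" "\<And>r x. c (r *\<^sub>R x) = r *\<^sub>R c x"
    and e': "\<And>x y. inner (e x) y = inner x (e y)"
    using c e by (auto simp: symmetric_map_def linear_cmul)
  have "inner (c (c (T v))) u = s * (norm (c u))\<^sup>2"
    by (simp add: T' c' power2_norm_eq_inner)
  moreover have "inner (T (e (e v))) u = s * (norm (e v))\<^sup>2"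
    by (simp add: T' e' power2_norm_eq_inner)
  moreover have "inner (c (T (e v))) u \<ge> - (s * (norm (c u) * norm (e v)))"
  proof -
    have "\<bar>inner (T (e v)) (c u)\<bar> \<le> norm (T (e v)) * norm (c u)" by (rule Cauchy_Schwarz_ineq2)
    also have "\<dots> \<le> (s * norm (e v)) * norm (c u)"
      using T'(3) by (intro mult_right_mono) (auto simp: bounded_by_def)
    finally show ?thesis by (simp add: c' mult_ac)
  qed
  ultimately show ?thesis by (simp add: inner_add_left algebra_simps)
qed

lemma half_squares_le: "(x::real)\<^sup>2 + y\<^sup>2 \<le> 2 * (x\<^sup>2 + y\<^sup>2 - x * y)"
  using zero_le_power2[of "x - y"] by (simp add: power2_diff)

lemma form_nonneg: "0 \<le> (x::real)\<^sup>2 + y\<^sup>2 - x * y"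
proof -
  have "0 \<le> q - p" if "2 * p \<le> q" "0 \<le> q" for p q :: real using that by linarith
  from this[OF _ sum_power2_ge_zero[of x y], of "x * y"] show ?thesis
    using sum_squares_bound[of x y] by (simp only: mult.assoc)
qed

context
  fixes c e :: "'v::real_inner \<Rightarrow> 'v" and \<epsilon> :: real
  assumes c: "symmetric_map c" and e: "symmetric_map e" and \<epsilon>: "0 \<le> \<epsilon>" "\<epsilon> \<le> 1"
  fixes D F H :: "'v \<Rightarrow> 'v"
  defines "D \<equiv> \<lambda>x. c x - e x"
    and "F \<equiv> \<lambda>x. c (c x) - e (e x)"
    and "H \<equiv> \<lambda>x. c (c (c x)) - e (e (e x)) - D x"
  assumes F: "bounded_by F (4 * \<epsilon>)" and H: "bounded_by H (12 * \<epsilon>)"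
begin

lemma lin_ce:
  "c (x + y) = c x + c y" "c (x - y) = c x - c y" "c (r *\<^sub>R x) = r *\<^sub>R c x"
  "e (x + y) = e x + e y" "e (x - y) = e x - e y" "e (r *\<^sub>R x) = r *\<^sub>R e x"
  "c (- x) = - c x" "e (- x) = - e x"
  using c e by (simp_all add: symmetric_map_def linear_add linear_diff linear_cmul linear_neg)

lemma sym_ce: "inner (c x) y = inner x (c y)" "inner (e x) y = inner x (e y)"
  using c e by (simp_all add: symmetric_map_def)

text \<open>The identity \<open>id\<close> in the proof is the polynomial identity
  \<open>(x\<^sup>2 + x y + y\<^sup>2 + 1) (x y + 1) = (x y - 1) (x\<^sup>2 + x y + y\<^sup>2 - 1) + 2 (x + y)\<^sup>2\<close> applied to \<open>D\<close>, with
  \<open>c\<close> acting for \<open>x\<close> on the left and \<open>e\<close> for \<open>y\<close> on the right.\<close>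

lemma cross_bound:
  assumes "singular_triple (\<lambda>x. c (D (e x)) + D x) s u v"
  shows "bounded_by (\<lambda>x. c (D (e x)) + D x) (20 * \<epsilon>)"
proof -
  let ?K = "\<lambda>x. c (D (e x)) + D x"
  let ?X = "norm (c u)" and ?Y = "norm (e v)"
  let ?L = "?X\<^sup>2 + ?Y\<^sup>2 - ?X * ?Y + 1"
  have T': "norm u = 1" "norm v = 1" "\<And>x. inner (?K x) u = s * inner x v" "bounded_by ?K s"
    using assms by (auto simp: singular_triple_def)
  have id: "c (c (?K v)) + c (?K (e v)) + ?K (e (e v)) + ?K v
      = c (H (e v)) - H v + (c (F v) + c (F v)) + (F (e v) + F (e v))"
    unfolding D_def F_def H_def by (simp add: lin_ce algebra_simps)
  have "s * ?L = s * (?X\<^sup>2 + ?Y\<^sup>2 - ?X * ?Y) + s" by (simp add: algebra_simps)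
  also have "\<dots> \<le> inner (c (c (?K v)) + c (?K (e v)) + ?K (e (e v))) u + inner (?K v) u"
    using singular_elliptic[OF c e assms] T'(2) T'(3)[of v] by (simp add: dot_square_norm)
  also have "\<dots> = inner (c (H (e v)) - H v + (c (F v) + c (F v)) + (F (e v) + F (e v))) u"
    unfolding id[symmetric] by (simp only: inner_add_left)
  also have "\<dots> = inner (H (e v)) (c u) - inner (H v) u + 2 * inner (F v) (c u) + 2 * inner (F (e v)) u"
    by (simp add: inner_add_left inner_diff_left sym_ce)
  also have "\<dots> \<le> 12 * \<epsilon> * (?X * ?Y) + 12 * \<epsilon> + 2 * (4 * \<epsilon> * ?X) + 2 * (4 * \<epsilon> * ?Y)"
  proof -
    have "\<bar>inner (H (e v)) (c u)\<bar> \<le> 12 * \<epsilon> * ?Y * ?X"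
      using bounded_byD[OF H, of "e v"] by (meson Cauchy_Schwarz_ineq2 mult_right_mono norm_ge_zero order_trans)
    moreover have "\<bar>inner (H v) u\<bar> \<le> 12 * \<epsilon>"
      using bounded_byD[OF H, of v] Cauchy_Schwarz_ineq2[of "H v" u] T' by simp
    moreover have "\<bar>inner (F v) (c u)\<bar> \<le> 4 * \<epsilon> * norm v * ?X"
      using bounded_byD[OF F, of "v"] by (meson Cauchy_Schwarz_ineq2 mult_right_mono norm_ge_zero order_trans)
    moreover have "\<bar>inner (F (e v)) u\<bar> \<le> 4 * \<epsilon> * ?Y"
      using bounded_byD[OF F, of "e v"] Cauchy_Schwarz_ineq2[of "F (e v)" u] T' by simp
    ultimately show ?thesis using T' by (simp add: mult_ac)
  qed
  also have "\<dots> = \<epsilon> * (12 * (?X * ?Y + 1) + 8 * (?X + ?Y))" by (simp add: algebra_simps)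
  also have "\<dots> \<le> \<epsilon> * (20 * ?L)"
  proof (intro mult_left_mono \<epsilon>)
    have "?X * ?Y + 1 \<le> ?L" using zero_le_power2[of "?X - ?Y"] by (simp add: power2_diff)
    moreover have "?X + ?Y \<le> ?L"
      using half_squares_le[of ?X ?Y] zero_le_power2[of "?X - 1"] zero_le_power2[of "?Y - 1"]
      by (simp add: power2_diff)
    moreover have "12 * p + 8 * q \<le> 20 * t" if "p \<le> t" "q \<le> t" for p q t :: real
      using that by linarith
    ultimately show "12 * (?X * ?Y + 1) + 8 * (?X + ?Y) \<le> 20 * ?L" by blast
  qed
  finally have "s * ?L \<le> (20 * \<epsilon>) * ?L" by (simp only: mult.assoc mult.left_commute)
  moreover have "?L > 0"
    using form_nonneg[of ?X ?Y] by simp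
  ultimately have "s \<le> 20 * \<epsilon>" by simp
  then show ?thesis using T'(4) bounded_by_mono by blast
qed

text \<open>If \<open>\<parallel>c u\<parallel> + \<parallel>e v\<parallel> \<le> 4\<close> then \<open>s = \<langle>v, c u\<rangle> - \<langle>e v, u\<rangle> \<le> 4\<close> because \<open>D = c - e\<close>. Otherwise the quadratic
  form is at least \<open>4\<close>, and then \<open>c\<^sup>2 D + c D e + D e\<^sup>2 = H + D\<close> forces \<open>s\<close> to be small.\<close>

lemma difference_bound:
  assumes "singular_triple D s u v"
  shows "bounded_by D 4"
proof -
  let ?X = "norm (c u)" and ?Y = "norm (e v)"
  let ?Q = "?X\<^sup>2 + ?Y\<^sup>2 - ?X * ?Y"
  have T': "norm u = 1" "norm v = 1" "D v = s *\<^sub>R u" "\<And>x. inner (D x) u = s * inner x v" "bounded_by D s"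
    using assms by (auto simp: singular_triple_def)
  have s: "s = inner (D v) u" using T' by (simp add: dot_square_norm)
  have "s \<le> 4"
  proof (cases "?X + ?Y \<le> 4")
    case True
    have "s = inner v (c u) - inner (e v) u"
      unfolding s D_def by (simp add: inner_diff_left sym_ce)
    also have "\<dots> \<le> ?X + ?Y"
      using Cauchy_Schwarz_ineq2[of v "c u"] Cauchy_Schwarz_ineq2[of "e v" u] T' by simp
    finally show ?thesis using True by simp
  next
    case False
    have id: "H v + D v = c (c (D v)) + c (D (e v)) + D (e (e v))"
      unfolding H_def D_def by (simp add: lin_ce algebra_simps)
    have "s * ?Q \<le> inner (H v + D v) u"
      unfolding id by (rule singular_elliptic[OF c e assms])
    also have "\<dots> = inner (H v) u + s" using s by (simp add: inner_add_left)
    also have "\<dots> \<le> 12 * \<epsilon> + s"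
      using bounded_byD[OF H, of v] Cauchy_Schwarz_ineq2[of "H v" u] T' by simp
    finally have "s * (?Q - 1) \<le> 12 * \<epsilon>" by (simp add: algebra_simps)
    moreover have "(?X + ?Y)\<^sup>2 \<le> 4 * ?Q"
      using zero_le_power2[of "?X - ?Y"] by (simp add: power2_diff power2_sum)
    then have "?Q \<ge> 4" using False power_mono[of 4 "?X + ?Y" 2] by simp
    then have "0 \<le> s \<Longrightarrow> s * 3 \<le> s * (?Q - 1)" by (intro mult_left_mono) auto
    ultimately show ?thesis using \<epsilon> by linarith
  qed
  then show ?thesis using T'(5) bounded_by_mono by blast
qed

text \<open>The same dichotomy as for \<open>D\<close>, now with \<open>c\<^sup>2 T + c T e + T e\<^sup>2 = c H + T\<close> for \<open>T = c D\<close>. The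
  right-hand side grows only linearly in \<open>\<parallel>c u\<parallel>\<close>, the left-hand side quadratically.\<close>

lemma weighted_difference_bound:
  assumes D: "bounded_by D 4" and T: "singular_triple (\<lambda>x. c (D x)) s u v"
  shows "bounded_by (\<lambda>x. c (D x)) 16"
proof -
  let ?T = "\<lambda>x. c (D x)"
  let ?X = "norm (c u)" and ?Y = "norm (e v)"
  let ?Q = "?X\<^sup>2 + ?Y\<^sup>2 - ?X * ?Y"
  have T': "norm u = 1" "norm v = 1" "?T v = s *\<^sub>R u" "\<And>x. inner (?T x) u = s * inner x v" "bounded_by ?T s"
    using T by (auto simp: singular_triple_def)
  have s: "s = inner (?T v) u" using T' by (simp add: dot_square_norm)
  have "s \<le> 16"
  proof (cases "?X + ?Y \<le> 4")
    case True
    have "s = inner (D v) (c u)" unfolding s by (simp add: sym_ce)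
    also have "\<dots> \<le> norm (D v) * ?X" by (rule norm_cauchy_schwarz)
    also have "\<dots> \<le> 4 * 4"
      using bounded_byD[OF D, of v] T' order_trans[OF _ True, of ?X]
      by (intro mult_mono) auto
    finally show ?thesis by simp
  next
    case False
    have id: "c (H v) + c (D v) = c (c (?T v)) + c (?T (e v)) + ?T (e (e v))"
      unfolding H_def D_def by (simp add: lin_ce algebra_simps)
    have "s * ?Q \<le> inner (c (H v) + c (D v)) u"
      unfolding id by (rule singular_elliptic[OF c e T])
    also have "\<dots> = inner (H v) (c u) + s" using s by (simp add: inner_add_left sym_ce)
    also have "\<dots> \<le> 12 * \<epsilon> * ?X + s"
    proof -
      have "inner (H v) (c u) \<le> norm (H v) * ?X" by (rule norm_cauchy_schwarz)
      also have "\<dots> \<le> 12 * \<epsilon> * ?X"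
        using bounded_byD[OF H, of v] T' by (intro mult_right_mono) auto
      finally show ?thesis by simp
    qed
    also have "\<dots> \<le> 12 * ?X + s" using \<epsilon> mult_right_mono[of \<epsilon> 1 ?X] by simp
    finally have 1: "s * (?Q - 1) \<le> 12 * ?X" by (simp add: algebra_simps)
    have 2: "(?X + ?Y)\<^sup>2 \<le> 4 * ?Q"
      using zero_le_power2[of "?X - ?Y"] by (simp add: power2_diff power2_sum)
    then have Q4: "?Q \<ge> 4" using False power_mono[of 4 "?X + ?Y" 2] by simp
    have Q3: "3 * ?X\<^sup>2 \<le> 4 * ?Q"
      using zero_le_power2[of "2 * ?Y - ?X"] by (simp add: power2_diff power_mult_distrib mult.commute)
    have "?X \<le> ?Q"
    proof (cases "?X \<le> 4")
      case False
      then have "4 * ?X \<le> ?X\<^sup>2" unfolding power2_eq_square by (intro mult_right_mono) auto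
      moreover have "r \<le> q" if "4 * r \<le> t" "3 * t \<le> 4 * q" "0 \<le> r" for q r t :: real
        using that by linarith
      ultimately show ?thesis using Q3 norm_ge_zero by blast
    qed (use Q4 in linarith)
    moreover have "12 * r \<le> 16 * (q - 1)" if "r \<le> q" "4 \<le> q" for q r :: real
      using that by argo
    ultimately have "12 * ?X \<le> 16 * (?Q - 1)" using Q4 by blast
    with 1 have "s * (?Q - 1) \<le> 16 * (?Q - 1)" by (rule order_trans)
    moreover have "0 < ?Q - 1" using Q4 by simp
    ultimately show ?thesis by (rule mult_right_le_imp_le)
  qed
  then show ?thesis using T'(5) bounded_by_mono by blast
qed

end

text \<open>In terms of \<open>c = 2 a - 1\<close> and \<open>e = 2 b - 1\<close> the hypotheses become
  bounds on \<open>c\<^sup>2 - e\<^sup>2\<close> and \<open>c\<^sup>3 - e\<^sup>3 - (c - e)\<close>, whose polynomials in the two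
  variables are simpler. The existence of singular vectors is a hypothesis
  because it is a matter of finite dimension.\<close>

lemma difference_estimates:
  fixes a b :: "'v::real_inner \<Rightarrow> 'v" and \<epsilon> :: real
  assumes a: "symmetric_map a" and b: "symmetric_map b" and \<epsilon>: "0 \<le> \<epsilon>" "\<epsilon> \<le> 1"
  fixes c e :: "'v \<Rightarrow> 'v"
  defines "c \<equiv> \<lambda>x. 2 *\<^sub>R a x - x" and "e \<equiv> \<lambda>x. 2 *\<^sub>R b x - x"
  assumes \<delta>: "bounded_by (\<lambda>x. (a (a x) - a x) - (b (b x) - b x)) \<epsilon>"
    and \<eta>: "bounded_by (\<lambda>x. a (a (a x) - a x) - b (b (b x) - b x)) \<epsilon>"
    and sing: "\<exists>s u v. singular_triple (\<lambda>x. c x - e x) s u v"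
      "\<exists>s u v. singular_triple (\<lambda>x. c (c x - e x)) s u v"
      "\<exists>s u v. singular_triple (\<lambda>x. c (c (e x) - e (e x)) + (c x - e x)) s u v"
  shows "bounded_by (\<lambda>x. a x - b x) 2" "bounded_by (\<lambda>x. a (a x - b x)) 5"
    "bounded_by (\<lambda>x. a (a (b x) - b (b x))) (3 * \<epsilon>)"
proof -
  have la: "a (x + y) = a x + a y" "a (x - y) = a x - a y" "a (r *\<^sub>R x) = r *\<^sub>R a x"
    "b (x + y) = b x + b y" "b (x - y) = b x - b y" "b (r *\<^sub>R x) = r *\<^sub>R b x" for x y r
    using a b by (simp_all add: symmetric_map_def linear_add linear_diff linear_cmul)
  have sc: "symmetric_map c" "symmetric_map e"
    using a b unfolding symmetric_map_def c_def e_def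
    by (auto intro!: linear_compose_sub linear_compose_scale_right linear_id[unfolded id_def]
        simp: inner_diff_left inner_diff_right)
  have num: "2 *\<^sub>R x = x + x" "4 *\<^sub>R x = x + x + (x + x)" "8 *\<^sub>R x = 4 *\<^sub>R x + 4 *\<^sub>R x" for x :: 'v
    using scaleR_left_distrib[of 2 2 x] scaleR_left_distrib[of 4 4 x]
    by (simp_all only: scaleR_2) simp_all
  have sq: "c (c x) = 4 *\<^sub>R (a (a x) - a x) + x" "e (e x) = 4 *\<^sub>R (b (b x) - b x) + x" for x
    unfolding num c_def e_def by (simp_all add: la algebra_simps)
  have cube: "c (c (c x)) = 8 *\<^sub>R a (a (a x) - a x) - 4 *\<^sub>R (a (a x) - a x) + c x"
    "e (e (e x)) = 8 *\<^sub>R b (b (b x) - b x) - 4 *\<^sub>R (b (b x) - b x) + e x" for x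
    by (simp_all add: sq(1)[of "c x"] sq(2)[of "e x"]) (simp_all add: c_def e_def la algebra_simps)
  have "(\<lambda>x. c (c x) - e (e x)) = (\<lambda>x. 4 *\<^sub>R ((a (a x) - a x) - (b (b x) - b x)))"
    unfolding sq by (rule ext) (simp add: algebra_simps)
  then have F: "bounded_by (\<lambda>x. c (c x) - e (e x)) (4 * \<epsilon>)"
    using bounded_by_scaleR[OF \<delta>, of 4] by simp
  have "(\<lambda>x. c (c (c x)) - e (e (e x)) - (c x - e x)) =
      (\<lambda>x. 8 *\<^sub>R (a (a (a x) - a x) - b (b (b x) - b x)) - 4 *\<^sub>R ((a (a x) - a x) - (b (b x) - b x)))"
    unfolding cube by (rule ext) (simp only: scaleR_right_diff_distrib, simp)
  then have H: "bounded_by (\<lambda>x. c (c (c x)) - e (e (e x)) - (c x - e x)) (12 * \<epsilon>)"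
    using bounded_by_diff[OF bounded_by_scaleR[OF \<eta>, of 8] bounded_by_scaleR[OF \<delta>, of 4]] by simp
  have D: "bounded_by (\<lambda>x. c x - e x) 4"
    using sing(1) difference_bound[OF sc \<epsilon> F H] by blast
  have cD: "bounded_by (\<lambda>x. c (c x - e x)) 16"
    using sing(2) weighted_difference_bound[OF sc \<epsilon> F H D] by blast
  have K: "bounded_by (\<lambda>x. c (c (e x) - e (e x)) + (c x - e x)) (20 * \<epsilon>)"
    using sing(3) cross_bound[OF sc \<epsilon> F H] by blast
  have "(\<lambda>x. a x - b x) = (\<lambda>x. (1/2) *\<^sub>R (c x - e x))"
    by (rule ext) (simp add: c_def e_def algebra_simps)
  then show "bounded_by (\<lambda>x. a x - b x) 2" using bounded_by_scaleR[OF D, of "1/2"] by simp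
  have divide: "y = (1 / r) *\<^sub>R z" if "r *\<^sub>R y = z" "r \<noteq> 0" for r and y z :: 'v
    using that by auto
  have "4 *\<^sub>R a (a x - b x) = c (c x - e x) + (c x - e x)" for x
    unfolding num c_def e_def by (simp add: la algebra_simps)
  then have "(\<lambda>x. a (a x - b x)) = (\<lambda>x. (1/4) *\<^sub>R (c (c x - e x) + (c x - e x)))"
    by (intro ext divide) simp_all
  then show "bounded_by (\<lambda>x. a (a x - b x)) 5"
    using bounded_by_scaleR[OF bounded_by_add[OF cD D], of "1/4"] by simp
  have "8 *\<^sub>R a (a (b x) - b (b x)) = c (c (e x) - e (e x)) + (c x - e x) + (c (c x) - e (e x))" for x
    unfolding num c_def e_def by (simp add: la algebra_simps)
  then have "(\<lambda>x. a (a (b x) - b (b x))) =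
      (\<lambda>x. (1/8) *\<^sub>R (c (c (e x) - e (e x)) + (c x - e x) + (c (c x) - e (e x))))"
    by (intro ext divide) simp_all
  then show "bounded_by (\<lambda>x. a (a (b x) - b (b x))) (3 * \<epsilon>)"
    using bounded_by_scaleR[OF bounded_by_add[OF K F], of "1/8"] by simp
qed

section \<open>Almost idempotency without bounds on the norms\<close>

context
  fixes a b :: "'v::real_inner \<Rightarrow> 'v" and \<epsilon> :: real
  assumes a: "symmetric_map a" and b: "symmetric_map b" and \<epsilon>: "0 \<le> \<epsilon>" "\<epsilon> \<le> 1"
  fixes d a' b' w :: "'v \<Rightarrow> 'v"
  defines "d \<equiv> \<lambda>x. a x - b x"
    and "a' \<equiv> \<lambda>x. x - a x"
    and "b' \<equiv> \<lambda>x. x - b x"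
    and "w \<equiv> \<lambda>x. a' (a' x) + a (a x)"
  assumes d: "bounded_by d 2" and ad: "bounded_by (\<lambda>x. a (d x)) 5"
    and q: "bounded_by (\<lambda>x. a (d (b x))) (3 * \<epsilon>)"
    and \<delta>: "bounded_by (\<lambda>x. (a (a x) - a x) - (b (b x) - b x)) \<epsilon>"
begin

lemma lin_a: "a (x + y) = a x + a y" "a (x - y) = a x - a y" "a (- x) = - a x"
  using a by (simp_all add: symmetric_map_def linear_add linear_diff linear_neg)

lemma lin_b: "b (x + y) = b x + b y" "b (x - y) = b x - b y" "b (- x) = - b x"
  using b by (simp_all add: symmetric_map_def linear_add linear_diff linear_neg)

lemma lin_d: "d (x + y) = d x + d y" "d (x - y) = d x - d y" "d (- x) = - d x"
  by (simp_all add: d_def lin_a lin_b algebra_simps)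

lemma lin_a': "a' (x + y) = a' x + a' y" "a' (x - y) = a' x - a' y" "a' (- x) = - a' x"
  by (simp_all add: a'_def lin_a algebra_simps)

lemma b_eq: "b x = a x - d x"
  by (simp add: d_def)

lemma sym_a: "inner (a x) y = inner x (a y)"
  using a by (simp add: symmetric_map_def)

lemma sym_b: "inner (b x) y = inner x (b y)"
  using b by (simp add: symmetric_map_def)

lemma sym_d: "inner (d x) y = inner x (d y)"
  by (simp add: d_def sym_a sym_b inner_diff_left inner_diff_right)

lemma sym_a': "inner (a' x) y = inner x (a' y)"
  by (simp add: a'_def sym_a inner_diff_left inner_diff_right)

lemma sym_w: "inner (w x) y = inner x (w y)"
  by (simp add: w_def sym_a sym_a' inner_add_left inner_add_right)

lemmas syms = sym_a sym_b sym_d sym_a' sym_w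

text \<open>With \<open>b\<close> expanded to \<open>a - d\<close> and \<open>d\<close> kept as a letter, identities between
  noncommutative polynomials become equalities of sums of words in \<open>a\<close> and \<open>d\<close>.\<close>

lemmas normal_form = b_eq lin_a lin_d a'_def b'_def w_def

lemma bound_da: "bounded_by (\<lambda>x. d (a x)) 5"
  by (rule bounded_by_adjoint[OF ad]) (simp add: syms)

lemma bound_bda: "bounded_by (\<lambda>x. b (d (a x))) (3 * \<epsilon>)"
  by (rule bounded_by_adjoint[OF q]) (simp add: syms)

lemma bound_a'd: "bounded_by (\<lambda>x. a' (d x)) 7"
  using bounded_by_diff[OF d ad] by (simp add: a'_def)

lemma bound_da': "bounded_by (\<lambda>x. d (a' x)) 7"
  by (rule bounded_by_adjoint[OF bound_a'd]) (simp add: syms)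

text \<open>\<open>(1 - a) d (1 - b) - a d b = d - a d - d b\<close>, and \<open>a d + d b = a\<^sup>2 - b\<^sup>2\<close>.\<close>

lemma bound_a'db': "bounded_by (\<lambda>x. a' (d (b' x))) (4 * \<epsilon>)"
proof -
  have "(\<lambda>x. a' (d (b' x))) = (\<lambda>x. a (d (b x)) - ((a (a x) - a x) - (b (b x) - b x)))"
    by (rule ext) (simp add: normal_form algebra_simps)
  then show ?thesis using bounded_by_diff[OF q \<delta>] by simp
qed

text \<open>Insert \<open>b + (1 - b) = 1\<close> between the two factors \<open>d\<close>: one summand contains \<open>b d a\<close>, the other
  \<open>(1 - a) d (1 - b)\<close>, and both are small. This smallness of \<open>(1 - a) d\<^sup>2 a\<close> is what makes all
  blocks of the defect small.\<close>

lemma bound_a'dda: "bounded_by (\<lambda>x. a' (d (d (a x)))) (41 * \<epsilon>)"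
proof -
  have "(\<lambda>x. a' (d (d (a x)))) = (\<lambda>x. a' (d (b (d (a x)))) + a' (d (b' (d (a x)))))"
    by (rule ext) (simp add: normal_form algebra_simps)
  moreover have "bounded_by (\<lambda>x. a' (d (b (d (a x)))) + a' (d (b' (d (a x))))) (7 * (3 * \<epsilon>) + 4 * \<epsilon> * 5)"
    using \<epsilon> by (intro bounded_by_add bounded_by_comp[OF bound_a'd bound_bda] bounded_by_comp[OF bound_a'db' bound_da]) auto
  ultimately show ?thesis by simp
qed

lemma bound_adda': "bounded_by (\<lambda>x. a (d (d (a' x)))) (41 * \<epsilon>)"
  by (rule bounded_by_adjoint[OF bound_a'dda]) (simp add: syms)

lemma bound_ada: "bounded_by (\<lambda>x. a (d (a x))) 13"
proof -
  have "(\<lambda>x. a (d (a x))) = (\<lambda>x. a (d (b x)) + a (d (d x)))"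
    by (rule ext) (simp add: normal_form algebra_simps)
  moreover have "bounded_by (\<lambda>x. a (d (b x)) + a (d (d x))) (3 * \<epsilon> + 5 * 2)"
    by (intro bounded_by_add q bounded_by_comp[OF ad d]) auto
  ultimately show ?thesis using \<epsilon> bounded_by_mono by fastforce
qed

lemma bound_a'da: "bounded_by (\<lambda>x. a' (d (a x))) 18"
  using bounded_by_diff[OF bound_da bound_ada] by (simp add: a'_def)

lemma bound_ada': "bounded_by (\<lambda>x. a (d (a' x))) 18"
  by (rule bounded_by_adjoint[OF bound_a'da]) (simp add: syms)

text \<open>Since \<open>w = 1 - 2 (1 - a) a\<close>, the term beyond \<open>(1 - a) d\<^sup>2 a\<close> is \<open>- 2 ((1 - a) d (1 - a)) (a d a)\<close>; in these
  two factors replace the second \<open>1 - a\<close> by \<open>(1 - b) - d\<close> and the second \<open>a\<close> by \<open>b + d\<close>.\<close>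

lemma bound_block_12: "bounded_by (\<lambda>x. a' (d (w (d (a x))))) (557 * \<epsilon>)"
proof -
  let ?T = "\<lambda>x. - a' (d (b' (a (d (a x))))) + a' (d (d (a (d (b x))))) + a' (d (d (a (d (d x)))))"
  have "(\<lambda>x. a' (d (w (d (a x))))) = (\<lambda>x. a' (d (d (a x))) + (?T x + ?T x))"
    by (rule ext) (simp add: normal_form algebra_simps)
  moreover have "bounded_by ?T (4 * \<epsilon> * 13 + 7 * (2 * (3 * \<epsilon>)) + 41 * \<epsilon> * (2 * 2))"
    using \<epsilon> by (intro bounded_by_add bounded_by_uminus bounded_by_comp[OF bound_a'db' bound_ada]
      bounded_by_comp[OF bound_a'd bounded_by_comp[OF d q]]
      bounded_by_comp[OF bound_a'dda bounded_by_comp[OF d d]]) auto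
  from bounded_by_add[OF bound_a'dda bounded_by_add[OF this this]]
  have "bounded_by (\<lambda>x. a' (d (d (a x))) + (?T x + ?T x)) (557 * \<epsilon>)" by simp
  ultimately show ?thesis by simp
qed

lemma bound_block_21: "bounded_by (\<lambda>x. a (d (w (d (a' x))))) (557 * \<epsilon>)"
  by (rule bounded_by_adjoint[OF bound_block_12]) (simp add: syms)

text \<open>The identity of the proof uses \<open>a d a = a d b + a d\<^sup>2\<close> and \<open>w = 1 - 2 a (1 - a)\<close>.\<close>

lemma bound_block_22: "bounded_by (\<lambda>x. a (d (w (d (a x)))) - a (d (a x))) (562 * \<epsilon>)"
proof -
  let ?T = "\<lambda>x. a (d (b (a' (d (a x))))) + a (d (d (a' (d (a x)))))"
  have "(\<lambda>x. a (d (w (d (a x)))) - a (d (a x))) =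
      (\<lambda>x. - (a (d (d (a' x))) + a (d (b x)) + (?T x + ?T x)))"
    by (rule ext) (simp add: normal_form algebra_simps)
  moreover have "bounded_by ?T (3 * \<epsilon> * 18 + 41 * \<epsilon> * 5)"
    using \<epsilon> by (intro bounded_by_add bounded_by_comp[OF q bound_a'da] bounded_by_comp[OF bound_adda' bound_da]) auto
  from bounded_by_uminus[OF bounded_by_add[OF bounded_by_add[OF bound_adda' q] bounded_by_add[OF this this]]]
  have "bounded_by (\<lambda>x. - (a (d (d (a' x))) + a (d (b x)) + (?T x + ?T x))) (562 * \<epsilon>)" by simp
  ultimately show ?thesis by simp
qed

text \<open>The identity of the proof uses \<open>(1 - a) d (1 - a) = (1 - a) d (1 - b) - (1 - a) d\<^sup>2\<close>.\<close>

lemma bound_block_11: "bounded_by (\<lambda>x. a' (d (a' x)) + a' (d (w (d (a' x))))) (763 * \<epsilon>)"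
proof -
  let ?T = "\<lambda>x. a' (d (d (a (d (a' x))))) - a' (d (b' (a (d (a' x)))))"
  have "(\<lambda>x. a' (d (a' x)) + a' (d (w (d (a' x))))) =
      (\<lambda>x. a' (d (b' x)) - a' (d (d (a x))) + (?T x + ?T x))"
    by (rule ext) (simp add: normal_form algebra_simps)
  moreover have "bounded_by ?T (41 * \<epsilon> * 7 + 4 * \<epsilon> * 18)"
    using \<epsilon> by (intro bounded_by_diff bounded_by_comp[OF bound_a'dda bound_da'] bounded_by_comp[OF bound_a'db' bound_ada']) auto
  from bounded_by_add[OF bounded_by_diff[OF bound_a'db' bound_a'dda] bounded_by_add[OF this this]]
  have "bounded_by (\<lambda>x. a' (d (b' x)) - a' (d (d (a x))) + (?T x + ?T x)) (763 * \<epsilon>)" by simp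
  ultimately show ?thesis by simp
qed

text \<open>For \<open>z = (z1, z2)\<close> the vectors \<open>p1\<close>, \<open>p2\<close> are the components of \<open>P''(a, b) z\<close>, so that the bounded
  expressions are those of \<open>(P''\<^sup>2 - P'') z\<close>. The form of \<open>p1\<close> and \<open>p2\<close> reflects
  \<open>P'' = E\<^sub>1\<^sub>1 + W d W\<^sup>*\<close> with \<open>W\<close> the column \<open>(1 - a, - a)\<close>, for which \<open>W\<^sup>* W = w\<close>.\<close>

lemma almost_idempotent:
  fixes z1 z2 :: 'v
  defines "p1 \<equiv> z1 + a' (d (a' z1 - a z2))" and "p2 \<equiv> - a (d (a' z1 - a z2))"
  shows "norm (p1 + a' (d (a' p1 - a p2)) - p1) \<le> 763 * \<epsilon> * (norm z1 + norm z2)"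
    and "norm (- a (d (a' p1 - a p2)) - p2) \<le> 763 * \<epsilon> * (norm z1 + norm z2)"
proof -
  have y: "a' p1 - a p2 = a' z1 + w (d (a' z1 - a z2))"
    unfolding p1_def p2_def w_def by (simp add: lin_a lin_a' lin_d)
  \<comment> \<open>the constant of the worst block serves for all of them\<close>
  have up: "x \<le> 763 * \<epsilon> * norm z" if "x \<le> r * \<epsilon> * norm z" "r \<le> 763" for x r and z :: 'v
    using that \<epsilon> by (meson mult_right_mono norm_ge_zero order_trans)
  have lin_w: "w (x - y) = w x - w y" for x y
    by (simp add: w_def lin_a lin_a')
  have "p1 + a' (d (a' p1 - a p2)) - p1
      = (a' (d (a' z1)) + a' (d (w (d (a' z1))))) - a' (d (w (d (a z2))))"
    unfolding y by (simp add: lin_w lin_d lin_a')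
  then have "norm (p1 + a' (d (a' p1 - a p2)) - p1) \<le>
      norm (a' (d (a' z1)) + a' (d (w (d (a' z1))))) + norm (a' (d (w (d (a z2)))))"
    by (simp only: norm_triangle_ineq4)
  also have "\<dots> \<le> 763 * \<epsilon> * norm z1 + 763 * \<epsilon> * norm z2"
    by (intro add_mono up[OF bounded_byD[OF bound_block_11]] up[OF bounded_byD[OF bound_block_12]]) auto
  finally show "norm (p1 + a' (d (a' p1 - a p2)) - p1) \<le> 763 * \<epsilon> * (norm z1 + norm z2)"
    by (simp only: distrib_left)
  have "- a (d (a' p1 - a p2)) - p2
      = (a (d (w (d (a z2)))) - a (d (a z2))) - a (d (w (d (a' z1))))"
    unfolding y unfolding p2_def by (simp add: lin_w lin_d lin_a)
  then have "norm (- a (d (a' p1 - a p2)) - p2) \<le>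
      norm (a (d (w (d (a z2)))) - a (d (a z2))) + norm (a (d (w (d (a' z1)))))"
    by (simp only: norm_triangle_ineq4)
  also have "\<dots> \<le> 763 * \<epsilon> * norm z2 + 763 * \<epsilon> * norm z1"
    by (intro add_mono up[OF bounded_byD[OF bound_block_22]] up[OF bounded_byD[OF bound_block_21]]) auto
  finally show "norm (- a (d (a' p1 - a p2)) - p2) \<le> 763 * \<epsilon> * (norm z1 + norm z2)"
    by (simp only: distrib_left add.commute)
qed

end

section \<open>Unitary diagonalization of selfadjoint matrices\<close>

text \<open>Complete \<open>v\<close> to a basis, orthogonalize, and normalize the columns.\<close>

lemma unitary_with_first_column:
  fixes v :: "complex vec"
  assumes v: "v \<in> carrier_vec n" and v0: "v \<noteq> 0\<^sub>v n"
  obtains U r where "U \<in> carrier_mat n n" "mat_adjoint U * U = 1\<^sub>m n" "col U 0 = r \<cdot>\<^sub>v v"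
proof -
  interpret cof_vec_space n "TYPE(complex)" .
  define ws where "ws = gram_schmidt n (basis_completion v)"
  have n: "0 < n" using v v0 by (cases n) auto
  note b = basis_completion[OF v v0]
  have "basis_completion v \<noteq> []" using b(6) n by auto
  then obtain vs where bv: "basis_completion v = v # vs" using b(7) by (cases "basis_completion v") auto
  have ws: "set ws \<subseteq> carrier_vec n" "corthogonal ws" "length ws = n"
    using gram_schmidt_result[OF b(2) b(4) b(5) refl] b(6) by (auto simp: ws_def)
  have hd: "ws ! 0 = v"
    using gram_schmidt_hd[OF v, of vs, folded bv] ws(3) n unfolding ws_def
    by (metis hd_conv_nth length_0_conv less_numeral_extra(3))
  have wsc: "ws ! i \<in> carrier_vec n" if "i < n" for i using ws that by auto
  define sq where "sq = (\<lambda>i. \<Sum>k<n. (cmod (ws ! i $ k))\<^sup>2)"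
  have prod: "ws ! i \<bullet>c ws ! j = (\<Sum>k<n. ws ! i $ k * cnj (ws ! j $ k))" if "i < n" "j < n" for i j
    using wsc[OF that(1)] wsc[OF that(2)] by (simp add: scalar_prod_def atLeast0LessThan)
  have sq: "ws ! i \<bullet>c ws ! i = complex_of_real (sq i)" if "i < n" for i
    unfolding prod[OF that that] sq_def by (simp only: of_real_sum complex_norm_square)
  have sq_pos: "0 < sq i" if "i < n" for i
  proof -
    have "sq i \<noteq> 0" using corthogonalD[OF ws(2), of i i] sq[OF that] ws(3) that by auto
    moreover have "0 \<le> sq i" by (auto simp: sq_def intro: sum_nonneg)
    ultimately show ?thesis by simp
  qed
  define U where "U = mat n n (\<lambda>(i, j). ws ! j $ i / complex_of_real (sqrt (sq j)))"
  have U: "U \<in> carrier_mat n n" by (simp add: U_def)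
  have "mat_adjoint U * U = 1\<^sub>m n"
  proof (rule eq_matI)
    fix i j assume "i < dim_row (1\<^sub>m n)" "j < dim_col (1\<^sub>m n)"
    then have ij: "i < n" "j < n" by auto
    have "(mat_adjoint U * U) $$ (i, j) = (\<Sum>k<n. cnj (U $$ (k, i)) * U $$ (k, j))"
      using U ij by (simp add: scalar_prod_def atLeast0LessThan)
    also have "\<dots> = (ws ! j \<bullet>c ws ! i) / (complex_of_real (sqrt (sq i)) * complex_of_real (sqrt (sq j)))"
      unfolding prod[OF ij(2,1)] sum_divide_distrib using ij by (simp add: U_def mult.commute)
    also have "\<dots> = (if i = j then 1 else 0)"
    proof (cases "i = j")
      case True
      then have "complex_of_real (sqrt (sq i)) * complex_of_real (sqrt (sq j)) = complex_of_real (sq i)"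
        using sq_pos[OF ij(1)] by (simp flip: of_real_mult)
      then show ?thesis using True sq[OF ij(1)] sq_pos[OF ij(1)] by simp
    next
      case False
      then show ?thesis using corthogonalD[OF ws(2), of j i] ws(3) ij by simp
    qed
    finally show "(mat_adjoint U * U) $$ (i, j) = 1\<^sub>m n $$ (i, j)" using ij by simp
  qed (use U in auto)
  moreover have "col U 0 = (1 / complex_of_real (sqrt (sq 0))) \<cdot>\<^sub>v v"
    using n v by (intro eq_vecI) (auto simp: U_def hd)
  ultimately show ?thesis using U that by blast
qed

definition diag_real :: "nat \<Rightarrow> (nat \<Rightarrow> real) \<Rightarrow> complex mat" where
  "diag_real n l = mat n n (\<lambda>(i, j). if i = j then complex_of_real (l i) else 0)"

lemma diag_real_carrier [simp]: "diag_real n l \<in> carrier_mat n n"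
  by (simp add: diag_real_def)

lemma unitary_right:
  assumes "U \<in> carrier_mat n n" "mat_adjoint U * U = 1\<^sub>m n"
  shows "U * mat_adjoint U = (1\<^sub>m n :: complex mat)"
  using assms mat_mult_left_right_inverse by (metis mat_adjoint_carrier)

text \<open>Induction on the size: conjugating with a unitary whose first column is a unit eigenvector splits off
  a \<open>1 \<times> 1\<close> block, since the first column of the result is a multiple of the first unit vector and, by
  selfadjointness, so is the first row.\<close>

lemma hermitian_diagonalization:
  fixes A :: "complex mat"
  assumes "A \<in> carrier_mat n n" "mat_adjoint A = A"
  shows "\<exists>U l. U \<in> carrier_mat n n \<and> mat_adjoint U * U = 1\<^sub>m n \<and> A = U * diag_real n l * mat_adjoint U"
  using assms
proof (induction n arbitrary: A)
  case 0
  then show ?case by (intro exI[of _ "1\<^sub>m 0"]) (auto intro!: eq_matI)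
next
  case (Suc m)
  let ?n = "Suc m"
  note A = Suc.prems(1)
  obtain e v where ev: "eigenvector A v e"
    using spectrum_non_empty[OF A] unfolding spectrum_def eigenvalue_def by auto
  then have v: "v \<in> carrier_vec ?n" "v \<noteq> 0\<^sub>v ?n" "A *\<^sub>v v = e \<cdot>\<^sub>v v"
    using A by (auto simp: eigenvector_def)
  obtain U r where U: "U \<in> carrier_mat ?n ?n" "mat_adjoint U * U = 1\<^sub>m ?n" "col U 0 = r \<cdot>\<^sub>v v"
    using unitary_with_first_column[OF v(1,2)] .
  define V where "V = mat_adjoint U"
  have V: "V \<in> carrier_mat ?n ?n" "V * U = 1\<^sub>m ?n" "U * V = 1\<^sub>m ?n"
    using U unitary_right[OF U(1,2)] by (auto simp: V_def)
  define B where "B = V * (A * U)"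
  have B: "B \<in> carrier_mat ?n ?n" using A U V by (auto simp: B_def)
  have assoc: "X * Y * Z = X * (Y * Z)"
    if "X \<in> carrier_mat ?n ?n" "Y \<in> carrier_mat ?n ?n" "Z \<in> carrier_mat ?n ?n" for X Y Z :: "complex mat"
    using that by (rule assoc_mult_mat)
  have cl: "X * Y \<in> carrier_mat ?n ?n"
    if "X \<in> carrier_mat ?n ?n" "Y \<in> carrier_mat ?n ?n" for X Y :: "complex mat"
    using that by (rule mult_carrier_mat)
  have Badj: "mat_adjoint B = B"
    unfolding B_def using mat_adjoint_mult[OF V(1) cl[OF A U(1)]] mat_adjoint_mult[OF A U(1)] Suc.prems(2)
    by (simp add: V_def assoc A U mat_adjoint_carrier[OF U(1)])
  have AUV: "A = U * B * V"
  proof -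
    have "U * B * V = (U * V) * (A * (U * V))"
      unfolding B_def by (simp only: assoc cl A U V(1))
    then show ?thesis using A by (simp add: V)
  qed
  have B0: "B $$ (i, 0) = (if i = 0 then e else 0)" if i: "i < ?n" for i
  proof -
    have "col (A * U) 0 = A *\<^sub>v col U 0" using col_mult2[OF A U(1)] by simp
    also have "\<dots> = e \<cdot>\<^sub>v col U 0"
      unfolding U(3) using A v by (simp add: mult_mat_vec smult_smult_assoc mult.commute)
    finally have "B $$ (i, 0) = row V i \<bullet> (e \<cdot>\<^sub>v col U 0)"
      unfolding B_def using i A U V by simp
    also have "\<dots> = e * (row V i \<bullet> col U 0)"
      using U V(1) v(1) i by (intro scalar_prod_smult_distrib[of _ ?n]) auto
    also have "\<dots> = e * (V * U) $$ (i, 0)" using i U(1) V(1) by simp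
    finally show ?thesis using i by (simp add: V)
  qed
  have cnjB: "cnj (B $$ (j, i)) = B $$ (i, j)" if "i < ?n" "j < ?n" for i j
    using index_mat_adjoint[of i B j] that B Badj by simp
  have B0': "B $$ (0, j) = (if j = 0 then e else 0)" if "j < ?n" for j
    using cnjB[of 0 j] B0[OF that] B0[of 0] that by (cases "j = 0") auto
  have e: "e = complex_of_real (Re e)"
    using cnjB[of 0 0] B0[of 0] by (simp add: complex_eq_iff)
  define C where "C = mat m m (\<lambda>(i, j). B $$ (Suc i, Suc j))"
  have C: "C \<in> carrier_mat m m" by (simp add: C_def)
  have "mat_adjoint C = C"
    using cnjB by (intro eq_matI) (auto simp: C_def)
  then obtain U1 l1 where U1: "U1 \<in> carrier_mat m m" "mat_adjoint U1 * U1 = 1\<^sub>m m"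
      "C = U1 * diag_real m l1 * mat_adjoint U1"
    using Suc.IH[OF C] by blast
  define l where "l = case_nat (Re e) l1"
  let ?E = "mat 1 1 (\<lambda>_. e) :: complex mat"
  let ?blk = "\<lambda>X Y. four_block_mat X (0\<^sub>m 1 m) (0\<^sub>m m 1) (Y :: complex mat)"
  define U2 where "U2 = ?blk (1\<^sub>m 1) U1"
  have U2: "U2 \<in> carrier_mat ?n ?n" using U1 by (auto simp: U2_def intro: carrier_matI)
  have one_adj: "mat_adjoint (1\<^sub>m k) = (1\<^sub>m k :: complex mat)" for k by (rule eq_matI) auto
  have U2a: "mat_adjoint U2 = ?blk (1\<^sub>m 1) (mat_adjoint U1)"
    unfolding U2_def using adjoint_diag_block[OF one_carrier_mat[of 1] U1(1)] by (simp add: one_adj)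
  have Beq: "B = ?blk ?E C"
    using B B0 B0' by (intro eq_matI) (auto simp: C_def)
  have diag: "diag_real ?n l = ?blk ?E (diag_real m l1)"
    by (intro eq_matI) (auto simp: diag_real_def l_def e[symmetric] split: nat.split)
  have U1D: "U1 * diag_real m l1 \<in> carrier_mat m m" using U1(1) by (rule mult_carrier_mat) simp
  have "U2 * diag_real ?n l = ?blk (1\<^sub>m 1 * ?E) (U1 * diag_real m l1)"
    unfolding U2_def diag using U1(1) by (intro mult_diag_block) auto
  then have "U2 * diag_real ?n l * mat_adjoint U2
      = ?blk (1\<^sub>m 1 * ?E) (U1 * diag_real m l1) * ?blk (1\<^sub>m 1) (mat_adjoint U1)"
    by (simp only: U2a)
  also have "\<dots> = ?blk (1\<^sub>m 1 * ?E * 1\<^sub>m 1) (U1 * diag_real m l1 * mat_adjoint U1)"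
    using U1D mat_adjoint_carrier[OF U1(1)] by (intro mult_diag_block) auto
  finally have "U2 * diag_real ?n l * mat_adjoint U2 = ?blk ?E C"
    by (simp add: U1(3) left_mult_one_mat[of _ 1 1] right_mult_one_mat[of _ 1 1])
  then have B2: "B = U2 * diag_real ?n l * mat_adjoint U2" using Beq by simp
  have "mat_adjoint U2 * U2 = ?blk (1\<^sub>m 1) (1\<^sub>m m)"
    unfolding U2a unfolding U2_def using U1(1,2) mat_adjoint_carrier[OF U1(1)]
    by (subst mult_diag_block[of _ 1 1 _ m m _ 1 _ m]) auto
  also have "\<dots> = 1\<^sub>m ?n" by (intro eq_matI) auto
  finally have U2u: "mat_adjoint U2 * U2 = 1\<^sub>m ?n" .
  define U3 where "U3 = U * U2"
  have U3: "U3 \<in> carrier_mat ?n ?n" using cl[OF U(1) U2] by (simp add: U3_def)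
  have U3a: "mat_adjoint U3 = mat_adjoint U2 * V"
    unfolding U3_def V_def by (rule mat_adjoint_mult[OF U(1) U2])
  note [simp] = mat_adjoint_carrier[OF U2]
  have "mat_adjoint U3 * U3 = mat_adjoint U2 * ((V * U) * U2)"
    unfolding U3a unfolding U3_def using U U2 V(1) by (simp add: assoc cl)
  then have "mat_adjoint U3 * U3 = 1\<^sub>m ?n" using U2 U2u by (simp add: V)
  moreover have "A = U3 * diag_real ?n l * mat_adjoint U3"
    unfolding U3a unfolding AUV B2 U3_def using U U2 V(1) by (simp add: assoc cl)
  ultimately show ?case using U3 by blast
qed

section \<open>Matrices acting on finitely supported sequences\<close>

text \<open>The estimates above are about maps on a real inner product space, that is, on one type, whereas the size of
  the matrices is arbitrary. Finitely supported complex sequences contain all \<open>\<complex>\<^sup>n\<close>, and the real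
  part of the scalar product is enough for norms, symmetry and singular vectors.\<close>

typedef fin_seq = "{f :: nat \<Rightarrow> complex. finite {n. f n \<noteq> 0}}"
  morphisms coord Abs_fin_seq
  by (rule exI[of _ "\<lambda>_. 0"]) simp

setup_lifting type_definition_fin_seq

lemma finite_support: "finite {n. coord f n \<noteq> 0}"
  using coord[of f] by simp

lemma fin_seq_eqI: "(\<And>n. coord f n = coord g n) \<Longrightarrow> f = g"
  by (simp add: coord_inject[symmetric] fun_eq_iff)

instantiation fin_seq :: real_vector
begin

lift_definition zero_fin_seq :: fin_seq is "\<lambda>_. 0" by simp

lift_definition plus_fin_seq :: "fin_seq \<Rightarrow> fin_seq \<Rightarrow> fin_seq" is "\<lambda>f g n. f n + g n"
  by (erule (1) finite_subset[OF _ finite_UnI, rotated]) auto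

lift_definition minus_fin_seq :: "fin_seq \<Rightarrow> fin_seq \<Rightarrow> fin_seq" is "\<lambda>f g n. f n - g n"
  by (erule (1) finite_subset[OF _ finite_UnI, rotated]) auto

lift_definition uminus_fin_seq :: "fin_seq \<Rightarrow> fin_seq" is "\<lambda>f n. - f n" by simp

lift_definition scaleR_fin_seq :: "real \<Rightarrow> fin_seq \<Rightarrow> fin_seq" is "\<lambda>r f n. r *\<^sub>R f n"
  by (erule finite_subset[rotated]) auto

lemmas coord_simps = zero_fin_seq.rep_eq plus_fin_seq.rep_eq minus_fin_seq.rep_eq
  uminus_fin_seq.rep_eq scaleR_fin_seq.rep_eq

instance
  by standard (rule fin_seq_eqI, simp add: coord_simps algebra_simps)+

end

instantiation fin_seq :: real_inner
begin

definition inner_fin_seq :: "fin_seq \<Rightarrow> fin_seq \<Rightarrow> real" where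
  "inner_fin_seq f g = (\<Sum>n | coord f n \<noteq> 0. inner (coord f n) (coord g n))"

definition norm_fin_seq :: "fin_seq \<Rightarrow> real" where "norm_fin_seq f = sqrt (inner f f)"

definition dist_fin_seq :: "fin_seq \<Rightarrow> fin_seq \<Rightarrow> real" where "dist_fin_seq f g = norm (f - g)"

definition sgn_fin_seq :: "fin_seq \<Rightarrow> fin_seq" where "sgn_fin_seq f = f /\<^sub>R norm f"

definition uniformity_fin_seq :: "(fin_seq \<times> fin_seq) filter" where
  "uniformity_fin_seq = (INF e\<in>{0<..}. principal {(x, y). dist x y < e})"

definition open_fin_seq :: "fin_seq set \<Rightarrow> bool" where
  "open_fin_seq U = (\<forall>x\<in>U. eventually (\<lambda>(x', y). x' = x \<longrightarrow> y \<in> U) uniformity)"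

lemma inner_fin_seq_superset:
  assumes "finite S" "{n. coord f n \<noteq> 0} \<subseteq> S"
  shows "inner f g = (\<Sum>n\<in>S. inner (coord f n) (coord g n))"
  unfolding inner_fin_seq_def using assms by (intro sum.mono_neutral_left) auto

instance
proof
  fix f g h :: fin_seq and r :: real
  show "dist f g = norm (f - g)" "sgn f = f /\<^sub>R norm f" "norm f = sqrt (inner f f)"
    by (simp_all add: dist_fin_seq_def sgn_fin_seq_def norm_fin_seq_def)
  show "uniformity = (INF e\<in>{0<..}. principal {(x :: fin_seq, y). dist x y < e})"
    by (rule uniformity_fin_seq_def)
  show "open U = (\<forall>x\<in>U. \<forall>\<^sub>F (x', y) in uniformity. x' = x \<longrightarrow> y \<in> U)" for U :: "fin_seq set"
    by (rule open_fin_seq_def)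
  let ?S = "{n. coord f n \<noteq> 0} \<union> {n. coord g n \<noteq> 0}"
  have S: "finite ?S" using finite_support by simp
  have "inner f g = (\<Sum>n\<in>?S. inner (coord f n) (coord g n))"
    using S by (intro inner_fin_seq_superset) auto
  also have "\<dots> = (\<Sum>n\<in>?S. inner (coord g n) (coord f n))" by (simp add: inner_commute)
  also have "\<dots> = inner g f" using S by (intro inner_fin_seq_superset[symmetric]) auto
  finally show "inner f g = inner g f" .
  have "inner (f + g) h = (\<Sum>n\<in>?S. inner (coord (f + g) n) (coord h n))"
    using S by (intro inner_fin_seq_superset) (auto simp: coord_simps)
  also have "\<dots> = (\<Sum>n\<in>?S. inner (coord f n) (coord h n)) + (\<Sum>n\<in>?S. inner (coord g n) (coord h n))"
    by (simp add: coord_simps inner_add_left sum.distrib)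
  also have "\<dots> = inner f h + inner g h"
    using S inner_fin_seq_superset[of ?S f h] inner_fin_seq_superset[of ?S g h] by simp
  finally show "inner (f + g) h = inner f h + inner g h" .
  have "inner (r *\<^sub>R f) g = (\<Sum>n\<in>?S. inner (coord (r *\<^sub>R f) n) (coord g n))"
    using S by (intro inner_fin_seq_superset) (auto simp: coord_simps)
  also have "\<dots> = r * inner f g"
    using S inner_fin_seq_superset[of ?S f g] by (simp add: coord_simps sum_distrib_left)
  finally show "inner (r *\<^sub>R f) g = r * inner f g" .
  show "0 \<le> inner f f" unfolding inner_fin_seq_def by (intro sum_nonneg inner_ge_zero)
  show "inner f f = 0 \<longleftrightarrow> f = 0"
  proof
    assume "inner f f = 0"
    then have "\<forall>n\<in>{n. coord f n \<noteq> 0}. inner (coord f n) (coord f n) = 0"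
      unfolding inner_fin_seq_def using sum_nonneg_eq_0_iff[OF finite_support[of f]]
      by (metis (no_types, lifting) inner_ge_zero)
    then show "f = 0" by (intro fin_seq_eqI) (auto simp: coord_simps)
  qed (simp add: inner_fin_seq_def coord_simps)
qed

end

lift_definition seq_of :: "complex vec \<Rightarrow> fin_seq" is "\<lambda>v n. if n < dim_vec v then vec_index v n else 0"
  by (rule finite_subset[of _ "{..<dim_vec _}"]) auto

text \<open>A matrix acts through the first coordinates and returns a sequence supported on its rows, so that
  the identity matrix of size \<open>k\<close> acts as the projection onto the first \<open>k\<close> coordinates.\<close>

definition act :: "complex mat \<Rightarrow> fin_seq \<Rightarrow> fin_seq" where
  "act M f = seq_of (M *\<^sub>v vec (dim_col M) (coord f))"

lemma coord_seq_of: "coord (seq_of v) n = (if n < dim_vec v then vec_index v n else 0)"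
  by (simp add: seq_of.rep_eq)

lemma coord_act: "coord (act M f) i = (if i < dim_row M then \<Sum>j<dim_col M. M $$ (i, j) * coord f j else 0)"
  by (simp add: act_def coord_seq_of scalar_prod_def atLeast0LessThan)

lemma act_seq_of: "M \<in> carrier_mat r c \<Longrightarrow> v \<in> carrier_vec c \<Longrightarrow> act M (seq_of v) = seq_of (M *\<^sub>v v)"
  by (intro fin_seq_eqI) (auto simp: coord_act coord_seq_of scalar_prod_def atLeast0LessThan)

lemma linear_act: "linear (act M)"
  by (intro linearI fin_seq_eqI)
    (auto simp: coord_act plus_fin_seq.rep_eq scaleR_fin_seq.rep_eq sum.distrib distrib_left
       scaleR_conv_of_real sum_distrib_left mult_ac)

lemma act_mult: "A \<in> carrier_mat r m \<Longrightarrow> B \<in> carrier_mat m c \<Longrightarrow> act (A * B) f = act A (act B f)"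
proof (rule fin_seq_eqI)
  fix i assume A: "A \<in> carrier_mat r m" and B: "B \<in> carrier_mat m c"
  show "coord (act (A * B) f) i = coord (act A (act B f)) i"
  proof (cases "i < r")
    case True
    have "coord (act (A * B) f) i = (\<Sum>j<c. (\<Sum>k<m. A $$ (i, k) * B $$ (k, j)) * coord f j)"
      using A B True by (simp add: coord_act scalar_prod_def atLeast0LessThan)
    also have "\<dots> = (\<Sum>j<c. \<Sum>k<m. A $$ (i, k) * (B $$ (k, j) * coord f j))"
      by (simp add: sum_distrib_right mult.assoc)
    also have "\<dots> = (\<Sum>k<m. \<Sum>j<c. A $$ (i, k) * (B $$ (k, j) * coord f j))" by (rule sum.swap)
    also have "\<dots> = (\<Sum>k<m. A $$ (i, k) * (\<Sum>j<c. B $$ (k, j) * coord f j))"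
      by (simp add: sum_distrib_left)
    also have "\<dots> = coord (act A (act B f)) i"
      using A B True by (simp add: coord_act)
    finally show ?thesis .
  qed (use A B in \<open>simp add: coord_act\<close>)
qed

lemma act_add: "A \<in> carrier_mat r c \<Longrightarrow> B \<in> carrier_mat r c \<Longrightarrow> act (A + B) f = act A f + act B f"
  by (rule fin_seq_eqI) (auto simp: coord_act coord_simps sum.distrib distrib_right)

lemma act_minus: "A \<in> carrier_mat r c \<Longrightarrow> B \<in> carrier_mat r c \<Longrightarrow> act (A - B) f = act A f - act B f"
  by (rule fin_seq_eqI) (auto simp: coord_act coord_simps sum_subtractf left_diff_distrib)

lemma seq_of_add: "v \<in> carrier_vec k \<Longrightarrow> w \<in> carrier_vec k \<Longrightarrow> seq_of (v + w) = seq_of v + seq_of w"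
  by (rule fin_seq_eqI) (auto simp: coord_seq_of coord_simps)

lemma seq_of_minus: "v \<in> carrier_vec k \<Longrightarrow> w \<in> carrier_vec k \<Longrightarrow> seq_of (v - w) = seq_of v - seq_of w"
  by (rule fin_seq_eqI) (auto simp: coord_seq_of coord_simps)

lemma inner_supported:
  assumes "\<And>i. k \<le> i \<Longrightarrow> coord f i = 0"
  shows "inner f g = (\<Sum>i<k. Re (coord f i * cnj (coord g i)))"
proof -
  have "inner f g = (\<Sum>i<k. inner (coord f i) (coord g i))"
    using assms by (intro inner_fin_seq_superset) (auto simp: not_less[symmetric])
  then show ?thesis by (simp add: inner_complex_def)
qed

lemma inner_self_supported:
  assumes "\<And>i. k \<le> i \<Longrightarrow> coord f i = 0"
  shows "inner f f = (\<Sum>i<k. (cmod (coord f i))\<^sup>2)"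
  using inner_supported[of k f f] assms by (simp add: complex_mult_cnj cmod_power2)

lemma norm_seq_of: "norm (seq_of v) = vec_l2norm v"
proof -
  have "inner (seq_of v) (seq_of v) = (\<Sum>i<dim_vec v. (cmod (vec_index v i))\<^sup>2)"
    by (subst inner_self_supported[of "dim_vec v"]) (auto simp: coord_seq_of)
  then show ?thesis by (simp add: norm_eq_sqrt_inner vec_l2norm_def L2_set_def)
qed

lemma inner_act: "inner (act M f) g = inner f (act (mat_adjoint M) g)"
proof -
  have "inner (act M f) g = Re (\<Sum>i<dim_row M. \<Sum>j<dim_col M. M $$ (i, j) * coord f j * cnj (coord g i))"
    by (subst inner_supported[of "dim_row M"]) (auto simp: coord_act sum_distrib_right)
  also have "\<dots> = Re (\<Sum>j<dim_col M. \<Sum>i<dim_row M. M $$ (i, j) * coord f j * cnj (coord g i))"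
    by (subst sum.swap) (rule refl)
  also have "\<dots> = Re (cnj (\<Sum>j<dim_col M. \<Sum>i<dim_row M. M $$ (i, j) * coord f j * cnj (coord g i)))"
    by (simp only: cnj.simps)
  also have "\<dots> = Re (\<Sum>j<dim_col M. \<Sum>i<dim_row M. cnj (M $$ (i, j)) * coord g i * cnj (coord f j))"
    by (simp add: mult_ac)
  also have "\<dots> = inner (act (mat_adjoint M) g) f"
    by (subst inner_supported[of "dim_col M"]) (auto simp: coord_act sum_distrib_right)
  finally show ?thesis by (simp add: inner_commute)
qed

lemma symmetric_act: "mat_adjoint A = A \<Longrightarrow> symmetric_map (act A)"
  using inner_act[of A] linear_act[of A] by (simp add: symmetric_map_def)

lemma act_one: "act (1\<^sub>m k) f = seq_of (vec k (coord f))"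
  by (simp add: act_def)

lemma act_one_seq_of: "v \<in> carrier_vec k \<Longrightarrow> act (1\<^sub>m k) (seq_of v) = seq_of v"
  by (simp add: act_seq_of[of _ k k])

text \<open>An orthogonal projection is a contraction.\<close>

lemma norm_act_one: "norm (act (1\<^sub>m k) f) \<le> norm f"
proof -
  have "mat_adjoint (1\<^sub>m k) = (1\<^sub>m k :: complex mat)" by (rule eq_matI) auto
  then have "inner (act (1\<^sub>m k) f) (act (1\<^sub>m k) f) = inner f (act (1\<^sub>m k) f)"
    by (simp add: inner_act act_mult[of _ k k _ k, symmetric])
  then have "norm (act (1\<^sub>m k) f) * norm (act (1\<^sub>m k) f) \<le> norm f * norm (act (1\<^sub>m k) f)"
    by (metis norm_cauchy_schwarz power2_norm_eq_inner power2_eq_square)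
  then show ?thesis by (cases "norm (act (1\<^sub>m k) f) = 0") auto
qed

lemma inner_diag_real: "inner g (act (diag_real k l) g) = (\<Sum>i<k. l i * (cmod (coord g i))\<^sup>2)"
proof -
  have c: "coord (act (diag_real k l) g) i = (if i < k then complex_of_real (l i) * coord g i else 0)" for i
  proof (cases "i < k")
    case True
    then have "coord (act (diag_real k l) g) i = (\<Sum>j<k. if j = i then complex_of_real (l i) * coord g j else 0)"
      unfolding coord_act using True
      by (simp add: diag_real_def del: sum.delta sum.delta', intro sum.cong refl) auto
    also have "\<dots> = complex_of_real (l i) * coord g i" using True by (subst sum.delta) auto
    finally show ?thesis using True by simp
  qed (simp add: coord_act diag_real_def)
  have "inner (act (diag_real k l) g) g = (\<Sum>i<k. Re (coord (act (diag_real k l) g) i * cnj (coord g i)))"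
    by (rule inner_supported) (simp add: c)
  also have "\<dots> = (\<Sum>i<k. l i * (cmod (coord g i))\<^sup>2)"
    by (intro sum.cong refl) (simp add: c mult.assoc complex_mult_cnj cmod_power2)
  finally show ?thesis by (simp add: inner_commute)
qed

lemma mat_unit_vec_diag: "j < k \<Longrightarrow> diag_real k l *\<^sub>v unit_vec k j = complex_of_real (l j) \<cdot>\<^sub>v unit_vec k j"
  by (intro eq_vecI) (auto simp: diag_real_def)

lemma seq_of_smult: "seq_of (complex_of_real r \<cdot>\<^sub>v v) = r *\<^sub>R seq_of v"
  by (rule fin_seq_eqI) (auto simp: coord_seq_of coord_simps scaleR_conv_of_real)

text \<open>Diagonalize \<open>M\<^sup>* M\<close> and take for \<open>v\<close> an eigenvector of its largest eigenvalue \<open>s\<^sup>2\<close>, and \<open>u = M v / s\<close>. If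
  \<open>s = 0\<close> then \<open>M\<close> acts as zero and any unit vectors will do; for matrices of size \<open>0\<close> these have to
  come from outside the range of the action.\<close>

lemma singular_triple_exists:
  assumes M: "M \<in> carrier_mat k k"
  shows "\<exists>s u v. singular_triple (act M) s u v"
proof (cases "k = 0")
  case True
  let ?e = "seq_of (unit_vec 1 0)"
  have "norm ?e = 1" by (simp add: norm_seq_of vec_l2norm_def L2_set_def)
  moreover have "act M f = 0" for f
    using M True by (intro fin_seq_eqI) (simp add: coord_act coord_simps)
  ultimately have "singular_triple (act M) 0 ?e ?e" by (simp add: singular_triple_def bounded_by_def)
  then show ?thesis by blast
next
  case False
  define H where "H = mat_adjoint M * M"
  note Ma = mat_adjoint_carrier[OF M]
  have H: "H \<in> carrier_mat k k" unfolding H_def using Ma M by (rule mult_carrier_mat)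
  have "mat_adjoint H = H" unfolding H_def using mat_adjoint_mult[OF Ma M] by simp
  then obtain U l where U: "U \<in> carrier_mat k k" "mat_adjoint U * U = 1\<^sub>m k"
      and Hd: "H = U * diag_real k l * mat_adjoint U"
    using hermitian_diagonalization[OF H] by blast
  note Ua = mat_adjoint_carrier[OF U(1)]
  have actH: "act H f = act U (act (diag_real k l) (act (mat_adjoint U) f))" for f
    unfolding Hd using U(1) Ua
    by (simp add: act_mult[of _ k k _ k] mult_carrier_mat[of _ k k _ k])
  obtain j where j: "j < k" "\<And>i. i < k \<Longrightarrow> l i \<le> l j"
  proof -
    have "Max (l ` {..<k}) \<in> l ` {..<k}" using False by (intro Max_in) auto
    then obtain j where "j < k" "l j = Max (l ` {..<k})" by auto
    then show ?thesis using that[of j] by simp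
  qed
  have quad: "(norm (act M f))\<^sup>2 \<le> l j * (norm (act (mat_adjoint U) f))\<^sup>2"
    and quad0: "(norm (act M f))\<^sup>2 = inner f (act H f)" for f
  proof -
    let ?g = "act (mat_adjoint U) f"
    show 1: "(norm (act M f))\<^sup>2 = inner f (act H f)"
      unfolding H_def by (simp add: power2_norm_eq_inner inner_act act_mult[OF Ma M])
    also have "\<dots> = inner ?g (act (diag_real k l) ?g)"
      unfolding actH by (simp add: inner_act)
    also have "\<dots> \<le> (\<Sum>i<k. l j * (cmod (coord ?g i))\<^sup>2)"
      unfolding inner_diag_real using j by (intro sum_mono mult_right_mono) auto
    also have "\<dots> = l j * inner ?g ?g"
      using U(1) by (subst inner_self_supported[of k]) (auto simp: coord_act sum_distrib_left)
    finally show "(norm (act M f))\<^sup>2 \<le> l j * (norm ?g)\<^sup>2" by (simp add: power2_norm_eq_inner)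
  qed
  have Ubound: "(norm (act (mat_adjoint U) f))\<^sup>2 \<le> (norm f)\<^sup>2" for f
  proof -
    have "(norm (act (mat_adjoint U) f))\<^sup>2 = inner f (act (1\<^sub>m k) f)"
      using unitary_right[OF U]
      by (simp add: power2_norm_eq_inner inner_act act_mult[OF U(1) Ua, symmetric])
    also have "\<dots> \<le> norm f * norm (act (1\<^sub>m k) f)" by (rule norm_cauchy_schwarz)
    also have "\<dots> \<le> norm f * norm f" by (intro mult_left_mono norm_act_one) simp
    finally show ?thesis by (simp add: power2_eq_square)
  qed
  let ?e = "seq_of (unit_vec k j)"
  define v where "v = act U ?e"
  have UUe: "act (mat_adjoint U) v = ?e"
    unfolding v_def by (simp add: act_mult[OF Ua U(1), symmetric] U(2) act_one_seq_of)
  have ne: "norm ?e = 1"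
  proof -
    have "(\<Sum>i<k. (cmod (if i = j then 1 else 0))\<^sup>2) = (\<Sum>i<k. if i = j then 1 else 0 :: real)"
      by (intro sum.cong) auto
    then show ?thesis using j(1)
      by (simp add: norm_seq_of vec_l2norm_def L2_set_def unit_vec_def)
  qed
  have "(norm v)\<^sup>2 = inner ?e ?e"
    unfolding power2_norm_eq_inner using UUe by (metis inner_act v_def)
  then have "(norm v)\<^sup>2 = 1" using ne by (simp add: power2_norm_eq_inner[symmetric])
  then have nv: "norm v = 1" using real_sqrt_abs[of "norm v"] by simp
  have Hv: "act H v = l j *\<^sub>R v"
    unfolding actH UUe
    by (simp add: act_seq_of[of _ k k] mat_unit_vec_diag[OF j(1)] seq_of_smult linear_cmul[OF linear_act] v_def)
  have lj: "l j = (norm (act M v))\<^sup>2" unfolding quad0 Hv using nv by (simp add: dot_square_norm)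
  define s where "s = norm (act M v)"
  have s2: "l j = s\<^sup>2" "0 \<le> s" using lj by (auto simp: s_def)
  have bd: "bounded_by (act M) s"
  proof (rule bounded_byI)
    fix f
    have "(norm (act M f))\<^sup>2 \<le> s\<^sup>2 * (norm f)\<^sup>2"
      using quad[of f] mult_left_mono[OF Ubound[of f], of "s\<^sup>2"] s2 by simp
    then have "(norm (act M f))\<^sup>2 \<le> (s * norm f)\<^sup>2" by (simp add: power_mult_distrib)
    then show "norm (act M f) \<le> s * norm f" by (rule power2_le_imp_le) (simp add: s2)
  qed
  show ?thesis
  proof (cases "s = 0")
    case True
    then have "act M f = 0" for f using bounded_byD[OF bd, of f] by simp
    then have "singular_triple (act M) 0 v v" using nv by (simp add: singular_triple_def bounded_by_def)
    then show ?thesis by blast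
  next
    case False
    define u where "u = (1 / s) *\<^sub>R act M v"
    have "norm u = 1" using False s2(2) by (simp add: u_def s_def)
    moreover have "act M v = s *\<^sub>R u" using False by (simp add: u_def)
    moreover have "inner (act M x) u = s * inner x v" for x
    proof -
      have "inner (act M x) u = (1 / s) * inner x (act H v)"
        unfolding u_def H_def by (simp add: inner_act act_mult[OF Ma M])
      then show ?thesis unfolding Hv s2(1) using False by (simp add: power2_eq_square)
    qed
    ultimately have "singular_triple (act M) s u v" using nv bd by (simp add: singular_triple_def)
    then show ?thesis by blast
  qed
qed

section \<open>The operator norm of the defect of P''\<close>

lemma sum_lessThan_add: "(\<Sum>i<m + n. f i) = (\<Sum>i<m. f i) + (\<Sum>i<n. f (m + i))" for f :: "nat \<Rightarrow> 'b::comm_monoid_add"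
  by (induction n) (auto simp: add.assoc)

lemma vec_l2norm_append:
  "(vec_l2norm (v @\<^sub>v w))\<^sup>2 = (vec_l2norm v)\<^sup>2 + (vec_l2norm w)\<^sup>2"
  by (simp add: vec_l2norm_def L2_set_def sum_lessThan_add sum_nonneg)

lemma vec_l2norm_nonneg [simp]: "0 \<le> vec_l2norm v"
  by (simp add: vec_l2norm_def)

lemma op_norm_leI:
  assumes "\<And>v. v \<in> carrier_vec (dim_col A) \<Longrightarrow> vec_l2norm v \<le> 1 \<Longrightarrow> vec_l2norm (A *\<^sub>v v) \<le> r"
  shows "op_norm A \<le> r"
  unfolding op_norm_def
proof (rule cSUP_least)
  have "0\<^sub>v (dim_col A) \<in> {v \<in> carrier_vec (dim_col A). vec_l2norm v \<le> 1}"
    by (simp add: vec_l2norm_def L2_set_def)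
  then show "{v \<in> carrier_vec (dim_col A). vec_l2norm v \<le> 1} \<noteq> {}" by blast
qed (use assms in auto)

lemma act_one_act: "M \<in> carrier_mat k k \<Longrightarrow> act (1\<^sub>m k) (act M f) = act M f"
  by (simp add: act_mult[of _ k k _ k, symmetric])

lemma act_linear: "act M (f + g) = act M f + act M g" "act M (f - g) = act M f - act M g"
  "act M (- f) = - act M f" "act M (r *\<^sub>R f) = r *\<^sub>R act M f"
  using linear_act[of M] by (simp_all add: linear_add linear_diff linear_neg linear_cmul)

context
  fixes a b :: "complex mat" and k :: nat
  assumes a: "a \<in> carrier_mat k k" "mat_adjoint a = a"
    and b: "b \<in> carrier_mat k k" "mat_adjoint b = b"
begin

lemma act_rules:
  "A \<in> carrier_mat k k \<Longrightarrow> B \<in> carrier_mat k k \<Longrightarrow> act (A * B) f = act A (act B f)"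
  "A \<in> carrier_mat k k \<Longrightarrow> B \<in> carrier_mat k k \<Longrightarrow> act (A + B) f = act A f + act B f"
  "A \<in> carrier_mat k k \<Longrightarrow> B \<in> carrier_mat k k \<Longrightarrow> act (A - B) f = act A f - act B f"
  by (simp_all add: act_mult act_add act_minus)

lemma square_closed:
  "A \<in> carrier_mat k k \<Longrightarrow> B \<in> carrier_mat k k \<Longrightarrow> A * B \<in> carrier_mat k k"
  "A \<in> carrier_mat k k \<Longrightarrow> B \<in> carrier_mat k k \<Longrightarrow> A + B \<in> carrier_mat k k"
  "B \<in> carrier_mat k k \<Longrightarrow> A - B \<in> carrier_mat k k"
  by auto

lemmas act_simps = act_rules act_linear a(1) b(1) square_closed

text \<open>The maps \<open>c\<close> and \<open>e\<close> are not given by matrices, as they do not vanish on high coordinates. The three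
  combinations are, because each contains the factor \<open>a - b\<close>.\<close>

lemma singular_triples:
  fixes c e :: "fin_seq \<Rightarrow> fin_seq"
  defines "c \<equiv> \<lambda>x. 2 *\<^sub>R act a x - x" and "e \<equiv> \<lambda>x. 2 *\<^sub>R act b x - x"
  shows "\<exists>s u v. singular_triple (\<lambda>x. c x - e x) s u v"
    "\<exists>s u v. singular_triple (\<lambda>x. c (c x - e x)) s u v"
    "\<exists>s u v. singular_triple (\<lambda>x. c (c (e x) - e (e x)) + (c x - e x)) s u v"
proof -
  define D where "D = (a - b) + (a - b)"
  have D: "D \<in> carrier_mat k k" by (simp add: D_def square_closed a b)
  have D': "c x - e x = act D x" for x
    by (simp add: D_def act_simps c_def e_def scaleR_2)
  have "(\<lambda>x. c x - e x) = act D" by (simp add: D')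
  then show "\<exists>s u v. singular_triple (\<lambda>x. c x - e x) s u v" using singular_triple_exists[OF D] by simp
  have "(\<lambda>x. c (c x - e x)) = act (a * D + a * D - D)"
    unfolding D' by (rule ext) (simp add: act_simps D c_def scaleR_2)
  then show "\<exists>s u v. singular_triple (\<lambda>x. c (c x - e x)) s u v"
    using singular_triple_exists[of "a * D + a * D - D" k] by (simp add: act_simps D)
  let ?M = "a * (D * b + D * b - D) + a * (D * b + D * b - D) - (D * b + D * b - D) + D"
  have "(\<lambda>x. c (c (e x) - e (e x)) + (c x - e x)) = act ?M"
    unfolding D' by (rule ext) (simp add: act_simps D c_def e_def scaleR_2)
  then show "\<exists>s u v. singular_triple (\<lambda>x. c (c (e x) - e (e x)) + (c x - e x)) s u v"
    using singular_triple_exists[of ?M k] by (simp add: act_simps D)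
qed

lemma P2_mult_vec:
  assumes w: "w1 \<in> carrier_vec k" "w2 \<in> carrier_vec k"
  defines "y \<equiv> (seq_of w1 - act a (seq_of w1)) - act a (seq_of w2)"
  defines "z \<equiv> act a y - act b y"
  obtains u1 u2 where "u1 \<in> carrier_vec k" "u2 \<in> carrier_vec k"
    "P2 a b *\<^sub>v (w1 @\<^sub>v w2) = u1 @\<^sub>v u2"
    "seq_of u1 = seq_of w1 + (z - act a z)" "seq_of u2 = - act a z"
proof -
  let ?one = "1\<^sub>m k :: complex mat"
  let ?B11 = "?one + (?one - a) * (a - b) * (?one - a)" and ?B12 = "(?one - a) * (b - a) * a"
  let ?B21 = "a * (b - a) * (?one - a)" and ?B22 = "a * (a - b) * a"
  have B: "?B11 \<in> carrier_mat k k" "?B12 \<in> carrier_mat k k" "?B21 \<in> carrier_mat k k" "?B22 \<in> carrier_mat k k"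
    using a b by (simp_all add: square_closed)
  have P: "P2 a b = four_block_mat ?B11 ?B12 ?B21 ?B22" using a(1) by (simp add: P2_def Let_def)
  show ?thesis
  proof (rule that)
    show "P2 a b *\<^sub>v (w1 @\<^sub>v w2) = (?B11 *\<^sub>v w1 + ?B12 *\<^sub>v w2) @\<^sub>v (?B21 *\<^sub>v w1 + ?B22 *\<^sub>v w2)"
      unfolding P by (rule four_block_mat_mult_vec[OF B w])
    note S = seq_of_add[of _ k] act_seq_of[symmetric, of _ k k] mult_mat_vec_carrier[of _ k k]
    show "seq_of (?B11 *\<^sub>v w1 + ?B12 *\<^sub>v w2) = seq_of w1 + (z - act a z)"
      using w B by (simp add: S act_simps act_one_seq_of act_one_act y_def z_def)
    show "seq_of (?B21 *\<^sub>v w1 + ?B22 *\<^sub>v w2) = - act a z"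
      using w B by (simp add: S act_simps act_one_seq_of act_one_act y_def z_def)
  qed (use B w in \<open>auto intro!: add_carrier_vec mult_mat_vec_carrier\<close>)
qed

text \<open>Each component of \<open>(P''\<^sup>2 - P'') v\<close> is at most \<open>763 \<epsilon> \<cdot> 2\<close> for \<open>\<parallel>v\<parallel> \<le> 1\<close>, and the norm is at most the
  sum over the two components.\<close>

lemma op_norm_P2_defect:
  assumes \<epsilon>: "0 \<le> \<epsilon>" "\<epsilon> \<le> 1"
    and \<delta>: "bounded_by (act ((a * a - a) - (b * b - b))) \<epsilon>"
    and \<eta>: "bounded_by (act (a * (a * a - a) - b * (b * b - b))) \<epsilon>"
  shows "op_norm (P2 a b * P2 a b - P2 a b) \<le> 3052 * \<epsilon>"
proof (rule op_norm_leI)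
  let ?P = "P2 a b"
  have P: "?P \<in> carrier_mat (k + k) (k + k)"
    using a b by (auto simp: P2_def Let_def)
  note sym = symmetric_act[OF a(2)] symmetric_act[OF b(2)]
  have \<delta>': "bounded_by (\<lambda>x. (act a (act a x) - act a x) - (act b (act b x) - act b x)) \<epsilon>"
    using \<delta> by (simp add: act_simps bounded_by_def)
  have \<eta>': "bounded_by (\<lambda>x. act a (act a (act a x) - act a x) - act b (act b (act b x) - act b x)) \<epsilon>"
    using \<eta> by (simp add: act_simps bounded_by_def)
  note est = difference_estimates[OF sym \<epsilon> \<delta>' \<eta>' singular_triples]
  note idem = almost_idempotent[OF sym \<epsilon> est(1,2,3) \<delta>']
  fix v :: "complex vec"
  assume "v \<in> carrier_vec (dim_col (?P * ?P - ?P))" and v1: "vec_l2norm v \<le> 1"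
  then have v: "v \<in> carrier_vec (k + k)" using P by simp
  define w1 w2 where "w1 = vec_first v k" and "w2 = vec_last v k"
  have w: "w1 \<in> carrier_vec k" "w2 \<in> carrier_vec k" and vw: "v = w1 @\<^sub>v w2"
    using v by (simp_all add: w1_def w2_def)
  let ?y = "\<lambda>w1 w2. (seq_of w1 - act a (seq_of w1)) - act a (seq_of w2)"
  let ?z = "\<lambda>w1 w2. act a (?y w1 w2) - act b (?y w1 w2)"
  obtain u1 u2 where u: "u1 \<in> carrier_vec k" "u2 \<in> carrier_vec k" "?P *\<^sub>v (w1 @\<^sub>v w2) = u1 @\<^sub>v u2"
    and u': "seq_of u1 = seq_of w1 + (?z w1 w2 - act a (?z w1 w2))" "seq_of u2 = - act a (?z w1 w2)"
    using P2_mult_vec[OF w] .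
  obtain t1 t2 where t: "t1 \<in> carrier_vec k" "t2 \<in> carrier_vec k" "?P *\<^sub>v (u1 @\<^sub>v u2) = t1 @\<^sub>v t2"
    and t': "seq_of t1 = seq_of u1 + (?z u1 u2 - act a (?z u1 u2))" "seq_of t2 = - act a (?z u1 u2)"
    using P2_mult_vec[OF u(1,2)] .
  have "(?P * ?P - ?P) *\<^sub>v v = (t1 @\<^sub>v t2) - (u1 @\<^sub>v u2)"
    using P v by (simp add: minus_mult_distrib_mat_vec[of _ "k + k" "k + k"] vw u t)
  also have "\<dots> = (t1 - u1) @\<^sub>v (t2 - u2)"
    using t u by (intro eq_vecI) auto
  finally have eq: "(?P * ?P - ?P) *\<^sub>v v = (t1 - u1) @\<^sub>v (t2 - u2)" .
  have w_le: "norm (seq_of w1) \<le> 1" "norm (seq_of w2) \<le> 1"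
  proof -
    have "(vec_l2norm v)\<^sup>2 \<le> 1" using v1 by (simp add: power_le_one)
    then have "(vec_l2norm w1)\<^sup>2 \<le> 1\<^sup>2" "(vec_l2norm w2)\<^sup>2 \<le> 1\<^sup>2"
      unfolding vw vec_l2norm_append one_power2
      using zero_le_power2[of "vec_l2norm w1"] zero_le_power2[of "vec_l2norm w2"] by linarith+
    then show "norm (seq_of w1) \<le> 1" "norm (seq_of w2) \<le> 1"
      unfolding norm_seq_of by (auto intro: power2_le_imp_le)
  qed
  have "763 * \<epsilon> * (norm (seq_of w1) + norm (seq_of w2)) \<le> 763 * \<epsilon> * 2"
    using w_le \<epsilon> by (intro mult_left_mono) auto
  moreover have "vec_l2norm (t1 - u1) \<le> 763 * \<epsilon> * (norm (seq_of w1) + norm (seq_of w2))"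
    using idem(1)[of "seq_of w1" "seq_of w2"] t u
    by (simp add: norm_seq_of[symmetric] seq_of_minus[of _ k] t' u' act_linear algebra_simps)
  moreover have "vec_l2norm (t2 - u2) \<le> 763 * \<epsilon> * (norm (seq_of w1) + norm (seq_of w2))"
    using idem(2)[of "seq_of w1" "seq_of w2"] t u
    by (simp add: norm_seq_of[symmetric] seq_of_minus[of _ k] t' u' act_linear algebra_simps)
  ultimately have le: "vec_l2norm (t1 - u1) \<le> 1526 * \<epsilon>" "vec_l2norm (t2 - u2) \<le> 1526 * \<epsilon>" by simp_all
  have "(vec_l2norm ((t1 - u1) @\<^sub>v (t2 - u2)))\<^sup>2 \<le> (vec_l2norm (t1 - u1) + vec_l2norm (t2 - u2))\<^sup>2"
    unfolding vec_l2norm_append power2_sum by simp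
  then have "vec_l2norm ((t1 - u1) @\<^sub>v (t2 - u2)) \<le> vec_l2norm (t1 - u1) + vec_l2norm (t2 - u2)"
    by (rule power2_le_imp_le) simp
  then show "vec_l2norm ((?P * ?P - ?P) *\<^sub>v v) \<le> 3052 * \<epsilon>" unfolding eq using le by simp
qed

end

section \<open>Block matrices weighted by a unit vector\<close>

text \<open>The supremum in the definition of the operator norm is over a set that is bounded because the
  largest singular value bounds it; the rest is scaling to unit vectors.\<close>

lemma bounded_by_op_norm:
  assumes M: "M \<in> carrier_mat k k"
  shows "bounded_by (act M) (op_norm M)"
proof -
  obtain s where s: "bounded_by (act M) s"
    using singular_triple_exists[OF M] by (auto simp: singular_triple_def)
  let ?B = "{v \<in> carrier_vec (dim_col M). vec_l2norm v \<le> 1}"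
  have bdd: "bdd_above ((\<lambda>v. vec_l2norm (M *\<^sub>v v)) ` ?B)"
  proof (rule bdd_aboveI2[of _ _ "max s 0"])
    fix v assume v: "v \<in> ?B"
    then have "vec_l2norm (M *\<^sub>v v) \<le> s * vec_l2norm v"
      using bounded_byD[OF s, of "seq_of v"] M by (simp add: act_seq_of[OF M] norm_seq_of)
    also have "\<dots> \<le> max s 0 * 1" using v by (intro mult_mono) auto
    finally show "vec_l2norm (M *\<^sub>v v) \<le> max s 0" by simp
  qed
  have le: "vec_l2norm (M *\<^sub>v v) \<le> op_norm M" if "v \<in> carrier_vec k" "vec_l2norm v \<le> 1" for v
    unfolding op_norm_def using that M by (intro cSUP_upper bdd) auto
  have nonneg: "0 \<le> op_norm M"
  proof -
    have "vec_l2norm (0\<^sub>v k) \<le> 1" by (simp add: vec_l2norm_def L2_set_def)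
    then show ?thesis using order_trans[OF vec_l2norm_nonneg le[of "0\<^sub>v k"]] by simp
  qed
  show ?thesis
  proof (rule bounded_byI)
    fix f
    define v where "v = vec k (coord f)"
    have v: "v \<in> carrier_vec k" by (simp add: v_def)
    have f: "act M f = act M (seq_of v)" using M by (simp add: act_seq_of[OF M v]) (simp add: act_def v_def)
    have vf: "norm (seq_of v) \<le> norm f" using norm_act_one[of k f] by (simp add: act_one v_def)
    have "norm (act M (seq_of v)) \<le> op_norm M * norm (seq_of v)"
    proof (cases "norm (seq_of v) = 0")
      case True
      then show ?thesis by (simp add: act_linear linear_0[OF linear_act])
    next
      case False
      let ?w = "complex_of_real (1 / norm (seq_of v)) \<cdot>\<^sub>v v"
      have w: "?w \<in> carrier_vec k" using v by simp
      have sw: "seq_of ?w = (1 / norm (seq_of v)) *\<^sub>R seq_of v" by (rule seq_of_smult)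
      have "vec_l2norm ?w \<le> 1" using False unfolding norm_seq_of[symmetric] sw by simp
      moreover have "norm (act M (seq_of ?w)) = vec_l2norm (M *\<^sub>v ?w)"
        unfolding act_seq_of[OF M w] by (rule norm_seq_of)
      ultimately have "norm (act M (seq_of ?w)) \<le> op_norm M" using le[OF w] by (simp only:)
      then show ?thesis unfolding sw act_linear using False by (simp add: field_simps)
    qed
    also have "\<dots> \<le> op_norm M * norm f" by (rule mult_left_mono[OF vf nonneg])
    finally show "norm (act M f) \<le> op_norm M * norm f" unfolding f .
  qed
qed

lemma sum_blocks: "(\<Sum>t<N * n. f t) = (\<Sum>j<N. \<Sum>q<n. f (j * n + q))" for f :: "nat \<Rightarrow> 'b::comm_monoid_add"
  by (induction N) (simp_all add: add.commute[of n] sum_lessThan_add)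

definition block_mat :: "nat \<Rightarrow> nat \<Rightarrow> (nat \<Rightarrow> real) \<Rightarrow> (nat \<Rightarrow> nat \<Rightarrow> complex mat) \<Rightarrow> complex mat" where
  "block_mat N n \<phi> B = mat (N * n) (N * n) (\<lambda>(s, t).
     complex_of_real (\<phi> (s div n) * \<phi> (t div n)) * B (s div n) (t div n) $$ (s mod n, t mod n))"

definition combination :: "nat \<Rightarrow> nat \<Rightarrow> (nat \<Rightarrow> real) \<Rightarrow> (nat \<Rightarrow> complex mat) \<Rightarrow> complex mat" where
  "combination N n \<phi> F = mat n n (\<lambda>pq. \<Sum>j<N. complex_of_real ((\<phi> j)\<^sup>2) * F j $$ pq)"

lemma block_mat_carrier [simp]: "block_mat N n \<phi> B \<in> carrier_mat (N * n) (N * n)"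
  by (simp add: block_mat_def)

lemma combination_carrier [simp]: "combination N n \<phi> F \<in> carrier_mat n n"
  by (simp add: combination_def)

lemma block_index_less: "j < N \<Longrightarrow> q < n \<Longrightarrow> j * n + q < N * (n::nat)"
proof -
  assume "j < N" "q < n"
  then have "j * n + q < Suc j * n" by simp
  also have "\<dots> \<le> N * n" using \<open>j < N\<close> by (intro mult_le_mono1) simp
  finally show ?thesis .
qed

lemma block_mat_index:
  "i < N \<Longrightarrow> j < N \<Longrightarrow> p < n \<Longrightarrow> q < n \<Longrightarrow>
    block_mat N n \<phi> B $$ (i * n + p, j * n + q) = complex_of_real (\<phi> i * \<phi> j) * B i j $$ (p, q)"
  by (simp add: block_mat_def block_index_less)

lemma block_mat_minus:
  assumes "\<And>i j. i < N \<Longrightarrow> j < N \<Longrightarrow> C i j \<in> carrier_mat n n"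
  shows "block_mat N n \<phi> B - block_mat N n \<phi> C = block_mat N n \<phi> (\<lambda>i j. B i j - C i j)"
proof (rule eq_matI)
  fix s t assume st: "s < dim_row (block_mat N n \<phi> (\<lambda>i j. B i j - C i j))"
    "t < dim_col (block_mat N n \<phi> (\<lambda>i j. B i j - C i j))"
  then have "s < N * n" "t < N * n" by (simp_all add: block_mat_def)
  moreover from this have "0 < n" by (cases n) auto
  ultimately have "s div n < N" "t div n < N" "s mod n < n" "t mod n < n"
    by (simp_all add: less_mult_imp_div_less)
  then show "(block_mat N n \<phi> B - block_mat N n \<phi> C) $$ (s, t) = block_mat N n \<phi> (\<lambda>i j. B i j - C i j) $$ (s, t)"
    using assms[of "s div n" "t div n"] \<open>s < N * n\<close> \<open>t < N * n\<close>
    by (simp add: block_mat_def right_diff_distrib)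
qed (simp_all add: block_mat_def)

text \<open>The product of two weighted block matrices is weighted in the same way, and the inner weights
  \<open>\<phi>\<^sub>j\<^sup>2\<close> turn the blocks of the product into convex combinations when \<open>(\<phi>\<^sub>j)\<close> is a unit vector.\<close>

lemma block_mat_mult:
  assumes B: "\<And>i j. i < N \<Longrightarrow> j < N \<Longrightarrow> B i j \<in> carrier_mat n n"
    and C: "\<And>i j. i < N \<Longrightarrow> j < N \<Longrightarrow> C i j \<in> carrier_mat n n"
  shows "block_mat N n \<phi> B * block_mat N n \<phi> C
    = block_mat N n \<phi> (\<lambda>i k. combination N n \<phi> (\<lambda>j. B i j * C j k))" (is "?L = ?R")
proof (rule eq_matI)
  fix s t assume "s < dim_row ?R" "t < dim_col ?R"
  then have st: "s < N * n" "t < N * n" by (simp_all add: block_mat_def)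
  then have n: "0 < n" by (cases n) auto
  define i p k r where "i = s div n" and "p = s mod n" and "k = t div n" and "r = t mod n"
  have ip: "i < N" "k < N" "p < n" "r < n" and s: "s = i * n + p" and t: "t = k * n + r"
    using st n by (simp_all add: i_def p_def k_def r_def less_mult_imp_div_less)
  have "?L $$ (s, t) = (\<Sum>u<N * n. block_mat N n \<phi> B $$ (s, u) * block_mat N n \<phi> C $$ (u, t))"
    using st by (simp add: scalar_prod_def atLeast0LessThan block_mat_def)
  also have "\<dots> = (\<Sum>j<N. \<Sum>q<n. block_mat N n \<phi> B $$ (s, j * n + q) * block_mat N n \<phi> C $$ (j * n + q, t))"
    by (rule sum_blocks)
  also have "\<dots> = (\<Sum>j<N. \<Sum>q<n. complex_of_real (\<phi> i * \<phi> k) * (complex_of_real ((\<phi> j)\<^sup>2) * (B i j $$ (p, q) * C j k $$ (q, r))))"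
    unfolding s t using ip by (intro sum.cong refl) (simp add: block_mat_index power2_eq_square)
  also have "\<dots> = complex_of_real (\<phi> i * \<phi> k) * (\<Sum>j<N. complex_of_real ((\<phi> j)\<^sup>2) * (\<Sum>q<n. B i j $$ (p, q) * C j k $$ (q, r)))"
    by (simp only: sum_distrib_left)
  also have "(\<Sum>j<N. complex_of_real ((\<phi> j)\<^sup>2) * (\<Sum>q<n. B i j $$ (p, q) * C j k $$ (q, r)))
      = combination N n \<phi> (\<lambda>j. B i j * C j k) $$ (p, r)"
  proof -
    have "(B i j * C j k) $$ (p, r) = (\<Sum>q<n. B i j $$ (p, q) * C j k $$ (q, r))" if "j < N" for j
      using B[OF ip(1) that] C[OF that ip(2)] ip by (simp add: scalar_prod_def atLeast0LessThan)
    then show ?thesis using ip by (simp add: combination_def)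
  qed
  also have "complex_of_real (\<phi> i * \<phi> k) * \<dots> = ?R $$ (s, t)"
    unfolding s t using ip by (simp add: block_mat_index)
  finally show "?L $$ (s, t) = ?R $$ (s, t)" .
qed (simp_all add: block_mat_def)

lemma coord_sum: "coord (\<Sum>j\<in>S. F j) i = (\<Sum>j\<in>S. coord (F j) i)"
  by (induction S rule: infinite_finite_induct) (simp_all add: coord_simps)

lemma act_combination:
  assumes "\<And>j. j < N \<Longrightarrow> F j \<in> carrier_mat n n"
  shows "act (combination N n \<phi> F) f = (\<Sum>j<N. (\<phi> j)\<^sup>2 *\<^sub>R act (F j) f)"
proof (rule fin_seq_eqI)
  fix i
  have dims: "dim_row (F j) = n" "dim_col (F j) = n" if "j < N" for j using assms[OF that] by auto
  show "coord (act (combination N n \<phi> F) f) i = coord (\<Sum>j<N. (\<phi> j)\<^sup>2 *\<^sub>R act (F j) f) i"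
  proof (cases "i < n")
    case True
    have "coord (act (combination N n \<phi> F) f) i
        = (\<Sum>q<n. \<Sum>j<N. complex_of_real ((\<phi> j)\<^sup>2) * (F j $$ (i, q) * coord f q))"
      using True by (simp add: coord_act combination_def sum_distrib_right mult.assoc)
    also have "\<dots> = (\<Sum>j<N. complex_of_real ((\<phi> j)\<^sup>2) * (\<Sum>q<n. F j $$ (i, q) * coord f q))"
      by (subst sum.swap) (simp add: sum_distrib_left)
    also have "\<dots> = coord (\<Sum>j<N. (\<phi> j)\<^sup>2 *\<^sub>R act (F j) f) i"
      using True by (simp add: coord_sum coord_act coord_simps dims scaleR_conv_of_real)
    finally show ?thesis .
  qed (simp add: coord_sum coord_act coord_simps dims combination_def)
qed

context
  fixes N :: nat and \<phi> :: "nat \<Rightarrow> real"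
  assumes nonneg: "\<And>j. j < N \<Longrightarrow> 0 \<le> \<phi> j" and unit: "(\<Sum>j<N. (\<phi> j)\<^sup>2) = 1"
begin

lemma norm_convex_combination:
  fixes x :: "nat \<Rightarrow> 'v::real_normed_vector"
  assumes "\<And>j. j < N \<Longrightarrow> \<phi> j \<noteq> 0 \<Longrightarrow> norm (x j) \<le> r"
  shows "norm (\<Sum>j<N. (\<phi> j)\<^sup>2 *\<^sub>R x j) \<le> r"
proof -
  have "norm (\<Sum>j<N. (\<phi> j)\<^sup>2 *\<^sub>R x j) \<le> (\<Sum>j<N. (\<phi> j)\<^sup>2 * r)"
  proof (rule sum_norm_le)
    fix j assume "j \<in> {..<N}"
    then show "norm ((\<phi> j)\<^sup>2 *\<^sub>R x j) \<le> (\<phi> j)\<^sup>2 * r"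
      using assms[of j] by (cases "\<phi> j = 0") (auto intro: mult_left_mono)
  qed
  also have "\<dots> = r" by (simp add: unit flip: sum_distrib_right)
  finally show ?thesis .
qed

text \<open>A row of blocks applied to \<open>f\<close> is \<open>\<phi>\<^sub>i \<Sum>\<^sub>k \<phi>\<^sub>k B\<^sub>i\<^sub>k f\<^sub>k\<close>, where \<open>f\<^sub>k\<close> are the blocks of \<open>f\<close>. Cauchy-Schwarz for the
  sum over \<open>k\<close> and then the sum over \<open>i\<close> each use that \<open>(\<phi>\<^sub>i)\<close> is a unit vector, so the bound on the blocks
  is inherited without a factor \<open>N\<close>. Only blocks with nonzero weights are tested.\<close>

lemma bounded_by_block_mat:
  assumes B: "\<And>i j. i < N \<Longrightarrow> j < N \<Longrightarrow> B i j \<in> carrier_mat n n" and r: "0 \<le> r"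
    and le: "\<And>i j. i < N \<Longrightarrow> j < N \<Longrightarrow> \<phi> i \<noteq> 0 \<Longrightarrow> \<phi> j \<noteq> 0 \<Longrightarrow> bounded_by (act (B i j)) r"
  shows "bounded_by (act (block_mat N n \<phi> B)) r"
proof (rule bounded_byI)
  fix f
  let ?M = "block_mat N n \<phi> B"
  define F where "F = (\<lambda>k. seq_of (vec n (\<lambda>q. coord f (k * n + q))))"
  define h where "h = (\<lambda>i. \<Sum>k<N. \<phi> k *\<^sub>R act (B i k) (F k))"
  have nF: "(norm (F k))\<^sup>2 = (\<Sum>q<n. (cmod (coord f (k * n + q)))\<^sup>2)" for k
    by (simp add: F_def norm_seq_of vec_l2norm_def L2_set_def sum_nonneg)
  have sumF: "(\<Sum>k<N. (norm (F k))\<^sup>2) \<le> (norm f)\<^sup>2"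
  proof -
    have "(\<Sum>k<N. (norm (F k))\<^sup>2) = (\<Sum>t<N * n. (cmod (coord f t))\<^sup>2)"
      unfolding nF by (rule sum_blocks[symmetric])
    also have "\<dots> = (norm (act (1\<^sub>m (N * n)) f))\<^sup>2"
      by (simp add: act_one norm_seq_of vec_l2norm_def L2_set_def sum_nonneg)
    also have "\<dots> \<le> (norm f)\<^sup>2" by (intro power_mono norm_act_one) simp
    finally show ?thesis .
  qed
  have h: "norm (h i) \<le> r * norm f" if i: "i < N" "\<phi> i \<noteq> 0" for i
  proof -
    have "norm (h i) \<le> (\<Sum>k<N. r * (\<bar>\<phi> k\<bar> * \<bar>norm (F k)\<bar>))"
      unfolding h_def
    proof (rule sum_norm_le)
      fix k assume "k \<in> {..<N}"
      then show "norm (\<phi> k *\<^sub>R act (B i k) (F k)) \<le> r * (\<bar>\<phi> k\<bar> * \<bar>norm (F k)\<bar>)"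
        using bounded_byD[OF le[of i k], of "F k"] i mult_left_mono[of _ _ "\<bar>\<phi> k\<bar>"]
        by (cases "\<phi> k = 0") (auto simp: mult.left_commute)
    qed
    also have "\<dots> = r * (\<Sum>k<N. \<bar>\<phi> k\<bar> * \<bar>norm (F k)\<bar>)" by (simp add: sum_distrib_left)
    also have "\<dots> \<le> r * (L2_set \<phi> {..<N} * L2_set (\<lambda>k. norm (F k)) {..<N})"
      by (intro mult_left_mono L2_set_mult_ineq r)
    also have "\<dots> \<le> r * norm f"
      using sumF r unit by (intro mult_left_mono) (auto simp: L2_set_def intro: real_le_lsqrt)
    finally show ?thesis .
  qed
  have c: "coord (act ?M f) (i * n + p) = complex_of_real (\<phi> i) * coord (h i) p" if "i < N" "p < n" for i p
  proof -
    have "coord (act ?M f) (i * n + p) = (\<Sum>t<N * n. ?M $$ (i * n + p, t) * coord f t)"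
      using that by (simp add: coord_act block_index_less block_mat_def)
    also have "\<dots> = (\<Sum>k<N. \<Sum>q<n. ?M $$ (i * n + p, k * n + q) * coord f (k * n + q))" by (rule sum_blocks)
    also have "\<dots> = (\<Sum>k<N. \<Sum>q<n. complex_of_real (\<phi> i) * (complex_of_real (\<phi> k) * (B i k $$ (p, q) * coord f (k * n + q))))"
      using that by (intro sum.cong refl) (simp add: block_mat_index mult_ac)
    also have "\<dots> = complex_of_real (\<phi> i) * (\<Sum>k<N. complex_of_real (\<phi> k) * (\<Sum>q<n. B i k $$ (p, q) * coord f (k * n + q)))"
      by (simp only: sum_distrib_left)
    also have "(\<Sum>k<N. complex_of_real (\<phi> k) * (\<Sum>q<n. B i k $$ (p, q) * coord f (k * n + q))) = coord (h i) p"
    proof -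
      have "coord (act (B i k) (F k)) p = (\<Sum>q<n. B i k $$ (p, q) * coord f (k * n + q))" if "k < N" for k
        using B[OF \<open>i < N\<close> that] \<open>p < n\<close> by (simp add: coord_act F_def coord_seq_of)
      then show ?thesis by (simp add: h_def coord_sum coord_simps scaleR_conv_of_real)
    qed
    finally show ?thesis .
  qed
  have hs: "(\<Sum>p<n. (cmod (coord (h i) p))\<^sup>2) = (norm (h i))\<^sup>2" if "i < N" for i
  proof -
    have "dim_row (B i k) = n" if "k < N" for k using B[OF \<open>i < N\<close> that] by simp
    then have "coord (h i) p = 0" if "n \<le> p" for p
      using that by (simp add: h_def coord_sum coord_simps coord_act)
    then show ?thesis using inner_self_supported[of n "h i"] by (simp add: power2_norm_eq_inner)
  qed
  have "(norm (act ?M f))\<^sup>2 = (\<Sum>t<N * n. (cmod (coord (act ?M f) t))\<^sup>2)"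
    unfolding power2_norm_eq_inner[of "act ?M f"] by (rule inner_self_supported) (simp add: coord_act block_mat_def)
  also have "\<dots> = (\<Sum>i<N. \<Sum>p<n. (\<phi> i)\<^sup>2 * (cmod (coord (h i) p))\<^sup>2)"
    unfolding sum_blocks by (intro sum.cong refl) (simp add: c norm_mult power_mult_distrib)
  also have "\<dots> = (\<Sum>i<N. (\<phi> i)\<^sup>2 * (norm (h i))\<^sup>2)" by (simp add: hs flip: sum_distrib_left)
  also have "\<dots> \<le> (\<Sum>i<N. (\<phi> i)\<^sup>2 * (r * norm f)\<^sup>2)"
  proof (rule sum_mono)
    fix i assume "i \<in> {..<N}"
    then show "(\<phi> i)\<^sup>2 * (norm (h i))\<^sup>2 \<le> (\<phi> i)\<^sup>2 * (r * norm f)\<^sup>2"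
      using h[of i] by (cases "\<phi> i = 0") (auto intro!: mult_left_mono power_mono)
  qed
  also have "\<dots> = (r * norm f)\<^sup>2" by (simp add: unit flip: sum_distrib_right)
  finally show "norm (act ?M f) \<le> r * norm f" by (rule power2_le_imp_le) (simp add: r)
qed

end

text \<open>For \<open>u i j = \<pi> (\<gamma> i j)\<close> and overlapping \<open>U\<^sub>i\<close>, \<open>U\<^sub>j\<close>, \<open>U\<^sub>k\<close> this is the multiplicativity defect of
  \<open>\<pi>\<close> at \<open>\<gamma> i j\<close>, \<open>\<gamma> j k\<close>.\<close>

definition cocycle_defect :: "(nat \<Rightarrow> nat \<Rightarrow> complex mat) \<Rightarrow> nat \<Rightarrow> nat \<Rightarrow> nat \<Rightarrow> complex mat" where
  "cocycle_defect u i j k = u i k - u i j * u j k"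

definition idempotency_block ::
    "nat \<Rightarrow> nat \<Rightarrow> (nat \<Rightarrow> real) \<Rightarrow> (nat \<Rightarrow> nat \<Rightarrow> complex mat) \<Rightarrow> nat \<Rightarrow> nat \<Rightarrow> complex mat" where
  "idempotency_block N n \<phi> u i k = combination N n \<phi> (\<lambda>j. u i j * u j k) - u i k"

context
  fixes N n :: nat and \<phi> :: "nat \<Rightarrow> real" and u :: "nat \<Rightarrow> nat \<Rightarrow> complex mat"
  assumes u: "\<And>i j. i < N \<Longrightarrow> j < N \<Longrightarrow> u i j \<in> carrier_mat n n"
begin

lemma mult_carrier: "i < N \<Longrightarrow> j < N \<Longrightarrow> k < N \<Longrightarrow> u i j * u j k \<in> carrier_mat n n"
  by (rule mult_carrier_mat[OF u u])

lemma cocycle_defect_carrier: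
  "i < N \<Longrightarrow> j < N \<Longrightarrow> k < N \<Longrightarrow> cocycle_defect u i j k \<in> carrier_mat n n"
  unfolding cocycle_defect_def by (rule minus_carrier_mat[OF mult_carrier])

lemma idempotency_block_carrier:
  "i < N \<Longrightarrow> k < N \<Longrightarrow> idempotency_block N n \<phi> u i k \<in> carrier_mat n n"
  unfolding idempotency_block_def by (rule minus_carrier_mat[OF u])

lemma block_mat_idempotency:
  "block_mat N n \<phi> u * block_mat N n \<phi> u - block_mat N n \<phi> u = block_mat N n \<phi> (idempotency_block N n \<phi> u)"
  by (simp add: block_mat_mult[OF u u] block_mat_minus[OF u] idempotency_block_def[abs_def])

text \<open>The block \<open>u i k\<close> is itself the convex combination of copies of itself.\<close>

lemma act_idempotency_block:
  assumes unit: "(\<Sum>j<N. (\<phi> j)\<^sup>2) = 1"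
  assumes ik: "i < N" "k < N"
  shows "act (idempotency_block N n \<phi> u i k) f = (\<Sum>j<N. (\<phi> j)\<^sup>2 *\<^sub>R (- act (cocycle_defect u i j k) f))"
proof -
  have "act (idempotency_block N n \<phi> u i k) f
      = (\<Sum>j<N. (\<phi> j)\<^sup>2 *\<^sub>R act (u i j * u j k) f) - act (u i k) f"
    unfolding idempotency_block_def
    by (subst act_minus[OF combination_carrier u[OF ik]], subst act_combination)
      (use ik mult_carrier in auto)
  also have "act (u i k) f = (\<Sum>j<N. (\<phi> j)\<^sup>2 *\<^sub>R act (u i k) f)"
    by (simp add: unit flip: scaleR_sum_left)
  also have "(\<Sum>j<N. (\<phi> j)\<^sup>2 *\<^sub>R act (u i j * u j k) f) - \<dots>
      = (\<Sum>j<N. (\<phi> j)\<^sup>2 *\<^sub>R (- act (cocycle_defect u i j k) f))"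
    unfolding sum_subtractf[symmetric] cocycle_defect_def
    using ik by (intro sum.cong refl)
      (simp add: act_minus[OF u mult_carrier] scaleR_right_diff_distrib)
  finally show ?thesis .
qed

lemma act_mult_idempotency_block:
  assumes unit: "(\<Sum>j<N. (\<phi> j)\<^sup>2) = 1"
  assumes ik: "i < N" "k < N"
  shows "act (combination N n \<phi> (\<lambda>j. u i j * idempotency_block N n \<phi> u j k)) f
    = (\<Sum>j<N. (\<phi> j)\<^sup>2 *\<^sub>R (\<Sum>l<N. (\<phi> l)\<^sup>2 *\<^sub>R (- act (u i j * cocycle_defect u j l k) f)))"
proof -
  have "act (u i j * idempotency_block N n \<phi> u j k) f
      = (\<Sum>l<N. (\<phi> l)\<^sup>2 *\<^sub>R (- act (u i j * cocycle_defect u j l k) f))" if j: "j < N" for j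
  proof -
    have "act (u i j * idempotency_block N n \<phi> u j k) f
        = act (u i j) (\<Sum>l<N. (\<phi> l)\<^sup>2 *\<^sub>R (- act (cocycle_defect u j l k) f))"
      using act_mult[OF u idempotency_block_carrier] act_idempotency_block[OF unit] ik j by simp
    also have "\<dots> = (\<Sum>l<N. (\<phi> l)\<^sup>2 *\<^sub>R (- act (u i j) (act (cocycle_defect u j l k) f)))"
      by (simp add: linear_sum[OF linear_act] act_linear)
    finally show ?thesis
      using act_mult[OF u cocycle_defect_carrier] ik j by simp
  qed
  then show ?thesis
    using act_combination[of N "\<lambda>j. u i j * idempotency_block N n \<phi> u j k" n]
      mult_carrier_mat[OF u idempotency_block_carrier] ik by simp
qed

end

text \<open>The hypotheses are the two conditions on a balanced pair, restricted to indices whose functions do not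
  vanish at the given point; for the others the cocycle identity is not available.\<close>

lemma block_mat_defect_bounds:
  fixes N n :: nat and \<phi> :: "nat \<Rightarrow> real" and p m :: "nat \<Rightarrow> nat \<Rightarrow> complex mat" and \<epsilon> :: real
  assumes nonneg: "\<And>j. j < N \<Longrightarrow> 0 \<le> \<phi> j" and unit: "(\<Sum>j<N. (\<phi> j)\<^sup>2) = 1"
    and p: "\<And>i j. i < N \<Longrightarrow> j < N \<Longrightarrow> p i j \<in> carrier_mat n n"
    and m: "\<And>i j. i < N \<Longrightarrow> j < N \<Longrightarrow> m i j \<in> carrier_mat n n"
    and \<epsilon>: "0 \<le> \<epsilon>"
    and defect: "\<And>i j k. \<lbrakk>i < N; j < N; k < N; \<phi> i \<noteq> 0; \<phi> j \<noteq> 0; \<phi> k \<noteq> 0\<rbrakk> \<Longrightarrow>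
      bounded_by (act (cocycle_defect p i j k - cocycle_defect m i j k)) \<epsilon>"
    and weighted: "\<And>i j l k. \<lbrakk>i < N; j < N; l < N; k < N; \<phi> i \<noteq> 0; \<phi> j \<noteq> 0; \<phi> l \<noteq> 0; \<phi> k \<noteq> 0\<rbrakk> \<Longrightarrow>
      bounded_by (act (p i j * cocycle_defect p j l k - m i j * cocycle_defect m j l k)) \<epsilon>"
  defines "a \<equiv> block_mat N n \<phi> p" and "b \<equiv> block_mat N n \<phi> m"
  shows "bounded_by (act ((a * a - a) - (b * b - b))) \<epsilon>"
    and "bounded_by (act (a * (a * a - a) - b * (b * b - b))) \<epsilon>"
proof -
  let ?P = "idempotency_block N n \<phi> p" and ?M = "idempotency_block N n \<phi> m"
  have Pc: "?P i k \<in> carrier_mat n n" if "i < N" "k < N" for i k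
    by (rule idempotency_block_carrier[where u = p, OF _ that]) (rule p)
  have Mc: "?M i k \<in> carrier_mat n n" if "i < N" "k < N" for i k
    by (rule idempotency_block_carrier[where u = m, OF _ that]) (rule m)
  have Pd: "cocycle_defect p i j k \<in> carrier_mat n n" if "i < N" "j < N" "k < N" for i j k
    by (rule cocycle_defect_carrier[where u = p, OF _ that]) (rule p)
  have Md: "cocycle_defect m i j k \<in> carrier_mat n n" if "i < N" "j < N" "k < N" for i j k
    by (rule cocycle_defect_carrier[where u = m, OF _ that]) (rule m)
  have Pa: "act (?P i k) f = (\<Sum>j<N. (\<phi> j)\<^sup>2 *\<^sub>R (- act (cocycle_defect p i j k) f))"
    if "i < N" "k < N" for i k f
    by (rule act_idempotency_block[where u = p, OF _ unit that]) (rule p)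
  have Ma: "act (?M i k) f = (\<Sum>j<N. (\<phi> j)\<^sup>2 *\<^sub>R (- act (cocycle_defect m i j k) f))"
    if "i < N" "k < N" for i k f
    by (rule act_idempotency_block[where u = m, OF _ unit that]) (rule m)
  have ab: "a * a - a = block_mat N n \<phi> ?P" "b * b - b = block_mat N n \<phi> ?M"
    unfolding a_def b_def by (rule block_mat_idempotency, fact p, rule block_mat_idempotency, fact m)
  have "(a * a - a) - (b * b - b) = block_mat N n \<phi> (\<lambda>i k. ?P i k - ?M i k)"
    unfolding ab by (rule block_mat_minus[OF Mc])
  moreover have "bounded_by (act (block_mat N n \<phi> (\<lambda>i k. ?P i k - ?M i k))) \<epsilon>"
  proof (rule bounded_by_block_mat[OF nonneg unit _ \<epsilon>])
    fix i k assume ik: "i < N" "k < N" "\<phi> i \<noteq> 0" "\<phi> k \<noteq> 0"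
    show "bounded_by (act (?P i k - ?M i k)) \<epsilon>"
    proof (rule bounded_byI)
      fix f
      have "act (?P i k - ?M i k) f
          = (\<Sum>j<N. (\<phi> j)\<^sup>2 *\<^sub>R (- act (cocycle_defect p i j k - cocycle_defect m i j k) f))"
      proof -
        have "act (?P i k - ?M i k) f = act (?P i k) f - act (?M i k) f"
          by (rule act_minus[OF Pc[OF ik(1,2)] Mc[OF ik(1,2)]])
        also have "\<dots> = (\<Sum>j<N. (\<phi> j)\<^sup>2 *\<^sub>R (- act (cocycle_defect p i j k - cocycle_defect m i j k) f))"
          unfolding Pa[OF ik(1,2)] Ma[OF ik(1,2)] sum_subtractf[symmetric] using ik
          by (intro sum.cong refl) (simp add: act_minus[of _ n n] Pd Md scaleR_right_diff_distrib)
        finally show ?thesis .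
      qed
      also have "norm \<dots> \<le> \<epsilon> * norm f"
        using bounded_byD[OF defect] ik by (intro norm_convex_combination[OF nonneg unit]) auto
      finally show "norm (act (?P i k - ?M i k) f) \<le> \<epsilon> * norm f" .
    qed
  qed (use Mc in \<open>auto intro: minus_carrier_mat\<close>)
  ultimately show "bounded_by (act ((a * a - a) - (b * b - b))) \<epsilon>" by simp
  let ?PP = "\<lambda>i k. combination N n \<phi> (\<lambda>j. p i j * ?P j k)"
  let ?MM = "\<lambda>i k. combination N n \<phi> (\<lambda>j. m i j * ?M j k)"
  have "a * (a * a - a) - b * (b * b - b) = block_mat N n \<phi> (\<lambda>i k. ?PP i k - ?MM i k)"
  proof -
    have "a * block_mat N n \<phi> ?P = block_mat N n \<phi> ?PP" "b * block_mat N n \<phi> ?M = block_mat N n \<phi> ?MM"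
      unfolding a_def b_def
      by (rule block_mat_mult[of N p n ?P], simp_all add: p Pc)
        (rule block_mat_mult[of N m n ?M], simp_all add: m Mc)
    then show ?thesis unfolding ab by (simp only:) (rule block_mat_minus, simp)
  qed
  moreover have "bounded_by (act (block_mat N n \<phi> (\<lambda>i k. ?PP i k - ?MM i k))) \<epsilon>"
  proof (rule bounded_by_block_mat[OF nonneg unit _ \<epsilon>])
    fix i k assume ik: "i < N" "k < N" "\<phi> i \<noteq> 0" "\<phi> k \<noteq> 0"
    show "bounded_by (act (?PP i k - ?MM i k)) \<epsilon>"
    proof (rule bounded_byI)
      fix f
      let ?D = "\<lambda>j l. p i j * cocycle_defect p j l k - m i j * cocycle_defect m j l k"
      have D: "act (?D j l) f = act (p i j * cocycle_defect p j l k) f - act (m i j * cocycle_defect m j l k) f"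
        if "j < N" "l < N" for j l
        using ik that by (intro act_minus[of _ n n] mult_carrier_mat[OF p Pd] mult_carrier_mat[OF m Md])
      have "act (?PP i k - ?MM i k) f = act (?PP i k) f - act (?MM i k) f"
        by (rule act_minus[OF combination_carrier combination_carrier])
      also have "\<dots> = (\<Sum>j<N. (\<phi> j)\<^sup>2 *\<^sub>R (\<Sum>l<N. (\<phi> l)\<^sup>2 *\<^sub>R (- act (?D j l) f)))"
      proof -
        have "act (?PP i k) f = (\<Sum>j<N. (\<phi> j)\<^sup>2 *\<^sub>R (\<Sum>l<N. (\<phi> l)\<^sup>2 *\<^sub>R
            (- act (p i j * cocycle_defect p j l k) f)))"
          by (rule act_mult_idempotency_block[where u = p, OF _ unit ik(1,2)]) (rule p)
        moreover have "act (?MM i k) f = (\<Sum>j<N. (\<phi> j)\<^sup>2 *\<^sub>R (\<Sum>l<N. (\<phi> l)\<^sup>2 *\<^sub>R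
            (- act (m i j * cocycle_defect m j l k) f)))"
          by (rule act_mult_idempotency_block[where u = m, OF _ unit ik(1,2)]) (rule m)
        ultimately show ?thesis
          by (simp add: D scaleR_right_diff_distrib sum_subtractf sum_negf)
      qed
      also have "norm \<dots> \<le> \<epsilon> * norm f"
        using bounded_byD[OF weighted] ik
        by (intro norm_convex_combination[OF nonneg unit]) auto
      finally show "norm (act (?PP i k - ?MM i k) f) \<le> \<epsilon> * norm f" .
    qed
  qed (auto intro: minus_carrier_mat)
  ultimately show "bounded_by (act (a * (a * a - a) - b * (b * b - b))) \<epsilon>" by simp
qed

section \<open>Spectral projections over C(X)\<close>

lemma unitary_sandwich_index:
  assumes U: "U \<in> carrier_mat k k" and ij: "i < k" "j < k"
  shows "(U * diag_real k l * mat_adjoint U) $$ (i, j)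
    = (\<Sum>m<k. U $$ (i, m) * cnj (U $$ (j, m)) * complex_of_real (l m))"
proof -
  have "(U * diag_real k l) $$ (i, m) = U $$ (i, m) * complex_of_real (l m)" if "m < k" for m
  proof -
    have "(U * diag_real k l) $$ (i, m) = (\<Sum>q<k. if q = m then U $$ (i, m) * complex_of_real (l m) else 0)"
      using U ij that by (simp add: scalar_prod_def atLeast0LessThan diag_real_def del: sum.delta sum.delta')
        (intro sum.cong refl, auto)
    then show ?thesis using that by simp
  qed
  then show ?thesis using U ij by (simp add: scalar_prod_def atLeast0LessThan mult_ac diag_real_def)
qed

lemma diag_real_mult: "diag_real k l * diag_real k l' = diag_real k (\<lambda>m. l m * l' m)"
proof (rule eq_matI)
  fix i j assume "i < dim_row (diag_real k (\<lambda>m. l m * l' m))" "j < dim_col (diag_real k (\<lambda>m. l m * l' m))"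
  then have ij: "i < k" "j < k" by (simp_all add: diag_real_def)
  have "(diag_real k l * diag_real k l') $$ (i, j) = (\<Sum>q<k.
      (if i = q then complex_of_real (l i) else 0) * (if q = j then complex_of_real (l' q) else 0))"
    using ij by (simp add: scalar_prod_def atLeast0LessThan diag_real_def del: sum.delta sum.delta')
  also have "\<dots> = (\<Sum>q<k. if q = i then (if i = j then complex_of_real (l i * l' i) else 0) else 0)"
    by (intro sum.cong refl) auto
  finally show "(diag_real k l * diag_real k l') $$ (i, j) = diag_real k (\<lambda>m. l m * l' m) $$ (i, j)"
    using ij by (simp add: diag_real_def)
qed (simp_all add: diag_real_def)

definition spectral_mat :: "complex mat \<Rightarrow> nat \<Rightarrow> (nat \<Rightarrow> real) \<Rightarrow> complex mat" where
  "spectral_mat U k l = U * diag_real k l * mat_adjoint U"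

lemma mult_mat_zero_vec: "A \<in> carrier_mat r c \<Longrightarrow> A *\<^sub>v 0\<^sub>v c = 0\<^sub>v r"
  by (intro eq_vecI) (auto simp: scalar_prod_def)

context
  fixes U :: "complex mat" and k :: nat
  assumes U: "U \<in> carrier_mat k k" and UU: "mat_adjoint U * U = 1\<^sub>m k"
begin

lemma Ua: "mat_adjoint U \<in> carrier_mat k k"
  using U by simp

lemma spectral_mat_carrier: "spectral_mat U k l \<in> carrier_mat k k"
  using U Ua by (simp add: spectral_mat_def mult_carrier_mat[of _ k k _ k])

lemma spectral_mat_index: "i < k \<Longrightarrow> j < k \<Longrightarrow>
    spectral_mat U k l $$ (i, j) = (\<Sum>m<k. U $$ (i, m) * cnj (U $$ (j, m)) * complex_of_real (l m))"
  unfolding spectral_mat_def by (rule unitary_sandwich_index[OF U])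

lemma spectral_mat_dim [simp]: "dim_row (spectral_mat U k l) = k" "dim_col (spectral_mat U k l) = k"
  using spectral_mat_carrier[of l] by auto

lemma spectral_mat_adjoint: "mat_adjoint (spectral_mat U k l) = spectral_mat U k l"
  by (rule eq_matI) (auto simp: spectral_mat_index mult_ac)

lemma spectral_mat_add: "spectral_mat U k l + spectral_mat U k l' = spectral_mat U k (\<lambda>m. l m + l' m)"
  by (rule eq_matI) (auto simp: spectral_mat_index sum.distrib distrib_left)

lemma spectral_mat_minus: "spectral_mat U k l - spectral_mat U k l' = spectral_mat U k (\<lambda>m. l m - l' m)"
  by (rule eq_matI) (auto simp: spectral_mat_index sum_subtractf right_diff_distrib)

lemma spectral_mat_mult: "spectral_mat U k l * spectral_mat U k l' = spectral_mat U k (\<lambda>m. l m * l' m)"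
proof -
  have assoc: "X * Y * Z = X * (Y * Z)"
    if "X \<in> carrier_mat k k" "Y \<in> carrier_mat k k" "Z \<in> carrier_mat k k" for X Y Z :: "complex mat"
    using that by (rule assoc_mult_mat)
  have cl: "X * Y \<in> carrier_mat k k"
    if "X \<in> carrier_mat k k" "Y \<in> carrier_mat k k" for X Y :: "complex mat"
    using that by (rule mult_carrier_mat)
  note c = U Ua diag_real_carrier cl
  have "spectral_mat U k l * spectral_mat U k l'
      = U * (diag_real k l * ((mat_adjoint U * U) * (diag_real k l' * mat_adjoint U)))"
    unfolding spectral_mat_def by (simp only: assoc c)
  also have "\<dots> = U * ((diag_real k l * diag_real k l') * mat_adjoint U)"
    unfolding UU left_mult_one_mat[OF cl[OF diag_real_carrier Ua]] by (simp only: assoc c)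
  finally show ?thesis unfolding diag_real_mult spectral_mat_def by (simp only: assoc c)
qed

lemma spectral_mat_mult_vec:
  assumes v: "v \<in> carrier_vec k"
  shows "spectral_mat U k l *\<^sub>v v = U *\<^sub>v (diag_real k l *\<^sub>v (mat_adjoint U *\<^sub>v v))"
proof -
  have UD: "U * diag_real k l \<in> carrier_mat k k" using U by (rule mult_carrier_mat) simp
  have "mat_adjoint U *\<^sub>v v \<in> carrier_vec k" using Ua v by simp
  then show ?thesis
    unfolding spectral_mat_def assoc_mult_mat_vec[OF UD Ua v]
    by (rule assoc_mult_mat_vec[OF U diag_real_carrier])
qed

lemma adjoint_col: "j < k \<Longrightarrow> mat_adjoint U *\<^sub>v col U j = unit_vec k j"
  using col_mult2[OF Ua U, of j] UU by simp

lemma col_carrier: "j < k \<Longrightarrow> col U j \<in> carrier_vec k"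
  using U by auto

lemma mult_unit_vec: "j < k \<Longrightarrow> U *\<^sub>v unit_vec k j = col U j"
  using col_mult2[OF U one_carrier_mat, of j] U by simp

lemma spectral_mat_col:
  assumes j: "j < k"
  shows "spectral_mat U k l *\<^sub>v col U j = complex_of_real (l j) \<cdot>\<^sub>v col U j"
  unfolding spectral_mat_mult_vec[OF col_carrier[OF j]] adjoint_col[OF j] mat_unit_vec_diag[OF j]
  using mult_mat_vec[OF U, of "unit_vec k j"] mult_unit_vec[OF j] by simp

lemma col_nonzero: "j < k \<Longrightarrow> col U j \<noteq> 0\<^sub>v k"
proof
  assume j: "j < k" "col U j = 0\<^sub>v k"
  then have "unit_vec k j = mat_adjoint U *\<^sub>v 0\<^sub>v k" using adjoint_col[of j] by simp
  also have "\<dots> = 0\<^sub>v k" by (rule mult_mat_zero_vec[OF Ua])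
  finally have "unit_vec k j $ j = (0\<^sub>v k $ j :: complex)" by simp
  then show False using j(1) by simp
qed

text \<open>For an eigenvector \<open>v\<close> the coordinates of \<open>U\<^sup>* v\<close> vanish except where the diagonal entry is the
  eigenvalue, so the proposed matrix acts as required. It is the only one, because the columns of \<open>U\<close> are
  eigenvectors and prescribe the matrix on a basis.\<close>

lemma spectral_projection_spectral_mat:
  "spectral_projection (spectral_mat U k l) = spectral_mat U k (\<lambda>m. if 1/2 < l m then 1 else 0)"
proof -
  let ?\<chi> = "\<lambda>m. if 1/2 < l m then 1 else 0 :: real"
  have eig: "spectral_mat U k ?\<chi> *\<^sub>v v = (if 1/2 < Re e then v else 0\<^sub>v k)"
    if "eigenvector (spectral_mat U k l) v e" for v e
  proof -
    from that have v: "v \<in> carrier_vec k" "spectral_mat U k l *\<^sub>v v = e \<cdot>\<^sub>v v"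
      by (auto simp: eigenvector_def)
    define w where "w = mat_adjoint U *\<^sub>v v"
    have w: "w \<in> carrier_vec k" using Ua v by (simp add: w_def)
    have vw: "v = U *\<^sub>v w"
      unfolding w_def using v(1) by (simp add: assoc_mult_mat_vec[OF U Ua, symmetric] unitary_right[OF U UU])
    have "mat_adjoint U *\<^sub>v (U *\<^sub>v (diag_real k l *\<^sub>v w)) = mat_adjoint U *\<^sub>v (e \<cdot>\<^sub>v v)"
      using v(2) unfolding spectral_mat_mult_vec[OF v(1)] w_def by simp
    moreover have "diag_real k l *\<^sub>v w \<in> carrier_vec k" by (rule mult_mat_vec_carrier[OF diag_real_carrier w])
    ultimately have Dw: "diag_real k l *\<^sub>v w = e \<cdot>\<^sub>v w"
      by (simp add: assoc_mult_mat_vec[OF Ua U, symmetric] UU mult_mat_vec[OF Ua v(1)] w_def[symmetric])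
    have idx: "(diag_real k m *\<^sub>v w) $ i = complex_of_real (m i) * w $ i" if "i < k" for m i
    proof -
      have "(diag_real k m *\<^sub>v w) $ i = (\<Sum>q<k. if q = i then complex_of_real (m i) * w $ i else 0)"
        using w that by (simp add: scalar_prod_def atLeast0LessThan diag_real_def del: sum.delta sum.delta')
          (intro sum.cong refl, auto)
      then show ?thesis using that by simp
    qed
    have ev: "w $ i = 0 \<or> l i = Re e" if "i < k" for i
    proof -
      have "complex_of_real (l i) * w $ i = e * w $ i"
        using arg_cong[OF Dw, of "\<lambda>x. x $ i"] idx[OF that, of l] w that by simp
      then show ?thesis by auto
    qed
    have "diag_real k ?\<chi> *\<^sub>v w = (if 1/2 < Re e then w else 0\<^sub>v k)"
    proof (rule eq_vecI)
      fix i assume "i < dim_vec (if 1/2 < Re e then w else 0\<^sub>v k)"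
      then have i: "i < k" using w by (auto split: if_splits)
      show "(diag_real k ?\<chi> *\<^sub>v w) $ i = (if 1/2 < Re e then w else 0\<^sub>v k) $ i"
        unfolding idx[OF i] using ev[OF i] i by auto
    qed (use w in \<open>simp add: diag_real_def\<close>)
    moreover have "U *\<^sub>v 0\<^sub>v k = 0\<^sub>v k" by (rule mult_mat_zero_vec[OF U])
    ultimately show ?thesis unfolding spectral_mat_mult_vec[OF v(1)] w_def[symmetric] by (simp add: vw)
  qed
  have uniq: "Q = spectral_mat U k ?\<chi>"
    if Q: "Q \<in> carrier_mat k k"
      "\<And>v e. eigenvector (spectral_mat U k l) v e \<Longrightarrow> Q *\<^sub>v v = (if 1/2 < Re e then v else 0\<^sub>v k)" for Q
  proof -
    have QU: "Q * U = spectral_mat U k ?\<chi> * U"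
    proof (rule mat_col_eqI)
      fix j assume "j < dim_col (spectral_mat U k ?\<chi> * U)"
      then have j: "j < k" using U by simp
      have "eigenvector (spectral_mat U k l) (col U j) (complex_of_real (l j))"
        using spectral_mat_col[OF j] col_nonzero[OF j] col_carrier[OF j] by (simp add: eigenvector_def)
      then have "Q *\<^sub>v col U j = spectral_mat U k ?\<chi> *\<^sub>v col U j" using Q(2) eig by simp
      then show "col (Q * U) j = col (spectral_mat U k ?\<chi> * U) j"
        using col_mult2[OF Q(1) U j] col_mult2[OF spectral_mat_carrier U j] by simp
    qed (use Q(1) in auto)
    have "Q = (Q * U) * mat_adjoint U"
      using Q(1) by (simp add: assoc_mult_mat[OF Q(1) U Ua] unitary_right[OF U UU])
    also have "\<dots> = spectral_mat U k ?\<chi>"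
      unfolding QU using spectral_mat_carrier
      by (simp add: assoc_mult_mat[OF spectral_mat_carrier U Ua] unitary_right[OF U UU])
    finally show ?thesis .
  qed
  show ?thesis unfolding spectral_projection_def
  proof (rule the_equality)
    show "spectral_mat U k ?\<chi> \<in> carrier_mat (dim_row (spectral_mat U k l)) (dim_row (spectral_mat U k l)) \<and>
      (\<forall>v e. eigenvector (spectral_mat U k l) v e \<longrightarrow>
        spectral_mat U k ?\<chi> *\<^sub>v v = (if 1/2 < Re e then v else 0\<^sub>v (dim_row (spectral_mat U k l))))"
      using spectral_mat_carrier eig by simp
  qed (use uniq in simp)
qed

lemma cmod_unitary_le: 
  assumes "i < k" "m < k"
  shows "cmod (U $$ (i, m)) \<le> 1"
proof -
  have "(U * mat_adjoint U) $$ (i, i) = complex_of_real (\<Sum>q<k. (cmod (U $$ (i, q)))\<^sup>2)"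
    using U assms(1)
    by (simp add: scalar_prod_def atLeast0LessThan complex_norm_square[symmetric] del: of_real_power)
  then have "complex_of_real (\<Sum>q<k. (cmod (U $$ (i, q)))\<^sup>2) = complex_of_real 1"
    using unitary_right[OF U UU] assms(1) by simp
  then have "(\<Sum>q<k. (cmod (U $$ (i, q)))\<^sup>2) = 1" by (simp only: of_real_eq_iff)
  moreover have "(cmod (U $$ (i, m)))\<^sup>2 \<le> (\<Sum>q<k. (cmod (U $$ (i, q)))\<^sup>2)"
    using assms(2) by (intro member_le_sum) auto
  ultimately show ?thesis by (simp add: power_le_one_iff)
qed

lemma cmod_spectral_mat_le:
  assumes "\<And>m. m < k \<Longrightarrow> \<bar>l m - l' m\<bar> \<le> r" "i < k" "j < k"
  shows "cmod (spectral_mat U k l $$ (i, j) - spectral_mat U k l' $$ (i, j)) \<le> real k * r"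
proof -
  have "spectral_mat U k l $$ (i, j) - spectral_mat U k l' $$ (i, j)
      = (\<Sum>m<k. U $$ (i, m) * cnj (U $$ (j, m)) * complex_of_real (l m - l' m))"
    using assms by (simp add: spectral_mat_index sum_subtractf right_diff_distrib)
  also have "cmod \<dots> \<le> (\<Sum>m<k. r)"
  proof (rule sum_norm_le)
    fix m assume "m \<in> {..<k}"
    then have m: "m < k" by simp
    have "cmod (U $$ (i, m) * cnj (U $$ (j, m)) * complex_of_real (l m - l' m))
        = cmod (U $$ (i, m)) * cmod (U $$ (j, m)) * \<bar>l m - l' m\<bar>"
      unfolding norm_mult complex_mod_cnj norm_of_real ..
    also have "\<dots> \<le> 1 * 1 * r"
      using assms m cmod_unitary_le by (intro mult_mono) auto
    finally show "cmod (U $$ (i, m) * cnj (U $$ (j, m)) * complex_of_real (l m - l' m)) \<le> r" by simp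
  qed
  finally show ?thesis by simp
qed

text \<open>Test \<open>A\<^sup>2 - A\<close> on the eigenvectors of \<open>A\<close>.\<close>

lemma spectral_mat_defect_le:
  assumes "op_norm (spectral_mat U k l * spectral_mat U k l - spectral_mat U k l) \<le> r" "j < k"
  shows "\<bar>l j * l j - l j\<bar> \<le> r"
proof -
  let ?L = "\<lambda>m. l m * l m - l m"
  let ?s = "seq_of (col U j)"
  have "bounded_by (act (spectral_mat U k ?L)) r"
    using bounded_by_mono[OF bounded_by_op_norm[OF spectral_mat_carrier] assms(1)[unfolded spectral_mat_mult spectral_mat_minus]] .
  then have "norm (act (spectral_mat U k ?L) ?s) \<le> r * norm ?s" by (rule bounded_byD)
  moreover have "act (spectral_mat U k ?L) ?s = ?L j *\<^sub>R ?s"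
    unfolding act_seq_of[OF spectral_mat_carrier col_carrier[OF assms(2)]] spectral_mat_col[OF assms(2)]
    by (rule seq_of_smult)
  ultimately have "\<bar>?L j\<bar> * norm ?s \<le> r * norm ?s" by simp
  moreover have "norm ?s \<noteq> 0"
  proof
    assume "norm ?s = 0"
    then have "?s = 0" by simp
    have "vec_index (col U j) i = 0" if "i < k" for i
    proof -
      have "coord ?s i = 0" unfolding \<open>?s = 0\<close> by (simp add: coord_simps)
      then show ?thesis using that U unfolding coord_seq_of by (simp split: if_splits)
    qed
    then have "col U j = 0\<^sub>v k" using U by (intro eq_vecI) auto
    then show False using col_nonzero[OF assms(2)] by simp
  qed
  ultimately show ?thesis by simp
qed

end

lemma cont_mat_add:
  assumes A: "cont_mat X r c A" and B: "cont_mat X r c B"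
  shows "cont_mat X r c (\<lambda>x. A x + B x)" "cont_mat X r c (\<lambda>x. A x - B x)"
proof -
  have carrier: "A x \<in> carrier_mat r c" "B x \<in> carrier_mat r c" if "x \<in> X" for x
    using A B that by (simp_all add: cont_mat_def)
  have cont: "continuous_on X (\<lambda>x. A x $$ (i, j) + B x $$ (i, j))"
    "continuous_on X (\<lambda>x. A x $$ (i, j) - B x $$ (i, j))" if "i < r" "j < c" for i j
    using A B that by (auto simp: cont_mat_def intro!: continuous_on_add continuous_on_diff)
  have idx: "(A x + B x) $$ (i, j) = A x $$ (i, j) + B x $$ (i, j)"
    "(A x - B x) $$ (i, j) = A x $$ (i, j) - B x $$ (i, j)" if "x \<in> X" "i < r" "j < c" for x i j
    using carrier[OF that(1)] that(2,3) by simp_all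
  show "cont_mat X r c (\<lambda>x. A x + B x)" unfolding cont_mat_def
  proof (intro conjI ballI allI impI)
    fix i j assume "i < r" "j < c"
    then show "continuous_on X (\<lambda>x. (A x + B x) $$ (i, j))"
      by (intro continuous_on_eq[OF cont(1)]) (simp_all only: idx)
  qed (simp add: carrier)
  show "cont_mat X r c (\<lambda>x. A x - B x)" unfolding cont_mat_def
  proof (intro conjI ballI allI impI)
    fix i j assume "i < r" "j < c"
    then show "continuous_on X (\<lambda>x. (A x - B x) $$ (i, j))"
      by (intro continuous_on_eq[OF cont(2)]) (simp_all only: idx)
  qed (simp add: carrier minus_carrier_mat)
qed

lemmas cont_mat_minus = cont_mat_add(2)

text \<open>The polynomial \<open>3 t\<^sup>2 - 2 t\<^sup>3\<close>. It has \<open>0\<close> and \<open>1\<close> as superattracting fixed points, which makes its iterates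
  approximate the characteristic function of \<open>(1/2, \<infinity>)\<close> near these points. It is written
  without scalar multiples to use only sums and products of matrices.\<close>

definition newton :: "complex mat \<Rightarrow> complex mat" where
  "newton A = (A * A + A * A + A * A) - (A * A * A + A * A * A)"

definition newton_real :: "real \<Rightarrow> real" where
  "newton_real t = (t * t + t * t + t * t) - (t * t * t + t * t * t)"

lemma cont_mat_newton:
  assumes A: "cont_mat X k k A"
  shows "cont_mat X k k (\<lambda>x. newton (A x))"
proof -
  note AA = cont_mat_mult[OF A A]
  note AAA = cont_mat_mult[OF AA A]
  show ?thesis unfolding newton_def
    by (intro cont_mat_minus cont_mat_add(1) AA AAA)
qed

lemma cont_mat_newton_power: "cont_mat X k k A \<Longrightarrow> cont_mat X k k (\<lambda>x. (newton ^^ n) (A x))"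
  by (induction n) (simp_all add: cont_mat_newton)

lemma newton_spectral_mat:
  assumes "U \<in> carrier_mat k k" "mat_adjoint U * U = 1\<^sub>m k"
  shows "(newton ^^ n) (spectral_mat U k l) = spectral_mat U k (\<lambda>m. (newton_real ^^ n) (l m))"
  by (induction n)
    (simp_all add: newton_def newton_real_def spectral_mat_mult[OF assms] spectral_mat_add[OF assms] spectral_mat_minus[OF assms])

lemma newton_real_defect:
  "newton_real t * newton_real t - newton_real t = - ((t * t - t) * (t * t - t) * (3 - 4 * (t * t - t)))"
proof -
  have "newton_real t = 3 * t ^ 2 - 2 * t ^ 3"
    by (simp add: newton_real_def power2_eq_square power3_eq_cube)
  then show ?thesis by (simp only:) (simp add: algebra_simps power2_eq_square power3_eq_cube)
qed

lemma newton_real_half: "newton_real t - 1/2 = (t - 1/2) * (1 - 2 * (t * t - t))"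
  unfolding newton_real_def by (simp add: algebra_simps)

text \<open>By the two preceding identities, the defect \<open>t\<^sup>2 - t\<close> is essentially squared in each step, and the side of
  \<open>1/2\<close> is preserved as long as the defect stays below \<open>1/2\<close>.\<close>

lemma newton_real_step:
  assumes "\<bar>t * t - t\<bar> \<le> r" "r < 1/4"
  defines "t' \<equiv> newton_real t"
  shows "\<bar>t' * t' - t'\<bar> \<le> 4 * r * \<bar>t * t - t\<bar>" "1/2 < t' \<longleftrightarrow> 1/2 < t"
proof -
  let ?e = "t * t - t"
  have e: "\<bar>?e\<bar> \<le> 1/4" using assms by linarith
  have "\<bar>t' * t' - t'\<bar> = \<bar>?e\<bar> * \<bar>?e\<bar> * \<bar>3 - 4 * ?e\<bar>"
    unfolding t'_def newton_real_defect by (simp only: abs_minus_cancel abs_mult)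
  also have "\<dots> \<le> \<bar>?e\<bar> * r * 4"
  proof -
    have "\<bar>3 - 4 * u\<bar> \<le> 4" if "\<bar>u\<bar> \<le> 1/4" for u :: real using that by linarith
    from this[OF e] show ?thesis using assms(1) by (intro mult_mono) auto
  qed
  finally show "\<bar>t' * t' - t'\<bar> \<le> 4 * r * \<bar>?e\<bar>" by (simp add: mult_ac)
  have "0 < 1 - 2 * u" if "\<bar>u\<bar> \<le> 1/4" for u :: real using that by linarith
  from this[OF e] have "0 < 1 - 2 * ?e" .
  then have "0 < t' - 1/2 \<longleftrightarrow> 0 < t - 1/2"
    unfolding t'_def newton_real_half by (simp add: zero_less_mult_iff)
  then show "1/2 < t' \<longleftrightarrow> 1/2 < t" by simp
qed

lemma newton_real_converges:
  assumes t: "\<bar>t * t - t\<bar> \<le> r" and r: "r < 1/4"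
  shows "\<bar>(newton_real ^^ n) t - (if 1/2 < t then 1 else 0)\<bar> \<le> (4 * r) ^ n"
proof -
  let ?t = "\<lambda>n. (newton_real ^^ n) t"
  have r0: "0 \<le> r" using t by linarith
  have inv: "\<bar>?t n * ?t n - ?t n\<bar> \<le> (4 * r) ^ n * r \<and> (1/2 < ?t n \<longleftrightarrow> 1/2 < t)" for n
  proof (induction n)
    case (Suc n)
    have "(4 * r) ^ n \<le> 1" using r r0 by (intro power_le_one) auto
    then have "(4 * r) ^ n * r \<le> 1 * r" using r0 by (intro mult_right_mono) auto
    then have "\<bar>?t n * ?t n - ?t n\<bar> \<le> r" using Suc.IH by linarith
    note step = newton_real_step[OF this r]
    have "4 * r * \<bar>?t n * ?t n - ?t n\<bar> \<le> 4 * r * ((4 * r) ^ n * r)"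
      using Suc.IH r0 by (intro mult_left_mono) auto
    then show ?case using step Suc.IH by (simp add: mult.assoc)
  qed (use t in simp)
  define s where "s = ?t n"
  have s: "\<bar>s * s - s\<bar> \<le> (4 * r) ^ n * r" "1/2 < s \<longleftrightarrow> 1/2 < t" using inv[of n] by (auto simp: s_def)
  have f: "\<bar>s * s - s\<bar> = \<bar>s\<bar> * \<bar>s - 1\<bar>" by (simp add: abs_mult[symmetric] algebra_simps)
  have "\<bar>s - (if 1/2 < t then 1 else 0)\<bar> \<le> 2 * \<bar>s * s - s\<bar>"
  proof (cases "1/2 < t")
    case True
    then have "1/2 * \<bar>s - 1\<bar> \<le> \<bar>s\<bar> * \<bar>s - 1\<bar>" using s(2) by (intro mult_right_mono) auto
    then show ?thesis using True f by simp
  next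
    case False
    then have "\<bar>s\<bar> * (1/2) \<le> \<bar>s\<bar> * \<bar>s - 1\<bar>" using s(2) by (intro mult_left_mono) auto
    then show ?thesis using False f by simp
  qed
  also have "\<dots> \<le> 2 * ((4 * r) ^ n * r)" using s(1) by simp
  also have "\<dots> \<le> (4 * r) ^ n * 1" using r r0 mult_left_mono[of "2 * r" 1 "(4 * r) ^ n"] by simp
  finally show ?thesis by (simp add: s_def)
qed

text \<open>Only continuity takes an argument: each Newton iterate of \<open>P\<close> is a polynomial in \<open>P\<close>, hence continuous, and
  the bound \<open>k (4 r)\<^sup>n\<close> for the distance of the entries to those of the spectral projection does not depend
  on the point.\<close>

lemma spectral_projection_in_projections:
  fixes P :: "'a::topological_space \<Rightarrow> complex mat"
  assumes P: "cont_mat X k k P" and adj: "\<And>x. x \<in> X \<Longrightarrow> mat_adjoint (P x) = P x"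
    and defect: "\<And>x. x \<in> X \<Longrightarrow> op_norm (P x * P x - P x) \<le> r" and r: "0 \<le> r" "r < 1/4"
  shows "(\<lambda>x. spectral_projection (P x)) \<in> projections X"
proof -
  let ?Q = "\<lambda>x. spectral_projection (P x)"
  have *: "?Q x \<in> carrier_mat k k \<and> mat_adjoint (?Q x) = ?Q x \<and> ?Q x * ?Q x = ?Q x \<and>
      (\<forall>n. \<forall>i<k. \<forall>j<k. cmod ((newton ^^ n) (P x) $$ (i, j) - ?Q x $$ (i, j)) \<le> real k * (4 * r) ^ n)"
    if x: "x \<in> X" for x
  proof -
    have "P x \<in> carrier_mat k k" using P x by (simp add: cont_mat_def)
    then obtain U l where U: "U \<in> carrier_mat k k" "mat_adjoint U * U = 1\<^sub>m k"
      and Px: "P x = spectral_mat U k l"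
      using hermitian_diagonalization[OF _ adj[OF x]] unfolding spectral_mat_def by blast
    let ?\<chi> = "\<lambda>m. if 1/2 < l m then 1 else 0 :: real"
    have Q: "?Q x = spectral_mat U k ?\<chi>"
      unfolding Px by (rule spectral_projection_spectral_mat[OF U])
    have "(\<lambda>m. ?\<chi> m * ?\<chi> m) = ?\<chi>" by auto
    moreover have "cmod ((newton ^^ n) (P x) $$ (i, j) - ?Q x $$ (i, j)) \<le> real k * (4 * r) ^ n"
      if "i < k" "j < k" for n i j
    proof -
      have "\<bar>l m * l m - l m\<bar> \<le> r" if "m < k" for m
        by (rule spectral_mat_defect_le[OF U _ that]) (use defect[OF x] Px in simp)
      then show ?thesis
        unfolding Q unfolding Px newton_spectral_mat[OF U] using that r
        by (intro cmod_spectral_mat_le[OF U] newton_real_converges) auto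
    qed
    ultimately show ?thesis
      using spectral_mat_carrier[OF U] spectral_mat_adjoint[OF U] spectral_mat_mult[OF U, of ?\<chi> ?\<chi>]
      by (simp add: Q)
  qed
  have "continuous_on X (\<lambda>x. ?Q x $$ (i, j))" if ij: "i < k" "j < k" for i j
  proof (rule uniform_limit_theorem[where F = sequentially])
    show "\<forall>\<^sub>F n in sequentially. continuous_on X (\<lambda>x. (newton ^^ n) (P x) $$ (i, j))"
      using cont_mat_newton_power[OF P] ij by (auto simp: cont_mat_def)
    show "uniform_limit X (\<lambda>n x. (newton ^^ n) (P x) $$ (i, j)) (\<lambda>x. ?Q x $$ (i, j)) sequentially"
    proof (rule uniform_limitI)
      fix e :: real assume e: "0 < e"
      have "(\<lambda>n. real k * (4 * r) ^ n) \<longlonglongrightarrow> real k * 0"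
        using r by (intro tendsto_mult tendsto_const LIMSEQ_realpow_zero) auto
      then have "\<forall>\<^sub>F n in sequentially. real k * (4 * r) ^ n < e"
        using e by (intro order_tendstoD(2)) auto
      then show "\<forall>\<^sub>F n in sequentially. \<forall>x\<in>X. dist ((newton ^^ n) (P x) $$ (i, j)) (?Q x $$ (i, j)) < e"
      proof (rule eventually_mono)
        fix n assume n: "real k * (4 * r) ^ n < e"
        show "\<forall>x\<in>X. dist ((newton ^^ n) (P x) $$ (i, j)) (?Q x $$ (i, j)) < e"
        proof
          fix x assume "x \<in> X"
          then have "cmod ((newton ^^ n) (P x) $$ (i, j) - ?Q x $$ (i, j)) \<le> real k * (4 * r) ^ n"
            using * ij by blast
          with n show "dist ((newton ^^ n) (P x) $$ (i, j)) (?Q x $$ (i, j)) < e"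
            unfolding dist_norm by linarith
        qed
      qed
    qed
  qed simp
  then have "cont_mat X k k ?Q" using * by (simp add: cont_mat_def)
  then show ?thesis using * by (auto simp: projections_def)
qed

lemma K0_class_in_carrier:
  "(\<lambda>x. spectral_projection (P x)) \<in> projections X \<Longrightarrow> K0_class X P \<in> carrier (K0 X)"
  unfolding K0_class_def by (rule K0_carrierI) auto

section \<open>The class of an almost projection\<close>

lemma mat_adjoint_add:
  "A \<in> carrier_mat r c \<Longrightarrow> B \<in> carrier_mat r c \<Longrightarrow> mat_adjoint (A + B) = mat_adjoint A + mat_adjoint (B :: complex mat)"
  by (rule eq_matI) auto

lemma mat_adjoint_minus:
  "A \<in> carrier_mat r c \<Longrightarrow> B \<in> carrier_mat r c \<Longrightarrow> mat_adjoint (A - B) = mat_adjoint A - mat_adjoint (B :: complex mat)"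
  by (rule eq_matI) auto

lemma mat_adjoint_one: "mat_adjoint (1\<^sub>m k) = (1\<^sub>m k :: complex mat)"
  by (rule eq_matI) auto

lemma mat_adjoint_four_block:
  assumes "A \<in> carrier_mat k k" "B \<in> carrier_mat k k" "C \<in> carrier_mat k k" "D \<in> carrier_mat k k"
  shows "mat_adjoint (four_block_mat A B C D)
    = four_block_mat (mat_adjoint A) (mat_adjoint C) (mat_adjoint B) (mat_adjoint (D :: complex mat))"
  using assms by (intro eq_matI) auto

lemma mat_adjoint_P2:
  assumes a: "a \<in> carrier_mat k k" "mat_adjoint a = a" and b: "b \<in> carrier_mat k k" "mat_adjoint b = b"
  shows "mat_adjoint (P2 a b) = P2 a b"
proof -
  have cl: "A * B \<in> carrier_mat k k" "A + B \<in> carrier_mat k k" "A - B \<in> carrier_mat k k"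
    if "A \<in> carrier_mat k k" "B \<in> carrier_mat k k" for A B :: "complex mat"
    using that by auto
  have assoc: "X * Y * Z = X * (Y * Z)"
    if "X \<in> carrier_mat k k" "Y \<in> carrier_mat k k" "Z \<in> carrier_mat k k" for X Y Z :: "complex mat"
    using that by (rule assoc_mult_mat)
  have dim: "dim_row a = k" using a by auto
  show ?thesis unfolding P2_def Let_def dim
    by (subst mat_adjoint_four_block[of _ k])
      (simp_all add: cl a b mat_adjoint_mult[of _ k k _ k] mat_adjoint_add[of _ k k] mat_adjoint_minus[of _ k k] mat_adjoint_one assoc)
qed

lemma cont_mat_P2:
  assumes a: "cont_mat X k k a" and b: "cont_mat X k k b"
  shows "cont_mat X (k + k) (k + k) (\<lambda>x. P2 (a x) (b x))"
proof -
  let ?one = "\<lambda>x. 1\<^sub>m k :: complex mat"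
  have one: "cont_mat X k k ?one" by (rule cont_mat_const) simp
  note c = cont_mat_mult cont_mat_add(1) cont_mat_minus one a b
  have "cont_mat X (k + k) (k + k) (\<lambda>x. four_block_mat
      (?one x + (?one x - a x) * (a x - b x) * (?one x - a x)) ((?one x - a x) * (b x - a x) * a x)
      (a x * (b x - a x) * (?one x - a x)) (a x * (a x - b x) * a x))"
    by (intro cont_mat_four_block) (rule c | rule c(1)[where m = k])+
  moreover have "dim_row (a x) = k" if "x \<in> X" for x using a that by (auto simp: cont_mat_def)
  ultimately show ?thesis
    by (subst cont_mat_cong) (auto simp: P2_def Let_def)
qed

lemma cont_mat_A_mat:
  assumes "\<And>i. i < N \<Longrightarrow> continuous_on X (\<phi> i)"
  shows "cont_mat X (N * n) (N * n) (A_mat N n \<phi> \<gamma> \<pi>)"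
proof -
  have "continuous_on X (\<lambda>x. A_mat N n \<phi> \<gamma> \<pi> x $$ (s, t))" if st: "s < N * n" "t < N * n" for s t
  proof -
    have "s div n < N" "t div n < N" using st by (simp_all add: less_mult_imp_div_less)
    then show ?thesis using st assms unfolding A_mat_def
      by (auto intro!: continuous_intros)
  qed
  then show ?thesis by (simp add: cont_mat_def A_mat_def)
qed

lemma mat_adjoint_A_mat:
  assumes "\<And>i j. i < N \<Longrightarrow> j < N \<Longrightarrow> \<pi> (\<gamma> i j) \<in> carrier_mat n n"
    and "\<And>i j. i < N \<Longrightarrow> j < N \<Longrightarrow> \<pi> (\<gamma> j i) = mat_adjoint (\<pi> (\<gamma> i j))"
  shows "mat_adjoint (A_mat N n \<phi> \<gamma> \<pi> x) = A_mat N n \<phi> \<gamma> \<pi> x"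
proof (rule eq_matI)
  fix s t assume "s < dim_row (A_mat N n \<phi> \<gamma> \<pi> x)" "t < dim_col (A_mat N n \<phi> \<gamma> \<pi> x)"
  then have st: "s < N * n" "t < N * n" by (simp_all add: A_mat_def)
  then have "0 < n" by (cases n) auto
  with st have d: "s div n < N" "t div n < N" "s mod n < n" "t mod n < n"
    by (simp_all add: less_mult_imp_div_less)
  then show "mat_adjoint (A_mat N n \<phi> \<gamma> \<pi> x) $$ (s, t) = A_mat N n \<phi> \<gamma> \<pi> x $$ (s, t)"
    using st assms(1)[OF d(2,1)] assms(2)[OF d(2,1)] by (simp add: A_mat_def mult.commute)
qed (simp_all add: A_mat_def)

lemma A_mat_eq_block_mat: "A_mat N n \<phi> \<gamma> \<pi> x = block_mat N n (\<lambda>i. \<phi> i x) (\<lambda>i j. \<pi> (\<gamma> i j))"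
  by (simp add: A_mat_def block_mat_def)

lemma K0_class_E11: "K0_class X (\<lambda>_. E11 k) \<in> carrier (K0 X)"
proof (rule K0_class_in_carrier, rule spectral_projection_in_projections[where r = 0])
  have E: "E11 k \<in> carrier_mat (k + k) (k + k)" by (simp add: E11_def)
  then show "cont_mat X (k + k) (k + k) (\<lambda>_. E11 k)" by (rule cont_mat_const)
  have zero: "mat_adjoint (0\<^sub>m k k) = (0\<^sub>m k k :: complex mat)" by (rule eq_matI) auto
  show "mat_adjoint (E11 k) = E11 k" unfolding E11_def
    by (subst mat_adjoint_four_block[of _ k]) (simp_all add: mat_adjoint_one zero)
  have "E11 k * E11 k = E11 k" unfolding E11_def
    by (subst mult_diag_block[of _ k k _ k k _ k _ k]) simp_all
  then have "E11 k * E11 k - E11 k = 0\<^sub>m (k + k) (k + k)" using E by simp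
  moreover have "op_norm (0\<^sub>m (k + k) (k + k)) \<le> 0"
  proof (rule op_norm_leI)
    fix v :: "complex vec" assume "v \<in> carrier_vec (dim_col (0\<^sub>m (k + k) (k + k) :: complex mat))"
    then have "0\<^sub>m (k + k) (k + k) *\<^sub>v v = 0\<^sub>v (k + k)" by (intro eq_vecI) auto
    then show "vec_l2norm (0\<^sub>m (k + k) (k + k) *\<^sub>v v) \<le> 0" by (simp add: vec_l2norm_def L2_set_def)
  qed
  ultimately show "op_norm (E11 k * E11 k - E11 k) \<le> 0" by simp
qed simp_all

lemma almost_projection_K0_class:
  assumes X: "X \<noteq> {}" and P: "cont_mat X k k P" "\<And>x. x \<in> X \<Longrightarrow> mat_adjoint (P x) = P x"
    and le: "\<And>x. x \<in> X \<Longrightarrow> op_norm (P x * P x - P x) \<le> r" and r: "0 \<le> r" "r < 1/4"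
  shows "almost_projection X k P" "K0_class X P \<in> carrier (K0 X)"
proof -
  have "sup_op_norm X (\<lambda>x. P x * P x - P x) \<le> r"
    unfolding sup_op_norm_def by (rule cSUP_least[OF X le])
  then show "almost_projection X k P" using P r by (simp add: almost_projection_def)
  show "K0_class X P \<in> carrier (K0 X)"
    by (rule K0_class_in_carrier[OF spectral_projection_in_projections[OF P le r]])
qed

theorem mainTheorem2:
  fixes X :: "'a::t2_space set" and x0 :: 'a
    and G :: "('g, 'b) monoid_scheme"
    and N :: nat and U :: "nat \<Rightarrow> 'a set"
    and \<phi> :: "nat \<Rightarrow> 'a \<Rightarrow> real" and \<gamma> :: "nat \<Rightarrow> nat \<Rightarrow> 'g"
  assumes "compact X" and "x0 \<in> X"
    and "finitely_generated_group G" and "fundamental_group X x0 \<cong> G"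
    and "\<And>i. i < N \<Longrightarrow> openin (top_of_set X) (U i)" and "(\<Union>i<N. U i) = X"
    and "\<And>i. i < N \<Longrightarrow> continuous_on X (\<phi> i)"
    and "\<And>i x. i < N \<Longrightarrow> x \<in> X \<Longrightarrow> 0 \<le> \<phi> i x \<and> \<phi> i x \<le> 1"
    and "\<And>i. i < N \<Longrightarrow> closure {x \<in> X. \<phi> i x \<noteq> 0} \<subseteq> U i"
    and "\<And>x. x \<in> X \<Longrightarrow> (\<Sum>i<N. (\<phi> i x)\<^sup>2) = 1"
    and "\<And>i j. i < N \<Longrightarrow> j < N \<Longrightarrow> \<gamma> i j \<in> carrier G"
    and "\<And>i j. i < N \<Longrightarrow> j < N \<Longrightarrow> \<gamma> j i = inv\<^bsub>G\<^esub> (\<gamma> i j)"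
    and "\<And>i j k. i < N \<Longrightarrow> j < N \<Longrightarrow> k < N \<Longrightarrow> U i \<inter> U j \<inter> U k \<noteq> {} \<Longrightarrow>
           \<gamma> i j \<otimes>\<^bsub>G\<^esub> \<gamma> j k = \<gamma> i k"
  shows "\<exists>F0 \<epsilon>0. finite F0 \<and> F0 \<subseteq> carrier G \<and> 0 < \<epsilon>0 \<and>
    (\<forall>F \<epsilon> n \<pi>p \<pi>m.
       finite F \<and> F0 \<subseteq> F \<and> F \<subseteq> carrier G \<and> 0 < \<epsilon> \<and> \<epsilon> \<le> \<epsilon>0 \<and>
       balanced_pair G n F \<epsilon> \<pi>p \<pi>m \<longrightarrow>
       (let P = (\<lambda>x. P2 (A_mat N n \<phi> \<gamma> \<pi>p x) (A_mat N n \<phi> \<gamma> \<pi>m x));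
            E = (\<lambda>_. E11 (N * n))
        in almost_projection X (2 * (N * n)) P \<and>
           K0_class X P \<in> carrier (K0 X) \<and> K0_class X E \<in> carrier (K0 X) \<and>
           K0_class X P \<otimes>\<^bsub>K0 X\<^esub> inv\<^bsub>K0 X\<^esub> K0_class X E \<in> carrier (K0 X)))"
proof -
  \<comment> \<open>every defect that enters the blocks is a defect at two values of \<open>\<gamma>\<close>\<close>
  define F0 where "F0 = (\<lambda>(i, j). \<gamma> i j) ` ({..<N} \<times> {..<N})"
  have F0: "\<gamma> i j \<in> F0" if "i < N" "j < N" for i j using that by (force simp: F0_def)
  have cocycle: "\<gamma> i j \<otimes>\<^bsub>G\<^esub> \<gamma> j k = \<gamma> i k"
    if "x \<in> X" "i < N" "j < N" "k < N" "\<phi> i x \<noteq> 0" "\<phi> j x \<noteq> 0" "\<phi> k x \<noteq> 0" for x i j k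
  proof -
    have "x \<in> U l" if "l < N" "\<phi> l x \<noteq> 0" for l
      using assms(9)[OF that(1)] closure_subset[of "{x \<in> X. \<phi> l x \<noteq> 0}"] that \<open>x \<in> X\<close> by auto
    then show ?thesis using that assms(13)[of i j k] by blast
  qed
  show ?thesis
  \<comment> \<open>\<open>1/16000\<close> is chosen to make \<open>3052 \<epsilon> < 1/4\<close>\<close>
  proof (intro exI[of _ F0] exI[of _ "1/16000"] conjI allI impI)
    show "finite F0" by (simp add: F0_def)
    show "F0 \<subseteq> carrier G" using assms(11) by (auto simp: F0_def)
    show "(0::real) < 1/16000" by simp
    fix F \<epsilon> n and \<pi>p \<pi>m :: "'g \<Rightarrow> complex mat"
    assume *: "finite F \<and> F0 \<subseteq> F \<and> F \<subseteq> carrier G \<and> 0 < \<epsilon> \<and> \<epsilon> \<le> 1/16000 \<and> balanced_pair G n F \<epsilon> \<pi>p \<pi>m"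
    then have F: "\<gamma> i j \<in> F" if "i < N" "j < N" for i j using F0[OF that] by blast
    have \<epsilon>: "0 \<le> \<epsilon>" "\<epsilon> \<le> 1" "3052 * \<epsilon> < 1/4" using * by auto
    have bal: "balanced_pair G n F \<epsilon> \<pi>p \<pi>m" using * by simp
    have car: "\<pi>p (\<gamma> i j) \<in> carrier_mat n n" "\<pi>m (\<gamma> i j) \<in> carrier_mat n n" if "i < N" "j < N" for i j
      using bal assms(11)[OF that] unfolding balanced_pair_def by blast+
    have adj: "\<pi>p (\<gamma> j i) = mat_adjoint (\<pi>p (\<gamma> i j))" "\<pi>m (\<gamma> j i) = mat_adjoint (\<pi>m (\<gamma> i j))"
      if "i < N" "j < N" for i j
      using bal F[OF that] assms(12)[OF that] unfolding balanced_pair_def by auto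
    let ?a = "A_mat N n \<phi> \<gamma> \<pi>p" and ?b = "A_mat N n \<phi> \<gamma> \<pi>m"
    let ?P = "\<lambda>x. P2 (?a x) (?b x)"
    have ac: "?a x \<in> carrier_mat (N * n) (N * n)" "?b x \<in> carrier_mat (N * n) (N * n)" for x
      by (simp_all add: A_mat_def)
    have aa: "mat_adjoint (?a x) = ?a x" "mat_adjoint (?b x) = ?b x" for x
      by (rule mat_adjoint_A_mat; (rule car | rule adj); assumption)+
    have cont: "cont_mat X (N * n + N * n) (N * n + N * n) ?P"
      using assms(7) by (intro cont_mat_P2 cont_mat_A_mat)
    have defect: "op_norm (?P x * ?P x - ?P x) \<le> 3052 * \<epsilon>" if x: "x \<in> X" for x
    proof -
      let ?p = "\<lambda>i j. \<pi>p (\<gamma> i j)" and ?m = "\<lambda>i j. \<pi>m (\<gamma> i j)" and ?\<phi> = "\<lambda>i. \<phi> i x"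
      have D: "cocycle_defect ?p i j k = mult_defect G \<pi>p (\<gamma> i j) (\<gamma> j k)"
        "cocycle_defect ?m i j k = mult_defect G \<pi>m (\<gamma> i j) (\<gamma> j k)"
        if "i < N" "j < N" "k < N" "\<phi> i x \<noteq> 0" "\<phi> j x \<noteq> 0" "\<phi> k x \<noteq> 0" for i j k
        using cocycle[OF x that] by (simp_all add: cocycle_defect_def mult_defect_def)
      have bnd: "bounded_by (act A) \<epsilon>" if "A \<in> carrier_mat n n" "op_norm A < \<epsilon>" for A
        using bounded_by_mono[OF bounded_by_op_norm[OF that(1)]] that(2) by simp
      have 1: "bounded_by (act (cocycle_defect ?p i j k - cocycle_defect ?m i j k)) \<epsilon>"
        if ijk: "i < N" "j < N" "k < N" "\<phi> i x \<noteq> 0" "\<phi> j x \<noteq> 0" "\<phi> k x \<noteq> 0" for i j k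
      proof (rule bnd)
        show "cocycle_defect ?p i j k - cocycle_defect ?m i j k \<in> carrier_mat n n"
          using ijk car by (intro minus_carrier_mat cocycle_defect_carrier) auto
        show "op_norm (cocycle_defect ?p i j k - cocycle_defect ?m i j k) < \<epsilon>"
          unfolding D[OF ijk] using bal F[OF ijk(1,2)] F[OF ijk(2,3)] unfolding balanced_pair_def by blast
      qed
      have 2: "bounded_by (act (?p i j * cocycle_defect ?p j l k - ?m i j * cocycle_defect ?m j l k)) \<epsilon>"
        if ijk: "i < N" "j < N" "l < N" "k < N" "\<phi> i x \<noteq> 0" "\<phi> j x \<noteq> 0" "\<phi> l x \<noteq> 0" "\<phi> k x \<noteq> 0" for i j l k
      proof (rule bnd)
        show "?p i j * cocycle_defect ?p j l k - ?m i j * cocycle_defect ?m j l k \<in> carrier_mat n n"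
          using ijk car by (intro minus_carrier_mat mult_carrier_mat[of _ n n] cocycle_defect_carrier) auto
        show "op_norm (?p i j * cocycle_defect ?p j l k - ?m i j * cocycle_defect ?m j l k) < \<epsilon>"
          unfolding D[OF ijk(2,3,4,6,7,8)] using bal F[OF ijk(1,2)] F[OF ijk(2,3)] F[OF ijk(3,4)]
          unfolding balanced_pair_def by blast
      qed
      have nonneg: "0 \<le> \<phi> j x" if "j < N" for j using assms(8)[OF that x] by simp
      note bounds = block_mat_defect_bounds[of N ?\<phi> ?p n ?m \<epsilon>, OF nonneg assms(10)[OF x] car \<epsilon>(1) 1 2,
        folded A_mat_eq_block_mat]
      show ?thesis
        by (rule op_norm_P2_defect[OF ac(1) aa(1) ac(2) aa(2) \<epsilon>(1,2)]) (rule bounds; assumption)+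
    qed
    have "X \<noteq> {}" using assms(2) by blast
    note P = almost_projection_K0_class[OF this cont mat_adjoint_P2[OF ac(1) aa(1) ac(2) aa(2)] defect _ \<epsilon>(3)]
    have K: "K0_class X ?P \<in> carrier (K0 X)" "K0_class X (\<lambda>_. E11 (N * n)) \<in> carrier (K0 X)"
      using P(2) \<epsilon>(1) K0_class_E11 by auto
    interpret K0: comm_group "K0 X" by (rule comm_group_K0)
    show "let P = ?P; E = (\<lambda>_. E11 (N * n))
        in almost_projection X (2 * (N * n)) P \<and>
           K0_class X P \<in> carrier (K0 X) \<and> K0_class X E \<in> carrier (K0 X) \<and>
           K0_class X P \<otimes>\<^bsub>K0 X\<^esub> inv\<^bsub>K0 X\<^esub> K0_class X E \<in> carrier (K0 X)"
      unfolding Let_def using P(1) \<epsilon>(1) K by (simp add: mult_2)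
  qed
qed

end
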